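(* Let $p$ be an odd prime with $p\equiv 2\pmod 3$. Let $C$ be the genus $2$ curve $y^2=x^6+1$ over $\mathbb{F}_p$, and let $C'$ be its twist $Y^2=(aX+b)^6+(cX+d)^6$ over $\mathbb{F}_p$, where $\gamma\in\overline{\mathbb{F}}_p$ satisfies $\gamma^{p^2-1}=\zeta_3$ and $a=\gamma^p$, $b=\zeta_3^{-1}\gamma^p$, $c=\gamma$, $d=\zeta_3\gamma$, with isomorphism $\phi:C'\to C$, $\phi(X,Y)=\left(\frac{aX+b}{cX+d},\frac{Y}{(cX+d)^3}\right)$. Let $r$ be a prime different from $2$, $3$ and $p$, and let $e_r$ be a bilinear, non-degenerate, Galois-invariant pairing on $\mathrm{Jac}(C')[r]$. Then for all pairs $D_1,D_2$ of non-zero elements of $\mathrm{Jac}(C')[r]$ there exists an element $\psi$ of the ring $\phi^{-1}\,\mathbb{Z}[\pi_C,\chi,\rho_6]\,\phi$ such that $e_r(D_1,\psi(D_2))\neq 1$.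
   Context: $\zeta_6\in\overline{\mathbb{F}}_p$ is a primitive sixth root of unity and $\zeta_3=\zeta_6^2$. $\pi_C$ is the $p$-power Frobenius on $C$; $\chi$ and $\rho_6$ are the automorphisms of $C$ given by $\chi(x,y)=(1/x,\,y/x^3)$ and $\rho_6(x,y)=(\zeta_6x,\,y)$; the same notation is used for the induced endomorphisms of $\mathrm{Jac}(C)$. $\mathbb{Z}[\pi_C,\chi,\rho_6]$ is the (non-commutative) subring of $\mathrm{End}(\mathrm{Jac}(C))$ (endomorphisms over $\overline{\mathbb{F}}_p$) generated by these three endomorphisms. The isomorphism $\phi$ also denotes the induced isomorphism $\mathrm{Jac}(C')\to\mathrm{Jac}(C)$, so $\phi^{-1}\mathbb{Z}[\pi_C,\chi,\rho_6]\phi$ is a subring of $\mathrm{End}(\mathrm{Jac}(C'))$. $\mathrm{Jac}(C')[r]$ is the $r$-torsion over $\overline{\mathbb{F}}_p$. A pairing $e_r$ is a map $\mathrm{Jac}(C')[r]\times\mathrm{Jac}(C')[r]\to\mu_r$, with $\mu_r$ the $r$-th roots of unity in $\overline{\mathbb{F}}_p$; non-degenerate means that for each non-zero $D_1$ there is $D_2$ with $e_r(D_1,D_2)\neq1$. *)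

theory Defs
  imports
    "HOL-Algebra.Free_Abelian_Groups"
    "HOL-Algebra.Generated_Rings"
    "HOL-Library.Poly_Mapping"
    "HOL-Computational_Algebra.Computational_Algebra"
    "HOL-Number_Theory.Cong"
begin

section \<open>The base field\<close>

text \<open>
  The type \<open>'k\<close> is an algebraic closure of the field with \<open>p\<close> elements. In characteristic
  \<open>p\<close>, the prime subfield is \<open>range of_nat\<close>.
\<close>

definition is_algebraic_closure_of_Fp :: "'k::alg_closed_field itself \<Rightarrow> nat \<Rightarrow> bool" where
  "is_algebraic_closure_of_Fp T p \<longleftrightarrow>
     CHAR('k) = p \<and>
     (\<forall>x::'k. \<exists>q. q \<noteq> 0 \<and> (\<forall>i. coeff q i \<in> range of_nat) \<and> poly q x = 0)"

text \<open>
  Every automorphism of an algebraic closure of the prime field fixes the prime field, so these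
  are precisely the elements of the absolute Galois group of the prime field.
\<close>

definition field_automorphism :: "('k::field \<Rightarrow> 'k) \<Rightarrow> bool" where
  "field_automorphism \<sigma> \<longleftrightarrow>
     bij \<sigma> \<and> (\<forall>x y. \<sigma> (x + y) = \<sigma> x + \<sigma> y) \<and> (\<forall>x y. \<sigma> (x * y) = \<sigma> x * \<sigma> y)"

definition primitive_root_of_unity :: "nat \<Rightarrow> 'k::field \<Rightarrow> bool" where
  "primitive_root_of_unity n z \<longleftrightarrow> z ^ n = 1 \<and> (\<forall>k. 0 < k \<and> k < n \<longrightarrow> z ^ k \<noteq> 1)"


section \<open>Points of genus 2 curves\<close>

text \<open>
  For \<open>f\<close> of degree at most \<open>6\<close>, the projective model of \<open>y\<^sup>2 = f(x)\<close> is the curve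
  \<open>Y\<^sup>2 = \<Sum>i\<le>6. f\<^sub>i X\<^sup>i Z\<^bsup>6-i\<^esup>\<close> in the weighted projective plane with weights \<open>(1,3,1)\<close>, where
  \<open>x = X/Z\<close> and \<open>y = Y/Z\<^sup>3\<close>; it is the smooth projective model whenever it is smooth. The point
  \<open>Aff x y\<close> is \<open>[x : y : 1]\<close> and the point \<open>Inf w\<close> is \<open>[1 : w : 0]\<close>.
\<close>

datatype 'k curve_point = Aff 'k 'k | Inf 'k

definition curve_points :: "'k::field poly \<Rightarrow> 'k curve_point set" where
  "curve_points f = {Aff x y | x y. y ^ 2 = poly f x} \<union> {Inf w | w. w ^ 2 = coeff f 6}"

text \<open>The point \<open>[X : Y : Z]\<close>, for \<open>(X, Z) \<noteq> (0, 0)\<close>\<close>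

definition weighted_point :: "'k::field \<Rightarrow> 'k \<Rightarrow> 'k \<Rightarrow> 'k curve_point" where
  "weighted_point X Y Z = (if Z = 0 then Inf (Y / X ^ 3) else Aff (X / Z) (Y / Z ^ 3))"

text \<open>
  The map \<open>(x, y) \<mapsto> ((a x + b) / (c x + d), y / (c x + d)\<^sup>3)\<close>, extended to all points as
  \<open>[X : Y : Z] \<mapsto> [a X + b Z : Y : c X + d Z]\<close>.
\<close>

fun moebius :: "'k::field \<Rightarrow> 'k \<Rightarrow> 'k \<Rightarrow> 'k \<Rightarrow> 'k curve_point \<Rightarrow> 'k curve_point" where
  "moebius a b c d (Aff x y) = weighted_point (a * x + b) y (c * x + d)"
| "moebius a b c d (Inf w) = weighted_point a w c"

definition chi_point :: "'k::field curve_point \<Rightarrow> 'k curve_point" where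
  "chi_point = moebius 0 1 1 0"

definition rho_point :: "'k::field \<Rightarrow> 'k curve_point \<Rightarrow> 'k curve_point" where
  "rho_point \<zeta> = moebius \<zeta> 0 0 1"

definition frobenius_point :: "nat \<Rightarrow> 'k::field curve_point \<Rightarrow> 'k curve_point" where
  "frobenius_point p = map_curve_point (\<lambda>x. x ^ p)"


section \<open>Orders of vanishing\<close>

text \<open>
  A polynomial in two variables \<open>x\<close> (inner) and \<open>y\<close> (outer) is an element of \<open>'k poly poly\<close>.
\<close>

definition poly2 :: "'k::field poly poly \<Rightarrow> 'k \<Rightarrow> 'k \<Rightarrow> 'k" where
  "poly2 g x y = poly (poly g [:y:]) x"

text \<open>
  The image of \<open>g\<close> in the local ring at \<open>(x0, y0)\<close> of the affine plane curve \<open>W = 0\<close> lies in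
  the \<open>d\<close>-th power of the maximal ideal. That power is generated by the monomials of degree \<open>d\<close>
  in \<open>x - x0\<close> and \<open>y - y0\<close>, and \<open>s\<close> is a denominator, a unit of the local ring.
\<close>

definition vanishes_to_order ::
  "'k::field poly poly \<Rightarrow> 'k \<Rightarrow> 'k \<Rightarrow> nat \<Rightarrow> 'k poly poly \<Rightarrow> bool" where
  "vanishes_to_order W x0 y0 d g \<longleftrightarrow>
     (\<exists>s c q. poly2 s x0 y0 \<noteq> 0 \<and>
        s * g = (\<Sum>i\<le>d. c i * [:[:- x0, 1:]:] ^ i * [:[:- y0:], 1:] ^ (d - i)) + q * W)"

definition vanishing_order ::
  "'k::field poly poly \<Rightarrow> 'k \<Rightarrow> 'k \<Rightarrow> 'k poly poly \<Rightarrow> nat" where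
  "vanishing_order W x0 y0 g = (GREATEST d. vanishes_to_order W x0 y0 d g)"

definition curve_equation :: "'k::field poly \<Rightarrow> 'k poly poly" where
  "curve_equation f = [:- f, 0, 1:]"

text \<open>
  A polynomial \<open>g\<close> of weighted degree at most \<open>n\<close> (\<open>x\<close> of weight \<open>1\<close>, \<open>y\<close> of weight \<open>3\<close>) stands
  for the weighted homogeneous polynomial \<open>G = Z\<^sup>n g(X/Z, Y/Z\<^sup>3)\<close> of degree \<open>n\<close>. Then
  \<open>other_chart n g\<close> is \<open>G(1, w, z)\<close>, with \<open>z\<close> as the inner and \<open>w\<close> as the outer variable.
\<close>

definition weighted_degree_le :: "nat \<Rightarrow> 'k::field poly poly \<Rightarrow> bool" where
  "weighted_degree_le n g \<longleftrightarrow> (\<forall>i j. coeff (coeff g j) i \<noteq> 0 \<longrightarrow> i + 3 * j \<le> n)"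

definition other_chart :: "nat \<Rightarrow> 'k::field poly poly \<Rightarrow> 'k poly poly" where
  "other_chart n g =
     (\<Sum>j\<le>degree g. \<Sum>i\<le>degree (coeff g j).
        monom (monom (coeff (coeff g j) i) (n - (i + 3 * j))) j)"

text \<open>
  The order of vanishing at a point of \<open>y\<^sup>2 = f(x)\<close> of the weighted homogeneous polynomial of
  degree \<open>n\<close> given by \<open>g\<close>. The curve itself has weighted degree \<open>6\<close>.
\<close>

fun order_at :: "'k::field poly \<Rightarrow> nat \<Rightarrow> 'k poly poly \<Rightarrow> 'k curve_point \<Rightarrow> nat" where
  "order_at f n g (Aff x y) = vanishing_order (curve_equation f) x y g"
| "order_at f n g (Inf w) =
     vanishing_order (other_chart 6 (curve_equation f)) 0 w (other_chart n g)"


section \<open>The Jacobian\<close>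

definition divisor_degree :: "('a \<Rightarrow>\<^sub>0 int) \<Rightarrow> int" where
  "divisor_degree D = (\<Sum>P\<in>Poly_Mapping.keys D. Poly_Mapping.lookup D P)"

definition degree_zero_divisors ::
  "'k::field poly \<Rightarrow> ('k curve_point \<Rightarrow>\<^sub>0 int) monoid" where
  "degree_zero_divisors f = (free_Abelian_group (curve_points f))
     \<lparr>carrier := {D \<in> carrier (free_Abelian_group (curve_points f)). divisor_degree D = 0}\<rparr>"

text \<open>
  Each non-zero rational function on the curve is a quotient \<open>g / h\<close> of polynomials in \<open>x\<close> and \<open>y\<close>
  that do not vanish identically on the curve, that is, a quotient of two weighted homogeneous
  polynomials of a common degree \<open>n\<close>.
\<close>

definition principal_divisors :: "'k::field poly \<Rightarrow> ('k curve_point \<Rightarrow>\<^sub>0 int) set" where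
  "principal_divisors f =
     {D \<in> carrier (free_Abelian_group (curve_points f)). \<exists>n g h.
        weighted_degree_le n g \<and> \<not> curve_equation f dvd g \<and>
        weighted_degree_le n h \<and> \<not> curve_equation f dvd h \<and>
        (\<forall>P\<in>curve_points f.
           Poly_Mapping.lookup D P = int (order_at f n g P) - int (order_at f n h P))}"

text \<open>The group of points of the Jacobian over the algebraically closed field \<open>'k\<close>\<close>

definition Jac :: "'k::field poly \<Rightarrow> ('k curve_point \<Rightarrow>\<^sub>0 int) set monoid" where
  "Jac f = degree_zero_divisors f Mod principal_divisors f"

text \<open>
  The homomorphism from \<open>Jac f\<close> to \<open>Jac f'\<close> induced by a map \<open>s\<close> on points. The class of a divisor
  \<open>\<Sum>n\<^sub>P P\<close> is sent to the class of \<open>\<Sum>n\<^sub>P s(P)\<close>.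
\<close>

definition push_divisor :: "('a \<Rightarrow> 'b) \<Rightarrow> ('a \<Rightarrow>\<^sub>0 int) \<Rightarrow> ('b \<Rightarrow>\<^sub>0 int)" where
  "push_divisor s = frag_extend (\<lambda>P. frag_of (s P))"

definition Jac_map ::
  "'k::field poly \<Rightarrow> 'k poly \<Rightarrow> ('k curve_point \<Rightarrow> 'k curve_point) \<Rightarrow>
   ('k curve_point \<Rightarrow>\<^sub>0 int) set \<Rightarrow> ('k curve_point \<Rightarrow>\<^sub>0 int) set" where
  "Jac_map f f' s =
     (\<lambda>D\<in>carrier (Jac f). principal_divisors f' <#>\<^bsub>degree_zero_divisors f'\<^esub> (push_divisor s ` D))"


section \<open>Endomorphism rings\<close>

text \<open>
  Endomorphisms are extensional functions. An endomorphism of an abelian variety over an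
  algebraically closed field is determined by its action on the group of points, so the ring of
  endomorphisms of a Jacobian is a subring of the endomorphism ring of the abelian group of its
  points, and the subring generated by given endomorphisms may be formed in the latter.
\<close>

definition End_ring :: "('a, 'm) monoid_scheme \<Rightarrow> ('a \<Rightarrow> 'a) ring" where
  "End_ring G =
     \<lparr>carrier = hom G G \<inter> extensional (carrier G),
      monoid.mult = (\<lambda>u v. compose (carrier G) u v),
      one = (\<lambda>x\<in>carrier G. x),
      zero = (\<lambda>x\<in>carrier G. \<one>\<^bsub>G\<^esub>),
      add = (\<lambda>u v. \<lambda>x\<in>carrier G. u x \<otimes>\<^bsub>G\<^esub> v x)\<rparr>"

text \<open>
  The set of all \<open>\<phi>\<inverse> \<circ> \<alpha> \<circ> \<phi>\<close> with \<open>\<alpha>\<close> in \<open>A\<close>, for an isomorphism \<open>\<phi>\<close> from \<open>G\<close> onto another group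
  and a set \<open>A\<close> of endomorphisms of the latter.
\<close>

definition conjugate_endos ::
  "('a, 'm) monoid_scheme \<Rightarrow> ('a \<Rightarrow> 'b) \<Rightarrow> ('b \<Rightarrow> 'b) set \<Rightarrow> ('a \<Rightarrow> 'a) set" where
  "conjugate_endos G \<phi> A =
     (\<lambda>\<alpha>. \<lambda>x\<in>carrier G. inv_into (carrier G) \<phi> (\<alpha> (\<phi> x))) ` A"


section \<open>Pairings on torsion subgroups\<close>

definition torsion :: "('a, 'm) monoid_scheme \<Rightarrow> nat \<Rightarrow> 'a set" where
  "torsion G r = {D \<in> carrier G. D [^]\<^bsub>G\<^esub> r = \<one>\<^bsub>G\<^esub>}"

definition torsion_pairing ::
  "('a, 'm) monoid_scheme \<Rightarrow> nat \<Rightarrow> ('a \<Rightarrow> 'a \<Rightarrow> 'k::field) \<Rightarrow> bool" where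
  "torsion_pairing G r e \<longleftrightarrow> (\<forall>D1\<in>torsion G r. \<forall>D2\<in>torsion G r. e D1 D2 ^ r = 1)"

definition bilinear_pairing ::
  "('a, 'm) monoid_scheme \<Rightarrow> nat \<Rightarrow> ('a \<Rightarrow> 'a \<Rightarrow> 'k::field) \<Rightarrow> bool" where
  "bilinear_pairing G r e \<longleftrightarrow>
     (\<forall>D\<in>torsion G r. \<forall>D'\<in>torsion G r. \<forall>E\<in>torsion G r.
        e (D \<otimes>\<^bsub>G\<^esub> D') E = e D E * e D' E \<and> e E (D \<otimes>\<^bsub>G\<^esub> D') = e E D * e E D')"

definition nondegenerate_pairing ::
  "('a, 'm) monoid_scheme \<Rightarrow> nat \<Rightarrow> ('a \<Rightarrow> 'a \<Rightarrow> 'k::field) \<Rightarrow> bool" where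
  "nondegenerate_pairing G r e \<longleftrightarrow>
     (\<forall>D1\<in>torsion G r. D1 \<noteq> \<one>\<^bsub>G\<^esub> \<longrightarrow> (\<exists>D2\<in>torsion G r. e D1 D2 \<noteq> 1))"

text \<open>
  Here \<open>f\<close> has coefficients in the prime field, so that automorphisms of \<open>'k\<close> act on the points
  of the curve \<open>y\<^sup>2 = f(x)\<close> and on its Jacobian.
\<close>

definition Galois_invariant_pairing ::
  "'k::field poly \<Rightarrow> nat \<Rightarrow>
   (('k curve_point \<Rightarrow>\<^sub>0 int) set \<Rightarrow> ('k curve_point \<Rightarrow>\<^sub>0 int) set \<Rightarrow> 'k) \<Rightarrow> bool" where
  "Galois_invariant_pairing f r e \<longleftrightarrow>
     (\<forall>\<sigma>. field_automorphism \<sigma> \<longrightarrow>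
        (\<forall>D1\<in>torsion (Jac f) r. \<forall>D2\<in>torsion (Jac f) r.
           e (Jac_map f f (map_curve_point \<sigma>) D1) (Jac_map f f (map_curve_point \<sigma>) D2)
           = \<sigma> (e D1 D2)))"


section \<open>The curve, its twist and the endomorphisms\<close>

definition C_sextic :: "'k::field poly" where
  "C_sextic = [:0, 1:] ^ 6 + 1"

definition twist_sextic :: "'k::field \<Rightarrow> 'k \<Rightarrow> 'k \<Rightarrow> 'k \<Rightarrow> 'k poly" where
  "twist_sextic a b c d = [:b, a:] ^ 6 + [:d, c:] ^ 6"

definition Z_pi_chi_rho ::
  "nat \<Rightarrow> 'k::field \<Rightarrow> (('k curve_point \<Rightarrow>\<^sub>0 int) set \<Rightarrow> ('k curve_point \<Rightarrow>\<^sub>0 int) set) set" where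
  "Z_pi_chi_rho p \<zeta> =
     generate_ring (End_ring (Jac C_sextic))
       {Jac_map C_sextic C_sextic (frobenius_point p),
        Jac_map C_sextic C_sextic chi_point,
        Jac_map C_sextic C_sextic (rho_point \<zeta>)}"

end

theory Submission
  imports Defs "HOL-Computational_Algebra.Formal_Laurent_Series"
begin

text \<open>
  Let \<open>V\<close> be the \<open>r\<close>-torsion of the Jacobian of \<open>C : y\<^sup>2 = x\<^sup>6 + 1\<close> and \<open>R\<close> the ring generated by
  the Frobenius \<open>\<pi>\<close>, by \<open>\<chi>\<close> and by \<open>\<rho>\<close>. The reason for the theorem is that \<open>V\<close> is an irreducible
  \<open>R\<close>-module (\<open>torsion_irreducible\<close>): \<open>R\<close> carries each of its non-zero elements to each
  of its elements. The isomorphism \<open>\<phi>\<close> transports this to the twist (\<open>orbit_contains_torsion_twist\<close>).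
  Given \<open>D\<^sub>1\<close> and \<open>D\<^sub>2\<close>, non-degeneracy yields a torsion point \<open>E\<close> that pairs non-trivially with
  \<open>D\<^sub>1\<close>, and some \<open>\<psi>\<close> in the conjugated ring sends \<open>D\<^sub>2\<close> to \<open>E\<close>.

  Irreducibility is first reduced to an elliptic curve. The involution \<open>\<epsilon> = \<rho>\<^sup>3\<close>, that is,
  \<open>(x, y) \<mapsto> (- x, y)\<close>, splits \<open>V\<close> into two eigenspaces, as \<open>r\<close> is odd. The involution \<open>\<chi>\<close>
  exchanges them, because \<open>\<chi> \<epsilon> \<chi>\<close> is \<open>\<epsilon>\<close> followed by the hyperelliptic involution, which acts as
  \<open>- 1\<close>. The fixed space \<open>V\<^sub>+\<close> of \<open>\<epsilon>\<close> comes from the quotient \<open>v\<^sup>2 = u\<^sup>3 + 1\<close> with \<open>u = x\<^sup>2\<close> and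
  \<open>v = y\<close>: its elements are classes of pullbacks of points (\<open>symmetric_divisor\<close>), distinct points
  have distinct classes (\<open>point_divisor_inj\<close>), and lines give the group law (\<open>line_divisor\<close>).

  On \<open>V\<^sub>+\<close> one has \<open>1 + \<rho> + \<rho>\<^sup>2 = 0\<close> and \<open>\<pi> \<rho> = \<rho>\<^sup>-\<^sup>1 \<pi>\<close>. Hence no non-zero \<open>x\<close> is an eigenvector of
  both \<open>\<rho>\<close> and \<open>\<pi>\<close> (\<open>not_both_eigenvector\<close>), so a non-zero submodule of \<open>V\<^sub>+\<close> has at least \<open>r\<^sup>2\<close>
  elements, and a proper one would force \<open>V\<^sub>+\<close> to have at least \<open>2 r\<^sup>2\<close> elements. But \<open>V\<^sub>+\<close> has fewer
  (\<open>torsion_points_bound\<close>): a polynomial of degree less than \<open>r\<^sup>2 - 1\<close>, built from a recursion for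
  the abscissae of the multiples of a point, vanishes at the abscissae of all its non-zero elements.

  To compute with orders of vanishing, each point of a curve is given a parametrisation by power
  series in a variable \<open>t\<close>. The order of a function at the point is then the order in \<open>t\<close> of a
  Laurent series (\<open>vanishing_order_eq_subdegree\<close>, \<open>principal_divisors_iff\<close>). Moebius transformations
  map parametrisations to parametrisations, hence principal divisors to principal divisors
  (\<open>moebius_push_principal\<close>). Pairing a function with its conjugate under \<open>y \<mapsto> - y\<close> reduces the
  remaining questions, the degree of principal divisors and the functions with few poles, to
  polynomials in \<open>x\<close> (\<open>principal_degree\<close>, \<open>function_of_x\<close>).
\<close>

section \<open>Polynomials evaluated at Laurent series\<close>

lemma poly_map_hom_add:
  fixes h :: "'a::comm_ring_1 \<Rightarrow> 'b::comm_ring_1"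
  assumes "h 0 = 0" "\<And>a b. h (a + b) = h a + h b"
  shows "map_poly h (p + q) = map_poly h p + map_poly h q"
  by (intro poly_eqI) (simp add: coeff_map_poly assms)

lemma poly_map_hom_mult:
  fixes h :: "'a::comm_ring_1 \<Rightarrow> 'b::comm_ring_1"
  assumes "h 0 = 0" "\<And>a b. h (a + b) = h a + h b" "\<And>a b. h (a * b) = h a * h b"
  shows "map_poly h (p * q) = map_poly h p * map_poly h q"
proof (intro poly_eqI)
  fix n
  have sum: "h (sum F A) = (\<Sum>i\<in>A. h (F i))" for F and A :: "nat set"
    by (induction A rule: infinite_finite_induct) (simp_all add: assms)
  show "coeff (map_poly h (p * q)) n = coeff (map_poly h p * map_poly h q) n"
    by (simp add: coeff_map_poly coeff_mult assms sum)
qed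

definition lift :: "'k::field poly \<Rightarrow> 'k fls \<Rightarrow> 'k fls" where
  "lift q x = poly (map_poly fls_const q) x"

definition ev :: "'k::field poly poly \<Rightarrow> 'k fls \<Rightarrow> 'k fls \<Rightarrow> 'k fls" where
  "ev g x y = poly (map_poly (\<lambda>q. lift q x) g) y"

lemma lift_0 [simp]: "lift 0 x = 0"
  and lift_1 [simp]: "lift 1 x = 1"
  and lift_pCons [simp]: "lift (pCons a q) x = fls_const a + x * lift q x"
  by (simp_all add: lift_def map_poly_pCons)

lemma lift_add [simp]: "lift (p + q) x = lift p x + lift q x"
  unfolding lift_def by (subst poly_map_hom_add) (simp_all add: fls_plus_const)

lemma lift_mult [simp]: "lift (p * q) x = lift p x * lift q x"
  unfolding lift_def by (subst poly_map_hom_mult) (simp_all add: fls_plus_const)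

lemma lift_uminus [simp]: "lift (- p) x = - lift p x"
  using lift_add[of p "- p" x] by (simp add: eq_neg_iff_add_eq_0 add.commute)

lemma lift_diff [simp]: "lift (p - q) x = lift p x - lift q x"
  using lift_add[of p "- q" x] by simp

lemma lift_power [simp]: "lift (p ^ n) x = lift p x ^ n"
  by (induction n) simp_all

lemma lift_smult [simp]: "lift (smult a p) x = fls_const a * lift p x"
  using lift_mult[of "[:a:]" p x] by simp

lemma lift_monom: "lift (monom a n) x = fls_const a * x ^ n"
  by (simp add: lift_def map_poly_monom poly_monom)

lemma lift_sum: "lift (sum F A) x = (\<Sum>i\<in>A. lift (F i) x)"
  by (induction A rule: infinite_finite_induct) simp_all

lemma ev_0 [simp]: "ev 0 x y = 0"
  and ev_1 [simp]: "ev 1 x y = 1"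
  and ev_pCons [simp]: "ev (pCons q g) x y = lift q x + y * ev g x y"
  by (simp_all add: ev_def map_poly_pCons)

lemma ev_add [simp]: "ev (p + q) x y = ev p x y + ev q x y"
  unfolding ev_def by (subst poly_map_hom_add) simp_all

lemma ev_mult [simp]: "ev (p * q) x y = ev p x y * ev q x y"
  unfolding ev_def by (subst poly_map_hom_mult) simp_all

lemma ev_uminus [simp]: "ev (- p) x y = - ev p x y"
  using ev_add[of p "- p" x y] by (simp add: eq_neg_iff_add_eq_0 add.commute)

lemma ev_power [simp]: "ev (p ^ n) x y = ev p x y ^ n"
  by (induction n) simp_all

lemma ev_monom: "ev (monom q n) x y = lift q x * y ^ n"
  by (simp add: ev_def map_poly_monom poly_monom)

lemma ev_sum: "ev (sum F A) x y = (\<Sum>i\<in>A. ev (F i) x y)"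
  by (induction A rule: infinite_finite_induct) simp_all

lemma ev_curve_equation [simp]: "ev (curve_equation f) x y = y ^ 2 - lift f x"
  by (simp add: curve_equation_def power2_eq_square)

text \<open>
  Phrased by coefficients, so that the zero series, whose subdegree is 0 by convention, lies in
  every step of the filtration by the order.
\<close>

definition vge :: "int \<Rightarrow> 'k::field fls \<Rightarrow> bool" where
  "vge n z \<longleftrightarrow> (\<forall>i<n. fls_nth z i = 0)"

lemma vge_0_right [simp]: "vge n 0"
  by (simp add: vge_def)

lemma vge_iff: "z \<noteq> 0 \<Longrightarrow> vge n z \<longleftrightarrow> n \<le> fls_subdegree z"
  unfolding vge_def by (meson fls_eq0_below_subdegree fls_subdegree_geI order.strict_trans2)

lemma vge_add: "vge n a \<Longrightarrow> vge n b \<Longrightarrow> vge n (a + b)"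
  by (simp add: vge_def)

lemma vge_diff: "vge n a \<Longrightarrow> vge n b \<Longrightarrow> vge n (a - b)"
  by (simp add: vge_def)

lemma vge_mono: "vge n a \<Longrightarrow> m \<le> n \<Longrightarrow> vge m a"
  by (simp add: vge_def)

lemma vge_mult: "vge m a \<Longrightarrow> vge n b \<Longrightarrow> vge (m + n) (a * b)"
proof (cases "a = 0 \<or> b = 0")
  case False
  assume "vge m a" "vge n b"
  thus ?thesis using False by (simp add: vge_iff)
qed auto

lemma vge_const [simp]: "vge 0 (fls_const c)"
  by (simp add: vge_def)

lemma vge_power: "vge n a \<Longrightarrow> vge (int k * n) (a ^ k)"
proof (induction k)
  case (Suc k)
  thus ?case using vge_mult[of n a "int k * n" "a ^ k"] by (simp add: algebra_simps)
qed (simp add: vge_def)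

lemma vge_sum: "(\<And>i. i \<in> A \<Longrightarrow> vge n (F i)) \<Longrightarrow> vge n (sum F A)"
  by (induction A rule: infinite_finite_induct) (simp_all add: vge_add)

lemma vge_0_mult: "vge n a \<Longrightarrow> vge 0 b \<Longrightarrow> vge n (a * b)"
  using vge_mult[of n a 0 b] by simp

lemma vge_0_mult': "vge 0 a \<Longrightarrow> vge n b \<Longrightarrow> vge n (a * b)"
  using vge_mult[of 0 a n b] by simp

lemma vge_lift: "vge 0 x \<Longrightarrow> vge 0 (lift q x)"
  by (induction q) (auto intro!: vge_add vge_0_mult)

lemma vge_ev: "vge 0 x \<Longrightarrow> vge 0 y \<Longrightarrow> vge 0 (ev g x y)"
  by (induction g) (auto intro!: vge_add vge_0_mult vge_lift)

lemma vge_1_approx: "vge 1 (z - fls_const c) \<Longrightarrow> vge 0 z"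
  by (auto simp: vge_def)

lemma vge_1_mult_approx:
  assumes "vge 1 (a - fls_const c)" "vge 1 (b - fls_const d)"
  shows "vge 1 (a * b - fls_const (c * d))"
proof -
  have "a * b - fls_const (c * d) = (a - fls_const c) * b + fls_const c * (b - fls_const d)"
    by (simp add: algebra_simps)
  also have "vge 1 \<dots>"
    using assms by (intro vge_add vge_0_mult vge_0_mult') (auto intro: vge_1_approx)
  finally show ?thesis .
qed

lemma vge_1_add_approx:
  assumes "vge 1 (a - fls_const c)" "vge 1 (b - fls_const d)"
  shows "vge 1 (a + b - fls_const (c + d))"
  using vge_add[OF assms] by (simp add: algebra_simps flip: fls_plus_const)

lemma lift_approx:
  assumes "vge 1 (x - fls_const x0)"
  shows "vge 1 (lift q x - fls_const (poly q x0))"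
proof (induction q)
  case (pCons a q)
  show ?case
    using vge_1_add_approx[OF _ vge_1_mult_approx[OF assms pCons(2)], of "fls_const a" a] by simp
qed simp

lemma ev_approx:
  assumes "vge 1 (x - fls_const x0)" "vge 1 (y - fls_const y0)"
  shows "vge 1 (ev g x y - fls_const (poly2 g x0 y0))"
proof (induction g)
  case (pCons q g)
  show ?case
    using vge_1_add_approx[OF lift_approx[OF assms(1)] vge_1_mult_approx[OF assms(2) pCons(2)], of q]
    by (simp add: poly2_def)
qed (simp add: poly2_def)

lemma approx_nonzero:
  assumes "vge 1 (z - fls_const c)" "c \<noteq> 0"
  shows "z \<noteq> 0 \<and> fls_subdegree z = 0"
proof -
  have "fls_nth z i = 0" if "i < 0" for i
    using assms(1) that by (auto simp: vge_def dest: spec[of _ i])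
  moreover have "fls_nth z 0 = c"
    using assms(1) by (auto simp: vge_def dest: spec[of _ 0])
  ultimately show ?thesis
    using assms(2) by (auto intro: fls_subdegree_eqI)
qed

lemma approx_nth: "vge 1 (z - fls_const c) \<Longrightarrow> fls_nth z 0 = c"
  by (auto simp: vge_def dest: spec[of _ 0])

lemma approx_zero: "vge 1 (z - fls_const c) \<Longrightarrow> vge 1 z \<longleftrightarrow> c = 0"
  by (auto simp: vge_def dest: spec[of _ 0] split: if_splits)

section \<open>Orders of vanishing at a smooth point\<close>

text \<open>
  The series \<open>x\<close> and \<open>y\<close> parametrise the curve around \<open>(x0, y0)\<close>, and \<open>t\<close> is a uniformiser:
  where \<open>y0 \<noteq> 0\<close> this means that \<open>x - x0\<close> is one, and at a ramification point that \<open>y\<close> is one.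
  In the second case the double zero of \<open>x - x0\<close> excludes a branch of a node.
\<close>

definition local_parameters :: "'k::field poly \<Rightarrow> 'k \<Rightarrow> 'k \<Rightarrow> 'k fls \<Rightarrow> 'k fls \<Rightarrow> bool" where
  "local_parameters f x0 y0 x y \<longleftrightarrow>
     y ^ 2 = lift f x \<and> vge 1 (x - fls_const x0) \<and> vge 1 (y - fls_const y0) \<and>
     (if y0 = 0 then vge 2 (x - fls_const x0) \<and> y \<noteq> 0 \<and> fls_subdegree y = 1
      else x - fls_const x0 \<noteq> 0 \<and> fls_subdegree (x - fls_const x0) = 1)"

lemma poly_dvd_split: "\<exists>k. f = [:poly f a:] + [:- a, 1:] * k" for f :: "'k::field poly"
  by (metis add.commute synthetic_div_correct' mult.commute)

lemma local_point_on_curve: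
  assumes "local_parameters f x0 y0 x y"
  shows "y0 ^ 2 = poly f x0"
proof -
  have "fls_nth (lift f x) 0 = poly f x0"
    using assms by (intro approx_nth lift_approx) (auto simp: local_parameters_def)
  moreover have "fls_nth (y * y) 0 = y0 * y0"
    using assms by (intro approx_nth vge_1_mult_approx) (auto simp: local_parameters_def)
  moreover have "y * y = lift f x"
    using assms by (simp add: local_parameters_def power2_eq_square)
  ultimately show ?thesis by (simp add: power2_eq_square)
qed

text \<open>
  The series \<open>y\<^sup>2 = f(x)\<close> has order exactly 2, and \<open>x - x0\<close> already contributes 2. So the
  cofactor is a unit.
\<close>

lemma local_simple_root:
  assumes "local_parameters f x0 0 x y"
  obtains u where "f = [:- x0, 1:] * u" "poly u x0 \<noteq> 0"
proof -
  have "poly f x0 = 0"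
    using local_point_on_curve[OF assms] by simp
  then obtain u where u: "f = [:- x0, 1:] * u"
    by (metis dvdE poly_eq_0_iff_dvd)
  have "poly u x0 \<noteq> 0"
  proof
    assume "poly u x0 = 0"
    hence "vge 1 (lift u x)"
      using lift_approx[of x x0 u] assms by (auto simp: local_parameters_def)
    moreover have "vge 2 (x - fls_const x0)"
      using assms by (simp add: local_parameters_def)
    ultimately have "vge 3 ((x - fls_const x0) * lift u x)"
      using vge_mult[of 2 _ 1] by fastforce
    moreover have "(x - fls_const x0) * lift u x = y ^ 2"
      using assms by (simp add: local_parameters_def u algebra_simps)
    moreover have "y \<noteq> 0" "fls_subdegree y = 1"
      using assms by (auto simp: local_parameters_def)
    ultimately show False by (simp add: vge_iff fls_subdegree_pow)
  qed
  thus ?thesis using u that by blast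
qed

lemma order_x_at_ramification_point:
  assumes "local_parameters f x0 0 x y"
  shows "x - fls_const x0 \<noteq> 0" "fls_subdegree (x - fls_const x0) = 2"
proof -
  obtain u where u: "f = [:- x0, 1:] * u" "poly u x0 \<noteq> 0"
    using local_simple_root[OF assms] .
  have ux: "lift u x \<noteq> 0 \<and> fls_subdegree (lift u x) = 0"
    using lift_approx[of x x0 u] assms u(2)
    by (intro approx_nonzero) (auto simp: local_parameters_def)
  have eq: "(x - fls_const x0) * lift u x = y ^ 2"
    using assms by (simp add: local_parameters_def u algebra_simps)
  have "y \<noteq> 0" "fls_subdegree y = 1"
    using assms by (auto simp: local_parameters_def)
  hence y: "y \<noteq> 0" "fls_subdegree (y ^ 2) = 2"
    by (auto simp: fls_subdegree_pow)
  show nz: "x - fls_const x0 \<noteq> 0"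
    using eq y by auto
  have "fls_subdegree (y ^ 2) = fls_subdegree (x - fls_const x0) + fls_subdegree (lift u x)"
    using nz ux by (simp flip: eq)
  thus "fls_subdegree (x - fls_const x0) = 2" using y ux by simp
qed

text \<open>A generator of the maximal ideal of the local ring.\<close>

definition local_generator :: "'k::field \<Rightarrow> 'k \<Rightarrow> 'k poly poly" where
  "local_generator x0 y0 = (if y0 = 0 then [:0, 1:] else [:[:- x0, 1:]:])"

lemma ev_local_generator:
  assumes "local_parameters f x0 y0 x y"
  shows "ev (local_generator x0 y0) x y \<noteq> 0" "fls_subdegree (ev (local_generator x0 y0) x y) = 1"
  using assms by (auto simp: local_parameters_def local_generator_def)

lemma ring_identity:
  fixes P M K t W :: "'a::comm_ring_1"
  assumes "P * M = K * t + W" "g = A * t + M * b"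
  shows "P * g = (P * A + K * b) * t + b * W"
proof -
  have "P * g = P * A * t + (P * M) * b" by (simp add: assms(2) algebra_simps)
  also have "\<dots> = P * A * t + (K * t + W) * b" by (simp only: assms(1))
  finally show ?thesis by (simp add: algebra_simps)
qed

text \<open>
  The maximal ideal is generated by \<open>x - x0\<close> and \<open>y - y0\<close>, and one of them is redundant. Modulo
  the equation of the curve, \<open>(y + y0) (y - y0)\<close> is \<open>f - f(x0)\<close>, a multiple of \<open>x - x0\<close>, and \<open>y
  + y0\<close> is a unit when \<open>y0 \<noteq> 0\<close>. At a ramification point \<open>(x - x0) u = y\<^sup>2\<close> with a unit \<open>u\<close>.
\<close>

lemma vanishing_imp_multiple_of_generator:
  assumes "local_parameters f x0 y0 x y" "(2::'k::field) \<noteq> 0" "poly2 (g :: 'k poly poly) x0 y0 = 0"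
  obtains s h q where "poly2 s x0 y0 \<noteq> 0" "s * g = h * local_generator x0 y0 + q * curve_equation f"
proof -
  define g0 where "g0 = poly g [:y0:]"
  obtain b where b: "g = [:g0:] + [:[:- y0:], 1:] * b"
    by (metis add.commute mult.commute synthetic_div_correct' g0_def minus_pCons minus_zero)
  have "poly g0 x0 = 0" using assms(3) by (simp add: poly2_def g0_def)
  then obtain a where a: "g0 = [:- x0, 1:] * a"
    by (metis dvdE poly_eq_0_iff_dvd)
  have g: "g = [:a:] * [:[:- x0, 1:]:] + [:[:- y0:], 1:] * b"
    by (simp add: b a mult.commute)
  show ?thesis
  proof (cases "y0 = 0")
    case True
    obtain u where u: "f = [:- x0, 1:] * u" "poly u x0 \<noteq> 0"
      using local_simple_root assms(1) True by blast
    have "[:u:] * g = ([:0, 1:] * [:a:] + b * [:u:]) * local_generator x0 y0 + (- [:a:]) * curve_equation f"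
      using True by (simp add: g local_generator_def curve_equation_def u algebra_simps)
    moreover have "poly2 [:u:] x0 y0 \<noteq> 0" using u by (simp add: poly2_def)
    ultimately show ?thesis using that by blast
  next
    case False
    obtain k where k: "f = [:poly f x0:] + [:- x0, 1:] * k" using poly_dvd_split by blast
    have "y0 * y0 = poly f x0" using local_point_on_curve[OF assms(1)] by (simp add: power2_eq_square)
    hence f: "f = [:y0 * y0:] + [:- x0, 1:] * k" using k by simp
    have "[:[:y0:], 1:] * [:[:- y0:], 1:] = [:k:] * [:[:- x0, 1:]:] + curve_equation f"
      unfolding curve_equation_def by (subst f) (simp add: algebra_simps)
    hence "[:[:y0:], 1:] * g = ([:[:y0:], 1:] * [:a:] + [:k:] * b) * [:[:- x0, 1:]:] + b * curve_equation f"
      using g by (rule ring_identity)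
    moreover have "poly2 [:[:y0:], 1:] x0 y0 \<noteq> 0"
      using False assms(2) by (simp add: poly2_def flip: mult_2)
    ultimately show ?thesis using that False by (simp add: local_generator_def)
  qed
qed

text \<open>
  As long as the order of \<open>g\<close> in \<open>t\<close> exceeds the exponent \<open>d\<close>, the cofactor \<open>h\<close> vanishes at the
  point, and another factor can be split off.
\<close>

lemma vge_imp_multiple_of_generator_power:
  assumes "local_parameters f x0 y0 x y" "(2::'k::field) \<noteq> 0"
  shows "vge (int d) (ev (g :: 'k poly poly) x y) \<Longrightarrow>
     \<exists>s h q. poly2 s x0 y0 \<noteq> 0 \<and> s * g = h * local_generator x0 y0 ^ d + q * curve_equation f"
proof (induction d)
  case 0
  have "poly2 1 x0 y0 \<noteq> 0 \<and> 1 * g = g * local_generator x0 y0 ^ 0 + 0 * curve_equation f"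
    by (simp add: poly2_def)
  thus ?case by blast
next
  case (Suc d)
  let ?t = "local_generator x0 y0" and ?W = "curve_equation f"
  have W: "ev ?W x y = 0" using assms(1) by (simp add: local_parameters_def)
  have xy: "vge 1 (x - fls_const x0)" "vge 1 (y - fls_const y0)"
    using assms(1) by (auto simp: local_parameters_def)
  obtain s h q where s: "poly2 s x0 y0 \<noteq> 0" "s * g = h * ?t ^ d + q * ?W"
    using Suc vge_mono[of "int (Suc d)" "ev g x y" "int d"] by auto
  have "ev s x y * ev g x y = ev h x y * ev ?t x y ^ d"
    using arg_cong[OF s(2), of "\<lambda>p. ev p x y"] W by simp
  moreover have "vge (int (Suc d)) (ev s x y * ev g x y)"
    using xy by (intro vge_0_mult'[OF vge_ev Suc.prems]) (auto intro: vge_1_approx)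
  ultimately have *: "vge (int (Suc d)) (ev h x y * ev ?t x y ^ d)" by simp
  have "vge 1 (ev h x y)"
  proof (cases "ev h x y = 0")
    case False
    thus ?thesis using * ev_local_generator[OF assms(1)] by (simp add: vge_iff fls_subdegree_pow)
  qed simp
  hence "poly2 h x0 y0 = 0"
    using approx_zero[OF ev_approx[OF xy]] by blast
  then obtain s' h' q' where s': "poly2 s' x0 y0 \<noteq> 0" "s' * h = h' * ?t + q' * ?W"
    using vanishing_imp_multiple_of_generator assms by metis
  have "(s' * s) * g = s' * (s * g)" by (simp only: mult.assoc)
  also have "\<dots> = (s' * h) * ?t ^ d + (s' * q) * ?W"
    by (simp only: s(2) distrib_left mult.assoc)
  also have "\<dots> = (h' * ?t + q' * ?W) * ?t ^ d + (s' * q) * ?W"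
    by (simp only: s'(2))
  also have "\<dots> = h' * ?t ^ Suc d + (q' * ?t ^ d + s' * q) * ?W"
    by (simp add: algebra_simps)
  finally have "(s' * s) * g = h' * ?t ^ Suc d + (q' * ?t ^ d + s' * q) * ?W" .
  moreover have "poly2 (s' * s) x0 y0 \<noteq> 0" using s s' by (simp add: poly2_def)
  ultimately show ?case by blast
qed

lemma vanishes_to_order_iff:
  assumes "local_parameters f x0 y0 x y" "(2::'k::field) \<noteq> 0"
  shows "vanishes_to_order (curve_equation f) x0 y0 d (g :: 'k poly poly) \<longleftrightarrow> vge (int d) (ev g x y)"
proof
  assume "vge (int d) (ev g x y)"
  then obtain s h q where s: "poly2 s x0 y0 \<noteq> 0"
      "s * g = h * local_generator x0 y0 ^ d + q * curve_equation f"
    using vge_imp_multiple_of_generator_power assms by metis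
  define k where "k = (if y0 = 0 then 0 else d)"
  define c where "c = (\<lambda>i. if i = k then h else 0)"
  have "(\<Sum>i\<le>d. c i * [:[:- x0, 1:]:] ^ i * [:[:- y0:], 1:] ^ (d - i)) =
        (\<Sum>i\<in>{k}. c i * [:[:- x0, 1:]:] ^ i * [:[:- y0:], 1:] ^ (d - i))"
    by (rule sum.mono_neutral_right) (auto simp: c_def k_def)
  also have "\<dots> = h * local_generator x0 y0 ^ d"
    by (simp add: c_def k_def local_generator_def)
  finally show "vanishes_to_order (curve_equation f) x0 y0 d g"
    unfolding vanishes_to_order_def using s(1)
    by (intro exI[of _ s] exI[of _ c] exI[of _ q]) (simp only: s(2) simp_thms not_False_eq_True)
next
  have W: "ev (curve_equation f) x y = 0" using assms(1) by (simp add: local_parameters_def)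
  have xy: "vge 1 (x - fls_const x0)" "vge 1 (y - fls_const y0)"
    using assms(1) by (auto simp: local_parameters_def)
  hence xy0: "vge 0 x" "vge 0 y" by (auto intro: vge_1_approx)
  assume "vanishes_to_order (curve_equation f) x0 y0 d g"
  then obtain s c q where s: "poly2 s x0 y0 \<noteq> 0"
    "s * g = (\<Sum>i\<le>d. c i * [:[:- x0, 1:]:] ^ i * [:[:- y0:], 1:] ^ (d - i)) + q * curve_equation f"
    unfolding vanishes_to_order_def by blast
  have "ev s x y * ev g x y =
      (\<Sum>i\<le>d. ev (c i) x y * ((x - fls_const x0) ^ i * (y - fls_const y0) ^ (d - i)))"
    using arg_cong[OF s(2), of "\<lambda>p. ev p x y"] W by (simp add: ev_sum algebra_simps)
  moreover have "vge (int d) (ev (c i) x y * ((x - fls_const x0) ^ i * (y - fls_const y0) ^ (d - i)))"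
    if "i \<le> d" for i
  proof -
    have "vge (int i * 1 + int (d - i) * 1) ((x - fls_const x0) ^ i * (y - fls_const y0) ^ (d - i))"
      using xy by (intro vge_mult vge_power)
    hence "vge (int d) ((x - fls_const x0) ^ i * (y - fls_const y0) ^ (d - i))"
      using that by (simp add: of_nat_diff)
    thus ?thesis by (rule vge_0_mult'[OF vge_ev[OF xy0]])
  qed
  ultimately have *: "vge (int d) (ev s x y * ev g x y)"
    by (auto intro!: vge_sum)
  have "ev s x y \<noteq> 0 \<and> fls_subdegree (ev s x y) = 0"
    using ev_approx[OF xy] s(1) by (intro approx_nonzero) auto
  thus "vge (int d) (ev g x y)"
    using * by (cases "ev g x y = 0") (auto simp: vge_iff)
qed

text \<open>Orders of vanishing turn into subdegrees, which are additive.\<close>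

lemma vanishing_order_eq_subdegree:
  assumes "local_parameters f x0 y0 x y" "(2::'k::field) \<noteq> 0" "ev (g :: 'k poly poly) x y \<noteq> 0"
  shows "int (vanishing_order (curve_equation f) x0 y0 g) = fls_subdegree (ev g x y)"
proof -
  have "vge 0 x" "vge 0 y"
    using assms(1) by (auto simp: local_parameters_def intro: vge_1_approx)
  hence "vge 0 (ev g x y)" by (rule vge_ev)
  hence nn: "0 \<le> fls_subdegree (ev g x y)" using assms(3) by (simp add: vge_iff)
  have "vanishing_order (curve_equation f) x0 y0 g = nat (fls_subdegree (ev g x y))"
    unfolding vanishing_order_def using assms(3) nn
    by (intro Greatest_equality) (auto simp: vanishes_to_order_iff[OF assms(1,2)] vge_iff)
  thus ?thesis using nn by simp
qed

section \<open>Parametrisations of a sextic curve\<close>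

text \<open>
  A parametrisation in the homogeneous coordinates of weights \<open>(1, 3, 1)\<close>. The Wronskian of \<open>X\<close>
  and \<open>Z\<close> changes under a linear substitution of \<open>X\<close> and \<open>Z\<close> only by the determinant, so the
  condition that \<open>t\<close> is a uniformiser has the same form at affine and at infinite points and is
  preserved by Moebius transformations.
\<close>

definition parametrisation :: "'k::field poly \<Rightarrow> 'k fps \<Rightarrow> 'k fps \<Rightarrow> 'k fps \<Rightarrow> bool" where
  "parametrisation f X Y Z \<longleftrightarrow>
     (fps_nth X 0 \<noteq> 0 \<or> fps_nth Z 0 \<noteq> 0) \<and> Z \<noteq> 0 \<and>
     (fps_to_fls Y / fps_to_fls Z ^ 3) ^ 2 = lift f (fps_to_fls X / fps_to_fls Z) \<and>
     (if fps_nth Y 0 = 0 then fps_nth X 1 * fps_nth Z 0 = fps_nth X 0 * fps_nth Z 1 \<and> fps_nth Y 1 \<noteq> 0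
      else fps_nth X 1 * fps_nth Z 0 \<noteq> fps_nth X 0 * fps_nth Z 1)"

definition coordinates_at :: "'k::field poly \<Rightarrow> 'k curve_point \<Rightarrow> 'k fls \<Rightarrow> 'k fls \<Rightarrow> bool" where
  "coordinates_at f P x y \<longleftrightarrow>
     (\<exists>X Y Z. parametrisation f X Y Z \<and> P = weighted_point (fps_nth X 0) (fps_nth Y 0) (fps_nth Z 0) \<and>
        x = fps_to_fls X / fps_to_fls Z \<and> y = fps_to_fls Y / fps_to_fls Z ^ 3)"

lemma vge_unit_mult:
  assumes "u \<noteq> 0" "fls_subdegree u = 0"
  shows "vge n (u * z) \<longleftrightarrow> vge n z"
  using assms by (cases "z = 0") (simp_all add: vge_iff)

lemma vge_1_fps: "vge 1 (fps_to_fls N) \<longleftrightarrow> fps_nth N 0 = 0"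
proof
  assume "fps_nth N 0 = 0"
  moreover have "i < 0 \<or> i = 0" if "i < 1" for i :: int using that by linarith
  ultimately show "vge 1 (fps_to_fls N)" unfolding vge_def by fastforce
qed (auto simp: vge_def dest: spec[of _ 0])

lemma vge_2_fps: "vge 2 (fps_to_fls N) \<longleftrightarrow> fps_nth N 0 = 0 \<and> fps_nth N 1 = 0"
proof
  assume a: "fps_nth N 0 = 0 \<and> fps_nth N 1 = 0"
  show "vge 2 (fps_to_fls N)"
    unfolding vge_def
  proof (intro allI impI)
    fix i :: int assume "i < 2"
    hence "i < 0 \<or> i = 0 \<or> i = 1" by linarith
    thus "fls_nth (fps_to_fls N) i = 0" using a by auto
  qed
qed (auto simp: vge_def dest: spec[of _ 0] spec[of _ 1])

lemma fps_nonzero_iff_subdegree: "fps_nth Z 0 \<noteq> 0 \<Longrightarrow> fps_to_fls Z \<noteq> 0 \<and> fls_subdegree (fps_to_fls Z) = 0"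
  by (auto simp: fls_subdegree_fls_to_fps)

lemma fps_order_one:
  "fps_nth N 0 = 0 \<Longrightarrow> fps_nth N 1 \<noteq> 0 \<Longrightarrow> fps_to_fls N \<noteq> 0 \<and> fls_subdegree (fps_to_fls N) = 1"
  by (auto simp: fls_subdegree_fls_to_fps intro!: subdegreeI)

lemma affine_local_parameters:
  assumes "parametrisation f X Y Z" "fps_nth Z 0 \<noteq> 0"
  shows "local_parameters f (fps_nth X 0 / fps_nth Z 0) (fps_nth Y 0 / fps_nth Z 0 ^ 3)
           (fps_to_fls X / fps_to_fls Z) (fps_to_fls Y / fps_to_fls Z ^ 3)"
proof -
  define x where "x = fps_to_fls X / fps_to_fls Z"
  define y where "y = fps_to_fls Y / fps_to_fls Z ^ 3"
  define x0 where "x0 = fps_nth X 0 / fps_nth Z 0"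
  define y0 where "y0 = fps_nth Y 0 / fps_nth Z 0 ^ 3"
  have Z: "fps_to_fls Z \<noteq> 0" "fls_subdegree (fps_to_fls Z) = 0"
    using fps_nonzero_iff_subdegree[OF assms(2)] by auto
  define N where "N = X - fps_const x0 * Z"
  have N: "fps_to_fls Z * (x - fls_const x0) = fps_to_fls N"
    using Z by (simp add: x_def N_def field_simps fls_times_fps_to_fls)
  have N0: "fps_nth N 0 = 0" using assms(2) by (simp add: N_def x0_def)
  have N1: "fps_nth N 1 = 0 \<longleftrightarrow> fps_nth X 1 * fps_nth Z 0 = fps_nth X 0 * fps_nth Z 1"
    using assms(2) by (simp add: N_def x0_def field_simps)
  define M where "M = Y - fps_const y0 * Z ^ 3"
  have Z3: "fps_to_fls Z ^ 3 \<noteq> 0" "fls_subdegree (fps_to_fls Z ^ 3) = 0"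
    using Z by (auto simp: fls_subdegree_pow)
  have M: "fps_to_fls Z ^ 3 * (y - fls_const y0) = fps_to_fls M"
    using Z by (simp add: y_def M_def field_simps fls_times_fps_to_fls fps_to_fls_power)
  have M0: "fps_nth M 0 = 0" using assms(2) by (simp add: M_def y0_def fps_power_zeroth)
  have vx: "vge n (x - fls_const x0) \<longleftrightarrow> vge n (fps_to_fls N)" for n
    using vge_unit_mult[OF Z, of n "x - fls_const x0"] N by simp
  have vy: "vge n (y - fls_const y0) \<longleftrightarrow> vge n (fps_to_fls M)" for n
    using vge_unit_mult[OF Z3, of n "y - fls_const y0"] M by simp
  have "vge 1 (x - fls_const x0)" "vge 1 (y - fls_const y0)"
    by (simp_all add: vx vy vge_1_fps N0 M0)
  moreover have "y ^ 2 = lift f x"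
    using assms(1) by (simp add: parametrisation_def x_def y_def)
  moreover have "vge 2 (x - fls_const x0) \<and> y \<noteq> 0 \<and> fls_subdegree y = 1" if "y0 = 0"
  proof -
    have Y0: "fps_nth Y 0 = 0" using that assms(2) by (simp add: y0_def)
    hence 1: "fps_nth N 1 = 0" "fps_nth Y 1 \<noteq> 0"
      using assms(1) N1 by (auto simp: parametrisation_def)
    have "fps_to_fls Y \<noteq> 0 \<and> fls_subdegree (fps_to_fls Y) = 1"
      using fps_order_one[OF Y0 1(2)] .
    moreover have "fps_to_fls Z ^ 3 * y = fps_to_fls Y" using Z by (simp add: y_def)
    ultimately have "y \<noteq> 0" "fls_subdegree (fps_to_fls Z ^ 3 * y) = 1" by auto
    thus ?thesis using 1 N0 Z3 by (simp add: vx vge_2_fps)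
  qed
  moreover have "x - fls_const x0 \<noteq> 0 \<and> fls_subdegree (x - fls_const x0) = 1" if "y0 \<noteq> 0"
  proof -
    have "fps_nth Y 0 \<noteq> 0" using that by (auto simp: y0_def)
    hence "fps_nth N 1 \<noteq> 0" using assms(1) N1 by (auto simp: parametrisation_def)
    hence "fps_to_fls N \<noteq> 0 \<and> fls_subdegree (fps_to_fls N) = 1"
      using fps_order_one[OF N0] by simp
    hence "x - fls_const x0 \<noteq> 0" "fls_subdegree (fps_to_fls Z * (x - fls_const x0)) = 1"
      using N by (metis mult_zero_right, metis)
    thus ?thesis using Z by simp
  qed
  ultimately show ?thesis
    unfolding local_parameters_def x_def[symmetric] y_def[symmetric] x0_def[symmetric] y0_def[symmetric]
    by auto
qed

text \<open>
  The right-hand side of the equation in the coordinates \<open>1 / x\<close> and \<open>y / x\<^sup>3\<close> around infinity.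
\<close>

definition reversed_sextic :: "'k::field poly \<Rightarrow> 'k poly" where
  "reversed_sextic f = (\<Sum>i\<le>degree f. monom (coeff f i) (6 - i))"

lemma lift_as_sum: "lift q x = (\<Sum>i\<le>degree q. fls_const (coeff q i) * x ^ i)"
proof -
  have "lift q x = lift (\<Sum>i\<le>degree q. monom (coeff q i) i) x"
    by (simp add: poly_as_sum_of_monoms)
  thus ?thesis by (simp only: lift_sum lift_monom)
qed

lemma ev_as_sum: "ev g x y = (\<Sum>j\<le>degree g. lift (coeff g j) x * y ^ j)"
proof -
  have "ev g x y = ev (\<Sum>i\<le>degree g. monom (coeff g i) i) x y"
    by (simp add: poly_as_sum_of_monoms)
  thus ?thesis by (simp only: ev_sum ev_monom)
qed

lemma inverse_power_diff:
  fixes x :: "'a::field"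
  assumes "x \<noteq> 0" "i \<le> n"
  shows "inverse x ^ (n - i) = x ^ i / x ^ n"
  using assms by (simp add: power_diff field_simps)

lemma lift_reversed_sextic:
  assumes "degree f \<le> 6" "x \<noteq> 0"
  shows "lift (reversed_sextic f) (inverse x) = lift f x / x ^ 6"
proof -
  have "lift (reversed_sextic f) (inverse x) =
      (\<Sum>i\<le>degree f. fls_const (coeff f i) * (x ^ i / x ^ 6))"
    unfolding reversed_sextic_def lift_sum lift_monom
    using assms by (intro sum.cong) (auto simp: inverse_power_diff)
  thus ?thesis by (simp add: lift_as_sum[of f] sum_divide_distrib)
qed

lemma poly_reversed_sextic_0: "degree f \<le> 6 \<Longrightarrow> poly (reversed_sextic f) 0 = coeff f 6"
proof -
  assume "degree f \<le> 6"
  have "poly (reversed_sextic f) 0 = (\<Sum>i\<le>degree f. if i = 6 then coeff f i else 0)"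
    unfolding reversed_sextic_def poly_sum
    using \<open>degree f \<le> 6\<close> by (intro sum.cong) (auto simp: poly_monom)
  thus ?thesis using \<open>degree f \<le> 6\<close> by (auto simp: coeff_eq_0)
qed

lemma ev_other_chart:
  assumes "weighted_degree_le n g" "x \<noteq> 0"
  shows "ev (other_chart n g) (inverse x) (y / x ^ 3) = ev g x y / x ^ n"
proof -
  have "ev (other_chart n g) (inverse x) (y / x ^ 3) =
    (\<Sum>j\<le>degree g. \<Sum>i\<le>degree (coeff g j).
       fls_const (coeff (coeff g j) i) * inverse x ^ (n - (i + 3 * j)) * (y / x ^ 3) ^ j)"
    unfolding other_chart_def by (simp add: ev_sum ev_monom lift_monom)
  also have "\<dots> = (\<Sum>j\<le>degree g. \<Sum>i\<le>degree (coeff g j).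
       fls_const (coeff (coeff g j) i) * x ^ i * y ^ j / x ^ n)"
  proof (intro sum.cong refl)
    fix j i
    show "fls_const (coeff (coeff g j) i) * inverse x ^ (n - (i + 3 * j)) * (y / x ^ 3) ^ j =
        fls_const (coeff (coeff g j) i) * x ^ i * y ^ j / x ^ n"
    proof (cases "coeff (coeff g j) i = 0")
      case False
      hence "i + 3 * j \<le> n" using assms(1) by (auto simp: weighted_degree_le_def)
      hence "inverse x ^ (n - (i + 3 * j)) = x ^ (i + 3 * j) / x ^ n"
        using assms(2) by (rule inverse_power_diff[rotated])
      moreover have "(y / x ^ 3) ^ j = y ^ j / x ^ (3 * j)"
        by (simp add: power_divide power_mult)
      ultimately show ?thesis
        using assms(2) by (simp only: power_add) simp
    qed simp
  qed
  also have "\<dots> = ev g x y / x ^ n"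
    by (simp add: ev_as_sum[of g] lift_as_sum sum_distrib_right sum_divide_distrib)
  finally show ?thesis .
qed

lemma other_chart_curve_equation:
  assumes "degree f \<le> 6"
  shows "other_chart 6 (curve_equation f) = curve_equation (reversed_sextic f)"
proof -
  have "{..degree (curve_equation f)} = {0, 1, 2}" by (auto simp: curve_equation_def)
  moreover have "(\<Sum>i\<le>degree f. monom (monom (- coeff f i) (6 - i)) 0) = [:- reversed_sextic f:]"
  proof -
    have "(\<Sum>i\<in>A. [:F i:]) = [:sum F A:]" for F :: "nat \<Rightarrow> 'a poly" and A
      by (induction A rule: infinite_finite_induct) auto
    thus ?thesis by (simp add: reversed_sextic_def monom_0 sum_negf flip: minus_monom)
  qed
  moreover have "monom (monom 1 0) 2 = [:0, 0, 1 :: 'a poly:]"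
    by (simp add: numeral_2_eq_2 monom_Suc monom_0 one_pCons)
  ultimately show ?thesis
    unfolding other_chart_def by (simp add: curve_equation_def numeral_2_eq_2 one_pCons)
qed

lemma parametrisation_swap:
  assumes "parametrisation f X Y Z" "degree f \<le> 6" "X \<noteq> 0"
  shows "parametrisation (reversed_sextic f) Z Y X"
proof -
  have nz: "fps_to_fls X \<noteq> 0" "fps_to_fls Z \<noteq> 0"
    using assms by (auto simp: parametrisation_def)
  have "(fps_to_fls Y / fps_to_fls X ^ 3) ^ 2 =
      (fps_to_fls Y / fps_to_fls Z ^ 3) ^ 2 / (fps_to_fls X / fps_to_fls Z) ^ 6"
    using nz by (simp add: field_simps flip: power_mult)
  also have "\<dots> = lift f (fps_to_fls X / fps_to_fls Z) / (fps_to_fls X / fps_to_fls Z) ^ 6"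
    using assms(1) by (simp add: parametrisation_def)
  also have "\<dots> = lift (reversed_sextic f) (inverse (fps_to_fls X / fps_to_fls Z))"
    using assms(2) nz by (subst lift_reversed_sextic) auto
  finally show ?thesis
    using assms(1,3) unfolding parametrisation_def by (auto simp: mult.commute)
qed

lemma infinite_local_parameters:
  assumes "parametrisation f X Y Z" "degree f \<le> 6" "fps_nth Z 0 = 0"
  shows "local_parameters (reversed_sextic f) 0 (fps_nth Y 0 / fps_nth X 0 ^ 3)
           (fps_to_fls Z / fps_to_fls X) (fps_to_fls Y / fps_to_fls X ^ 3)"
proof -
  have X0: "fps_nth X 0 \<noteq> 0" using assms by (simp add: parametrisation_def)
  hence "X \<noteq> 0" by auto
  from affine_local_parameters[OF parametrisation_swap[OF assms(1,2) this] X0] show ?thesis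
    using assms(3) by simp
qed

lemma coordinates_cases:
  assumes "coordinates_at f P x y" "degree f \<le> 6"
  obtains (Aff) x0 y0 where "P = Aff x0 y0" "local_parameters f x0 y0 x y"
  | (Inf) w where "P = Inf w" "x \<noteq> 0" "fls_subdegree x < 0"
      "local_parameters (reversed_sextic f) 0 w (inverse x) (y / x ^ 3)"
proof -
  obtain X Y Z where *: "parametrisation f X Y Z"
      "P = weighted_point (fps_nth X 0) (fps_nth Y 0) (fps_nth Z 0)"
      "x = fps_to_fls X / fps_to_fls Z" "y = fps_to_fls Y / fps_to_fls Z ^ 3"
    using assms(1) by (auto simp: coordinates_at_def)
  show ?thesis
  proof (cases "fps_nth Z 0 = 0")
    case False
    thus ?thesis using affine_local_parameters[OF *(1) False] * Aff by (simp add: weighted_point_def)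
  next
    case True
    have X0: "fps_nth X 0 \<noteq> 0" using * True by (simp add: parametrisation_def)
    hence X: "X \<noteq> 0" by auto
    have Z: "Z \<noteq> 0" using * by (simp add: parametrisation_def)
    have "subdegree Z > 0" using True Z by (metis gr0I nth_subdegree_nonzero)
    hence "fls_subdegree (fps_to_fls Z) > 0" by (simp add: fls_subdegree_fls_to_fps)
    moreover have "fps_to_fls X = x * fps_to_fls Z" using Z * by simp
    hence "fls_subdegree (fps_to_fls X) = fls_subdegree x + fls_subdegree (fps_to_fls Z)"
      using X Z by (metis fls_subdegree_mult fps_to_fls_eq_0_iff mult_eq_0_iff)
    moreover have "fls_subdegree (fps_to_fls X) = 0" using fps_nonzero_iff_subdegree[OF X0] by simp
    ultimately have "fls_subdegree x < 0" by linarith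
    moreover have "x \<noteq> 0" using X Z * by simp
    moreover have e1: "inverse x = fps_to_fls Z / fps_to_fls X" using * by simp
    moreover have e2: "y / x ^ 3 = fps_to_fls Y / fps_to_fls X ^ 3" using * X Z by (simp add: power_divide)
    moreover have "local_parameters (reversed_sextic f) 0 (fps_nth Y 0 / fps_nth X 0 ^ 3) (inverse x) (y / x ^ 3)"
      using infinite_local_parameters[OF *(1) assms(2) True] by (simp only: e1 e2)
    ultimately show ?thesis
      using Inf *(2) True by (simp only: weighted_point_def if_True simp_thms)
  qed
qed

lemma coordinates_equation: "coordinates_at f P x y \<Longrightarrow> y ^ 2 = lift f x"
  by (auto simp: coordinates_at_def parametrisation_def)

lemma coordinates_on_curve:
  assumes "coordinates_at f P x y" "degree f \<le> 6"
  shows "P \<in> curve_points f"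
  using assms
proof (cases rule: coordinates_cases)
  case (Aff x0 y0)
  thus ?thesis using local_point_on_curve by (auto simp: curve_points_def)
next
  case (Inf w)
  hence "w ^ 2 = coeff f 6"
    using local_point_on_curve[OF Inf(4)] poly_reversed_sextic_0[OF assms(2)] by simp
  thus ?thesis using Inf(1) by (simp add: curve_points_def)
qed

text \<open>
  At infinity the order of a form of weight \<open>n\<close> exceeds the order of the series \<open>g(x, y)\<close> by \<open>n\<close>
  times that of \<open>1 / x\<close>. The forms \<open>g\<close> and \<open>h\<close> have the same weight, so this cancels in the
  difference.
\<close>

lemma order_difference:
  assumes "coordinates_at f P x y" "degree f \<le> 6" "(2::'k::field) \<noteq> 0"
    and "weighted_degree_le n (g :: 'k poly poly)" "ev g x y \<noteq> 0"
    and "weighted_degree_le n h" "ev h x y \<noteq> 0"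
  shows "int (order_at f n g P) - int (order_at f n h P) =
           fls_subdegree (ev g x y) - fls_subdegree (ev h x y)"
  using assms(1,2)
proof (cases rule: coordinates_cases)
  case (Aff x0 y0)
  thus ?thesis using vanishing_order_eq_subdegree[OF Aff(2) assms(3)] assms by simp
next
  case (Inf w)
  have "int (order_at f n k P) = fls_subdegree (ev k x y) - int n * fls_subdegree x"
    if "weighted_degree_le n k" "ev k x y \<noteq> 0" for k
  proof -
    have e: "ev (other_chart n k) (inverse x) (y / x ^ 3) = ev k x y * inverse x ^ n"
      using ev_other_chart[OF that(1) Inf(2)] by (simp add: field_simps)
    hence "int (order_at f n k P) = fls_subdegree (ev (other_chart n k) (inverse x) (y / x ^ 3))"
      using Inf that(2) assms(2,3)
      by (simp add: other_chart_curve_equation vanishing_order_eq_subdegree[OF Inf(4)])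
    thus ?thesis using e that(2) Inf(2) by (simp add: fls_subdegree_pow)
  qed
  thus ?thesis using assms by simp
qed

lemma order_lift_at_pole:
  assumes "fls_subdegree x < 0" "q \<noteq> 0"
  shows "lift q x \<noteq> 0 \<and> fls_subdegree (lift q x) = int (degree q) * fls_subdegree x"
  using assms(2)
proof (induction q)
  case (pCons a q)
  show ?case
  proof (cases "q = 0")
    case True
    thus ?thesis using pCons by auto
  next
    case False
    have x: "x \<noteq> 0" using assms(1) by auto
    have *: "x * lift q x \<noteq> 0" "fls_subdegree (x * lift q x) = int (degree (pCons a q)) * fls_subdegree x"
      using pCons False x by (auto simp: algebra_simps)
    have neg: "fls_subdegree (x * lift q x) < 0"
      unfolding *(2) using False assms(1) by (simp add: mult_pos_neg)
    have "fls_subdegree (fls_const a + x * lift q x) = fls_subdegree (x * lift q x)"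
    proof (cases "a = 0")
      case False
      thus ?thesis using neg * by (intro fls_subdegree_add_eq2) auto
    qed simp
    thus ?thesis using * neg by auto
  qed
qed simp

text \<open>
  The series \<open>x\<close> is not constant: at an affine point \<open>x - x0\<close> has positive order, and at
  infinity the leading term of the polynomial dominates.
\<close>

lemma coordinate_transcendental:
  assumes "coordinates_at f P x y" "degree f \<le> 6" "lift q x = 0"
  shows "q = 0"
proof (rule ccontr)
  assume q: "q \<noteq> 0"
  show False
    using assms(1,2)
  proof (cases rule: coordinates_cases)
    case (Aff x0 y0)
    have x: "x - fls_const x0 \<noteq> 0" "vge 1 (x - fls_const x0)"
      using Aff(2) order_x_at_ramification_point(1)[of f x0 x y]
      by (cases "y0 = 0"; auto simp: local_parameters_def)+
    obtain k where k: "q = [:- x0, 1:] ^ order x0 q * k" "\<not> [:- x0, 1:] dvd k"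
      using order_decomp[OF q] by blast
    have "poly k x0 \<noteq> 0" using k(2) by (simp add: poly_eq_0_iff_dvd)
    hence "lift k x \<noteq> 0" using approx_nonzero[OF lift_approx[OF x(2)]] by blast
    moreover have "lift q x = (x - fls_const x0) ^ order x0 q * lift k x"
      by (subst k(1)) simp
    ultimately show False using x assms(3) by simp
  next
    case (Inf w)
    thus False using order_lift_at_pole[OF Inf(3) q] assms(3) by simp
  qed
qed

section \<open>Principal divisors\<close>

lemma reduce_mod_curve: "\<exists>A B q. g = q * curve_equation f + [:A, B:]"
proof (induction g)
  case 0
  have "0 = 0 * curve_equation f + [:0, 0:]" by simp
  thus ?case by blast
next
  case (pCons c g)
  then obtain A B q where "g = q * curve_equation f + [:A, B:]" by blast
  hence "pCons c g = [:c:] + [:0, 1:] * (q * curve_equation f + [:A, B:])" by simp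
  also have "\<dots> = ([:0, 1:] * q + [:B:]) * curve_equation f + [:c + B * f, A:]"
    by (simp add: curve_equation_def algebra_simps)
  finally show ?case by blast
qed

text \<open>
  Smoothness enters as the existence of a parametrisation at each point. By smoothness the root
  of \<open>f\<close> is simple, hence \<open>f\<close> is not a square and the curve is irreducible.
\<close>

locale sextic_curve =
  fixes f :: "'k::field poly"
  assumes two_nonzero: "(2::'k) \<noteq> 0"
    and degree_le: "degree f \<le> 6"
    and coordinates_exist: "P \<in> curve_points f \<Longrightarrow> \<exists>x y. coordinates_at f P x y"
    and has_root: "\<exists>x0. poly f x0 = 0"
begin

abbreviation "W \<equiv> curve_equation f"

lemma simple_root: obtains x0 u where "f = [:- x0, 1:] * u" "poly u x0 \<noteq> 0"
proof -
  obtain x0 where x0: "poly f x0 = 0" using has_root by blast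
  hence "Aff x0 0 \<in> curve_points f" by (simp add: curve_points_def)
  then obtain x y where "coordinates_at f (Aff x0 0) x y" using coordinates_exist by blast
  hence "local_parameters f x0 0 x y"
    using degree_le by (cases rule: coordinates_cases) auto
  thus ?thesis using local_simple_root that by blast
qed

text \<open>
  A simple root of \<open>f\<close> has even multiplicity in \<open>A\<^sup>2\<close> and odd multiplicity in \<open>f B\<^sup>2\<close>.
\<close>

lemma norm_nonzero:
  assumes "A ^ 2 = f * B ^ 2"
  shows "A = 0 \<and> B = 0"
proof (rule ccontr)
  assume "\<not> (A = 0 \<and> B = 0)"
  obtain x0 u where u: "f = [:- x0, 1:] * u" "poly u x0 \<noteq> 0" using simple_root .
  have "u \<noteq> 0" using u(2) by auto
  hence fnz: "f \<noteq> 0" unfolding u(1) mult_eq_0_iff by simp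
  hence nz: "A \<noteq> 0" "B \<noteq> 0" using assms \<open>\<not> (A = 0 \<and> B = 0)\<close> by auto
  have "order x0 f = order x0 [:- x0, 1:] + order x0 u"
    using fnz unfolding u(1) by (rule order_mult)
  moreover have "order x0 [:- x0, 1:] = 1" using order_power_n_n[of x0 1] by simp
  moreover have "order x0 u = 0" using u(2) by (rule order_0I)
  ultimately have "order x0 f = 1" by simp
  moreover have "order x0 (A ^ 2) = 2 * order x0 A" "order x0 (B ^ 2) = 2 * order x0 B"
    using nz by (simp_all add: power2_eq_square order_mult)
  moreover have "order x0 (f * B ^ 2) = order x0 f + order x0 (B ^ 2)"
    using fnz nz by (simp add: order_mult)
  ultimately have "2 * order x0 A = 1 + 2 * order x0 B" using assms by simp
  thus False by presburger
qed

lemma ev_eq_0_iff: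
  assumes "coordinates_at f P x y"
  shows "ev g x y = 0 \<longleftrightarrow> W dvd g"
proof
  have W: "ev W x y = 0" using coordinates_equation[OF assms] by simp
  {
    assume "W dvd g"
    thus "ev g x y = 0" using W by (auto elim!: dvdE)
  next
    assume e: "ev g x y = 0"
    obtain A B q where g: "g = q * W + [:A, B:]" using reduce_mod_curve by blast
    have "lift A x + y * lift B x = 0" using e W by (simp add: g)
    hence "lift A x ^ 2 = y ^ 2 * lift B x ^ 2"
      by (metis add_eq_0_iff2 power2_minus power_mult_distrib)
    hence "lift (A ^ 2 - f * B ^ 2) x = 0"
      by (simp add: coordinates_equation[OF assms])
    hence "A ^ 2 - f * B ^ 2 = 0"
      using coordinate_transcendental[OF assms degree_le] by blast
    hence "A = 0 \<and> B = 0" using norm_nonzero[of A B] by simp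
    thus "W dvd g" by (simp add: g)
  }
qed

text \<open>
  Along a parametrisation \<open>g\<close> and \<open>h\<close> have orders as Laurent series, without reference to a
  common weighted degree. All parametrisations of a point occur, so that any of them may be used
  to read off a coefficient.
\<close>

definition has_divisor :: "'k poly poly \<Rightarrow> 'k poly poly \<Rightarrow> ('k curve_point \<Rightarrow>\<^sub>0 int) \<Rightarrow> bool" where
  "has_divisor g h D \<longleftrightarrow> \<not> W dvd g \<and> \<not> W dvd h \<and>
     (\<forall>P x y. coordinates_at f P x y \<longrightarrow>
        Poly_Mapping.lookup D P = fls_subdegree (ev g x y) - fls_subdegree (ev h x y))"

lemma weighted_degree_bound: "\<exists>m. \<forall>n\<ge>m. weighted_degree_le n g"
proof -
  define m where "m = (\<Sum>j\<le>degree g. degree (coeff g j)) + 3 * degree g"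
  have "i + 3 * j \<le> m" if "coeff (coeff g j) i \<noteq> 0" for i j
  proof -
    have j: "j \<le> degree g" using that by (metis coeff_0 le_degree)
    have "i \<le> degree (coeff g j)" using that by (rule le_degree)
    also have "\<dots> \<le> (\<Sum>j\<le>degree g. degree (coeff g j))"
      using j by (intro member_le_sum) auto
    finally show ?thesis using j by (simp add: m_def)
  qed
  thus ?thesis unfolding weighted_degree_le_def by (meson order_trans)
qed

lemma principal_divisors_iff:
  "D \<in> principal_divisors f \<longleftrightarrow>
     Poly_Mapping.keys D \<subseteq> curve_points f \<and> (\<exists>g h. has_divisor g h D)"
proof (intro iffI conjI)
  assume D: "D \<in> principal_divisors f"
  thus "Poly_Mapping.keys D \<subseteq> curve_points f" by (simp add: principal_divisors_def)
  obtain n g h where *: "weighted_degree_le n g" "\<not> W dvd g" "weighted_degree_le n h" "\<not> W dvd h"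
      "\<And>P. P \<in> curve_points f \<Longrightarrow>
         Poly_Mapping.lookup D P = int (order_at f n g P) - int (order_at f n h P)"
    using D by (auto simp: principal_divisors_def)
  have "has_divisor g h D"
    unfolding has_divisor_def
    using * order_difference[OF _ degree_le two_nonzero] coordinates_on_curve[OF _ degree_le] ev_eq_0_iff
    by auto
  thus "\<exists>g h. has_divisor g h D" by blast
next
  assume D: "Poly_Mapping.keys D \<subseteq> curve_points f \<and> (\<exists>g h. has_divisor g h D)"
  then obtain g h where gh: "has_divisor g h D" by blast
  obtain m1 m2 where m: "\<And>n. n \<ge> m1 \<Longrightarrow> weighted_degree_le n g" "\<And>n. n \<ge> m2 \<Longrightarrow> weighted_degree_le n h"
    using weighted_degree_bound by meson
  let ?n = "max m1 m2"
  have w: "weighted_degree_le ?n g" "weighted_degree_le ?n h" using m by auto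
  have "Poly_Mapping.lookup D P = int (order_at f ?n g P) - int (order_at f ?n h P)"
    if P: "P \<in> curve_points f" for P
  proof -
    obtain x y where xy: "coordinates_at f P x y" using coordinates_exist P by blast
    show ?thesis
      using gh xy order_difference[OF xy degree_le two_nonzero w(1) _ w(2)] ev_eq_0_iff[OF xy]
      by (auto simp: has_divisor_def)
  qed
  thus "D \<in> principal_divisors f"
    using D gh w unfolding principal_divisors_def has_divisor_def by auto
qed

lemma not_dvd_mult: "\<not> W dvd g \<Longrightarrow> \<not> W dvd h \<Longrightarrow> \<not> W dvd g * h"
proof -
  obtain x0 where "poly f x0 = 0" using has_root by blast
  hence "Aff x0 0 \<in> curve_points f" by (simp add: curve_points_def)
  then obtain x y where "coordinates_at f (Aff x0 0) x y" using coordinates_exist by blast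
  from ev_eq_0_iff[OF this] show "\<not> W dvd g \<Longrightarrow> \<not> W dvd h \<Longrightarrow> \<not> W dvd g * h"
    by (metis ev_mult mult_eq_0_iff)
qed

lemma not_dvd_1: "\<not> W dvd 1"
  by (auto simp: curve_equation_def dest: dvd_imp_degree_le)

lemma has_divisor_add:
  assumes "has_divisor g h D" "has_divisor g' h' D'"
  shows "has_divisor (g * g') (h * h') (D + D')"
  using assms ev_eq_0_iff not_dvd_mult by (auto simp: has_divisor_def lookup_add)

lemma has_divisor_uminus: "has_divisor g h D \<Longrightarrow> has_divisor h g (- D)"
  by (auto simp: has_divisor_def)

lemma principal_add: "D \<in> principal_divisors f \<Longrightarrow> D' \<in> principal_divisors f \<Longrightarrow> D + D' \<in> principal_divisors f"
  using has_divisor_add keys_add[of D D'] by (auto simp: principal_divisors_iff; blast)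

lemma principal_uminus: "D \<in> principal_divisors f \<Longrightarrow> - D \<in> principal_divisors f"
  using has_divisor_uminus by (simp add: principal_divisors_iff) blast

lemma principal_0: "0 \<in> principal_divisors f"
proof -
  have "has_divisor 1 1 0" using not_dvd_1 by (simp add: has_divisor_def)
  thus ?thesis by (auto simp: principal_divisors_iff)
qed

lemma principal_diff: "D \<in> principal_divisors f \<Longrightarrow> D' \<in> principal_divisors f \<Longrightarrow> D - D' \<in> principal_divisors f"
  using principal_add[of D "- D'"] principal_uminus[of D'] by simp

end

section \<open>Moebius transformations\<close>

abbreviation "cc \<equiv> fls_const"

lemma weighted_point_scale:
  assumes "k \<noteq> 0"
  shows "weighted_point (k * X) (k ^ 3 * Y) (k * Z) = weighted_point X Y Z"
  using assms by (simp add: weighted_point_def power_mult_distrib)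

lemma moebius_weighted_point:
  assumes "X \<noteq> 0 \<or> Z \<noteq> 0"
  shows "moebius a b c d (weighted_point X Y Z) = weighted_point (a * X + b * Z) Y (c * X + d * Z)"
proof (cases "Z = 0")
  case True
  hence X: "X \<noteq> 0" using assms by simp
  show ?thesis
    using weighted_point_scale[OF X, of a "Y / X ^ 3" c] True X
    by (simp add: weighted_point_def[of X] mult.commute)
next
  case False
  show ?thesis
    using weighted_point_scale[OF False, of "a * (X / Z) + b" "Y / Z ^ 3" "c * (X / Z) + d"] False
    by (simp add: weighted_point_def[of X] algebra_simps)
qed

text \<open>
  The substitution pulls the sextic form of \<open>f'\<close> back to that of \<open>f\<close>. Since a polynomial
  identity over \<open>'k\<close> may be tested in the field of Laurent series, where it is applied, it is
  stated there.
\<close>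

definition moebius_transports :: "'k::field \<Rightarrow> 'k \<Rightarrow> 'k \<Rightarrow> 'k \<Rightarrow> 'k poly \<Rightarrow> 'k poly \<Rightarrow> bool" where
  "moebius_transports a b c d f f' \<longleftrightarrow>
     (\<forall>x. cc c * x + cc d \<noteq> 0 \<longrightarrow>
        lift f' ((cc a * x + cc b) / (cc c * x + cc d)) * (cc c * x + cc d) ^ 6 = lift f x)"

lemma lift_const: "lift q (cc a) = cc (poly q a)"
  by (induction q) (simp_all add: fls_plus_const)

text \<open>
  Otherwise \<open>x\<close> is a constant series, and then so is \<open>y\<^sup>2\<close>. But the Wronskian is zero, so \<open>y\<close>
  has order 1.
\<close>

lemma parametrisation_denominator:
  assumes "parametrisation f X Y Z" "a * d - b * c \<noteq> 0"
  shows "fps_const c * X + fps_const d * Z \<noteq> 0"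
proof
  assume e: "fps_const c * X + fps_const d * Z = 0"
  have Z: "Z \<noteq> 0" using assms(1) by (simp add: parametrisation_def)
  have c: "c \<noteq> 0"
  proof
    assume c0: "c = 0"
    have "d \<noteq> 0" using assms(2) unfolding c0 by simp
    moreover have "fps_const d * Z = 0" using e unfolding c0 by simp
    ultimately show False using Z by simp
  qed
  have X: "X = fps_const (- d / c) * Z"
  proof (rule fps_ext)
    fix n
    have "c * fps_nth X n + d * fps_nth Z n = 0"
      using arg_cong[OF e, of "\<lambda>F. fps_nth F n"] by simp
    hence "c * fps_nth X n = - (d * fps_nth Z n)" by (simp add: eq_neg_iff_add_eq_0)
    thus "fps_nth X n = fps_nth (fps_const (- d / c) * Z) n" using c by (simp add: field_simps)
  qed
  have J: "fps_nth X 1 * fps_nth Z 0 = fps_nth X 0 * fps_nth Z 1" by (simp add: X)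
  have Z0: "fps_nth Z 0 \<noteq> 0" using assms(1) X by (auto simp: parametrisation_def)
  have Y: "fps_nth Y 0 = 0"
    using assms(1) J unfolding parametrisation_def by presburger
  let ?x = "fps_to_fls X / fps_to_fls Z" and ?y = "fps_to_fls Y / fps_to_fls Z ^ 3"
  have x: "?x = cc (- d / c)"
    using Z by (simp add: X fls_times_fps_to_fls)
  have "?y ^ 2 = lift f ?x"
    using assms(1) by (simp add: parametrisation_def)
  hence "?y ^ 2 = cc (poly f (- d / c))" by (simp only: x lift_const)
  moreover have "local_parameters f (fps_nth X 0 / fps_nth Z 0) 0 ?x ?y"
    using affine_local_parameters[OF assms(1) Z0] Y by simp
  hence "fls_subdegree ?y = 1" by (simp add: local_parameters_def)
  hence "fls_subdegree (?y ^ 2) = 2" by (simp add: fls_subdegree_pow)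
  ultimately show False by simp
qed

lemma moebius_coordinates:
  assumes "coordinates_at f P x y" "a * d - b * c \<noteq> 0" "moebius_transports a b c d f f'"
  shows "cc c * x + cc d \<noteq> 0"
    and "coordinates_at f' (moebius a b c d P)
      ((cc a * x + cc b) / (cc c * x + cc d)) (y / (cc c * x + cc d) ^ 3)"
proof -
  obtain X Y Z where *: "parametrisation f X Y Z"
      "P = weighted_point (fps_nth X 0) (fps_nth Y 0) (fps_nth Z 0)"
      "x = fps_to_fls X / fps_to_fls Z" "y = fps_to_fls Y / fps_to_fls Z ^ 3"
    using assms(1) by (auto simp: coordinates_at_def)
  define X' where "X' = fps_const a * X + fps_const b * Z"
  define Z' where "Z' = fps_const c * X + fps_const d * Z"
  have Z: "fps_to_fls Z \<noteq> 0" using * by (simp add: parametrisation_def)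
  have Z'nz: "Z' \<noteq> 0" using parametrisation_denominator[OF *(1) assms(2)] by (simp add: Z'_def)
  have Z'1: "fps_to_fls Z' = (cc c * x + cc d) * fps_to_fls Z"
    using Z by (simp add: Z'_def * fls_times_fps_to_fls field_simps)
  have X'1: "fps_to_fls X' = (cc a * x + cc b) * fps_to_fls Z"
    using Z by (simp add: X'_def * fls_times_fps_to_fls field_simps)
  show L: "cc c * x + cc d \<noteq> 0" using Z'1 Z'nz by auto
  have x': "fps_to_fls X' / fps_to_fls Z' = (cc a * x + cc b) / (cc c * x + cc d)"
    using Z unfolding Z'1 X'1 by simp
  have y': "fps_to_fls Y / fps_to_fls Z' ^ 3 = y / (cc c * x + cc d) ^ 3"
    unfolding Z'1 *(4) by (simp add: power_mult_distrib mult.commute)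
  have eq: "(y / (cc c * x + cc d) ^ 3) ^ 2 = lift f' ((cc a * x + cc b) / (cc c * x + cc d))"
  proof -
    have "lift f' ((cc a * x + cc b) / (cc c * x + cc d)) * (cc c * x + cc d) ^ 6 = y ^ 2"
      using assms(3) L coordinates_equation[OF assms(1)] by (simp add: moebius_transports_def)
    thus ?thesis using L by (simp add: power_divide field_simps flip: power_mult)
  qed
  have det: "(fps_nth X' 1 * fps_nth Z' 0 - fps_nth X' 0 * fps_nth Z' 1) =
      (a * d - b * c) * (fps_nth X 1 * fps_nth Z 0 - fps_nth X 0 * fps_nth Z 1)"
    by (simp add: X'_def Z'_def algebra_simps)
  have J: "fps_nth X' 1 * fps_nth Z' 0 = fps_nth X' 0 * fps_nth Z' 1 \<longleftrightarrow>
      fps_nth X 1 * fps_nth Z 0 = fps_nth X 0 * fps_nth Z 1"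
    using det assms(2) by auto
  have "fps_nth X' 0 \<noteq> 0 \<or> fps_nth Z' 0 \<noteq> 0"
  proof (rule ccontr)
    assume "\<not> ?thesis"
    hence 0: "a * fps_nth X 0 + b * fps_nth Z 0 = 0" "c * fps_nth X 0 + d * fps_nth Z 0 = 0"
      by (auto simp: X'_def Z'_def)
    have "(a * d - b * c) * fps_nth X 0 =
        d * (a * fps_nth X 0 + b * fps_nth Z 0) - b * (c * fps_nth X 0 + d * fps_nth Z 0)"
      by (simp add: algebra_simps)
    moreover have "(a * d - b * c) * fps_nth Z 0 =
        a * (c * fps_nth X 0 + d * fps_nth Z 0) - c * (a * fps_nth X 0 + b * fps_nth Z 0)"
      by (simp add: algebra_simps)
    ultimately have "fps_nth X 0 = 0" "fps_nth Z 0 = 0" using 0 assms(2) by auto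
    thus False using *(1) by (simp add: parametrisation_def)
  qed
  hence "parametrisation f' X' Y Z'"
    using *(1) Z'nz unfolding parametrisation_def J x' y' eq by auto
  moreover have "moebius a b c d P = weighted_point (fps_nth X' 0) (fps_nth Y 0) (fps_nth Z' 0)"
    using *(1) unfolding *(2)
    by (subst moebius_weighted_point) (auto simp: parametrisation_def X'_def Z'_def)
  ultimately show "coordinates_at f' (moebius a b c d P)
      ((cc a * x + cc b) / (cc c * x + cc d)) (y / (cc c * x + cc d) ^ 3)"
    unfolding coordinates_at_def using x' y' by metis
qed

lemma moebius_inverse:
  assumes "a * d - b * c \<noteq> 0"
    and "a' * a + b' * c = 1" "a' * b + b' * d = 0" "c' * a + d' * c = 0" "c' * b + d' * d = (1::'k::field)"
  shows "moebius a' b' c' d' (moebius a b c d P) = P"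
proof -
  have *: "moebius a' b' c' d' (moebius a b c d (weighted_point X Y Z)) = weighted_point X Y Z"
    if "X \<noteq> 0 \<or> Z \<noteq> 0" for X Y Z
  proof -
    have 1: "a' * (a * X + b * Z) + b' * (c * X + d * Z) = (a' * a + b' * c) * X + (a' * b + b' * d) * Z"
      by (simp add: algebra_simps)
    have 2: "c' * (a * X + b * Z) + d' * (c * X + d * Z) = (c' * a + d' * c) * X + (c' * b + d' * d) * Z"
      by (simp add: algebra_simps)
    have "a * X + b * Z \<noteq> 0 \<or> c * X + d * Z \<noteq> 0"
      using 1 2 assms that by auto
    thus ?thesis using that by (simp add: moebius_weighted_point 1 2 assms)
  qed
  show ?thesis
  proof (cases P)
    case (Aff x y)
    thus ?thesis using *[of x 1 y] by (simp add: weighted_point_def)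
  next
    case (Inf w)
    thus ?thesis using *[of 1 0 w] by (simp add: weighted_point_def)
  qed
qed

lemma lift_moebius:
  "\<exists>N q'. \<forall>x. cc c * x + cc d \<noteq> 0 \<longrightarrow>
     lift q' x = (cc c * x + cc d) ^ N * lift q ((cc a * x + cc b) / (cc c * x + cc d))"
proof (induction q)
  case 0
  show ?case by (intro exI[of _ 0]) simp
next
  case (pCons u q)
  then obtain N q' where *: "\<And>x. cc c * x + cc d \<noteq> 0 \<Longrightarrow>
     lift q' x = (cc c * x + cc d) ^ N * lift q ((cc a * x + cc b) / (cc c * x + cc d))" by blast
  let ?q = "[:u:] * [:d, c:] ^ Suc N + [:b, a:] * q'"
  have "lift ?q x = (cc c * x + cc d) ^ Suc N * lift (pCons u q) ((cc a * x + cc b) / (cc c * x + cc d))"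
    if "cc c * x + cc d \<noteq> 0" for x
  proof -
    have e: "lift [:d, c:] x = cc c * x + cc d" "lift [:b, a:] x = cc a * x + cc b"
      by (simp_all add: algebra_simps)
    have "lift ?q x = cc u * (cc c * x + cc d) ^ Suc N + (cc a * x + cc b) * lift q' x"
      by (simp only: lift_add lift_mult lift_power e) simp
    also have "\<dots> = (cc c * x + cc d) ^ Suc N * lift (pCons u q) ((cc a * x + cc b) / (cc c * x + cc d))"
      unfolding *[OF that] using that by (simp add: distrib_left mult_ac)
    finally show ?thesis .
  qed
  thus ?case by blast
qed

text \<open>
  Denominators are cleared by a power of \<open>c x + d\<close>. With the exponent left open, the induction
  only has to add and multiply.
\<close>

lemma ev_moebius:
  "\<exists>N g'. \<forall>x y. cc c * x + cc d \<noteq> 0 \<longrightarrow>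
     ev g' x y = (cc c * x + cc d) ^ N *
       ev g ((cc a * x + cc b) / (cc c * x + cc d)) (y / (cc c * x + cc d) ^ 3)"
proof (induction g)
  case 0
  show ?case by (intro exI[of _ 0]) simp
next
  case (pCons q g)
  then obtain N g' where g': "\<And>x y. cc c * x + cc d \<noteq> 0 \<Longrightarrow>
     ev g' x y = (cc c * x + cc d) ^ N *
       ev g ((cc a * x + cc b) / (cc c * x + cc d)) (y / (cc c * x + cc d) ^ 3)" by blast
  obtain M q' where q': "\<And>x. cc c * x + cc d \<noteq> 0 \<Longrightarrow>
     lift q' x = (cc c * x + cc d) ^ M * lift q ((cc a * x + cc b) / (cc c * x + cc d))"
    using lift_moebius[of c d q a b] by blast
  let ?g = "[:q' * [:d, c:] ^ (N + 3):] + [:0, [:d, c:] ^ M:] * g'"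
  have "ev ?g x y = (cc c * x + cc d) ^ (M + N + 3) *
       ev (pCons q g) ((cc a * x + cc b) / (cc c * x + cc d)) (y / (cc c * x + cc d) ^ 3)"
    if "cc c * x + cc d \<noteq> 0" for x y
  proof -
    have e: "lift [:d, c:] x = cc c * x + cc d"
      by (simp add: algebra_simps)
    have "ev ?g x y = lift q' x * (cc c * x + cc d) ^ (N + 3) + y * (cc c * x + cc d) ^ M * ev g' x y"
      by (simp only: ev_add ev_mult ev_pCons ev_0 lift_mult lift_power e lift_0) simp
    also have "\<dots> = (cc c * x + cc d) ^ (M + N + 3) *
       ev (pCons q g) ((cc a * x + cc b) / (cc c * x + cc d)) (y / (cc c * x + cc d) ^ 3)"
      unfolding q'[OF that] g'[OF that] using that by (simp add: power_add distrib_left mult_ac)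
    finally show ?thesis .
  qed
  thus ?case by blast
qed

section \<open>Transport of divisors\<close>

lemma push_divisor_add [simp]: "push_divisor s (D + E) = push_divisor s D + push_divisor s E"
  by (simp add: push_divisor_def frag_extend_add)

lemma push_divisor_diff [simp]: "push_divisor s (D - E) = push_divisor s D - push_divisor s E"
  by (simp add: push_divisor_def frag_extend_diff)

lemma push_divisor_uminus [simp]: "push_divisor s (- D) = - push_divisor s D"
  by (simp add: push_divisor_def frag_extend_minus)

lemma push_divisor_0 [simp]: "push_divisor s 0 = 0"
  by (simp add: push_divisor_def)

lemma push_divisor_frag_of [simp]: "push_divisor s (frag_of P) = frag_of (s P)"
  by (simp add: push_divisor_def)

lemma keys_push_divisor: "Poly_Mapping.keys (push_divisor s D) \<subseteq> s ` Poly_Mapping.keys D"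
  using keys_frag_extend[of "\<lambda>P. frag_of (s P)" D] by (auto simp: push_divisor_def)

lemma push_divisor_cong:
  "(\<And>P. P \<in> Poly_Mapping.keys D \<Longrightarrow> s P = t P) \<Longrightarrow> push_divisor s D = push_divisor t D"
  unfolding push_divisor_def by (intro frag_extend_eq) simp

lemma push_divisor_push_divisor: "push_divisor s (push_divisor t D) = push_divisor (s \<circ> t) D"
proof -
  have "Poly_Mapping.keys D \<subseteq> UNIV" by simp
  thus ?thesis by (induction D rule: frag_induction) auto
qed

lemma push_divisor_id: "(\<And>P. P \<in> Poly_Mapping.keys D \<Longrightarrow> s P = P) \<Longrightarrow> push_divisor s D = D"
  using push_divisor_cong[of D s id] by (simp add: push_divisor_def comp_def flip: frag_expansion)

lemma lookup_push_divisor_inj: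
  assumes "inj_on s S" "Poly_Mapping.keys D \<subseteq> S" "P \<in> S"
  shows "Poly_Mapping.lookup (push_divisor s D) (s P) = Poly_Mapping.lookup D P"
  using assms(2)
proof (induction D rule: frag_induction)
  case (one Q)
  thus ?case using assms by (auto simp: inj_on_def)
qed (auto simp: lookup_minus)

lemma divisor_degree_superset:
  assumes "finite S" "Poly_Mapping.keys D \<subseteq> S"
  shows "divisor_degree D = (\<Sum>P\<in>S. Poly_Mapping.lookup D P)"
  unfolding divisor_degree_def using assms
  by (intro sum.mono_neutral_left) (auto simp: in_keys_iff)

lemma divisor_degree_0 [simp]: "divisor_degree 0 = 0"
  by (simp add: divisor_degree_def)

lemma divisor_degree_frag_of [simp]: "divisor_degree (frag_of P) = 1"
  by (simp add: divisor_degree_def)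

lemma divisor_degree_diff [simp]: "divisor_degree (D - E) = divisor_degree D - divisor_degree E"
proof -
  let ?S = "Poly_Mapping.keys D \<union> Poly_Mapping.keys E"
  have "Poly_Mapping.keys (D - E) \<subseteq> ?S" by (rule keys_diff)
  thus ?thesis
    by (simp add: divisor_degree_superset[of ?S] lookup_minus sum_subtractf)
qed

lemma divisor_degree_uminus [simp]: "divisor_degree (- D) = - divisor_degree D"
  using divisor_degree_diff[of 0 D] by simp

lemma divisor_degree_add [simp]: "divisor_degree (D + E) = divisor_degree D + divisor_degree E"
  using divisor_degree_diff[of D "- E"] by simp

lemma divisor_degree_push [simp]: "divisor_degree (push_divisor s D) = divisor_degree D"
proof -
  have "Poly_Mapping.keys D \<subseteq> UNIV" by simp
  thus ?thesis by (induction D rule: frag_induction) auto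
qed

text \<open>
  A quotient \<open>g / h\<close> with divisor \<open>D\<close>, composed with the inverse transformation, has the
  transported divisor. Clearing denominators in \<open>g\<close> and in \<open>h\<close> costs different powers of \<open>c' x +
  d'\<close>, which are balanced by multiplying crosswise.
\<close>

lemma moebius_push_principal:
  assumes "sextic_curve f" "sextic_curve f'"
    and det: "a * d - b * c \<noteq> 0" "a' * d' - b' * c' \<noteq> 0"
    and inv: "a' * a + b' * c = 1" "a' * b + b' * d = 0" "c' * a + d' * c = 0" "c' * b + d' * d = 1"
    and inv': "a * a' + b * c' = 1" "a * b' + b * d' = 0" "c * a' + d * c' = 0" "c * b' + d * d' = 1"
    and tr: "moebius_transports a b c d f f'" "moebius_transports a' b' c' d' f' f"
    and D: "D \<in> principal_divisors f"
  shows "push_divisor (moebius a b c d) D \<in> principal_divisors f'"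
proof -
  interpret f: sextic_curve f by fact
  interpret f': sextic_curve f' by fact
  let ?M = "moebius a b c d" and ?M' = "moebius a' b' c' d'"
  obtain g h where gh: "f.has_divisor g h D" and keys: "Poly_Mapping.keys D \<subseteq> curve_points f"
    using D f.principal_divisors_iff by blast
  have inj: "inj_on ?M (curve_points f)"
    using moebius_inverse[OF det(1) inv] by (metis inj_onI)
  obtain N g1 where g1: "\<And>x y. cc c' * x + cc d' \<noteq> 0 \<Longrightarrow> ev g1 x y = (cc c' * x + cc d') ^ N *
       ev g ((cc a' * x + cc b') / (cc c' * x + cc d')) (y / (cc c' * x + cc d') ^ 3)"
    using ev_moebius[of c' d' g a' b'] by blast
  obtain K h1 where h1: "\<And>x y. cc c' * x + cc d' \<noteq> 0 \<Longrightarrow> ev h1 x y = (cc c' * x + cc d') ^ K *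
       ev h ((cc a' * x + cc b') / (cc c' * x + cc d')) (y / (cc c' * x + cc d') ^ 3)"
    using ev_moebius[of c' d' h a' b'] by blast
  \<comment> \<open>Multiplying crosswise gives both polynomials the same power of the denominator.\<close>
  define g' where "g' = g1 * [:[:d', c':]:] ^ K"
  define h' where "h' = h1 * [:[:d', c':]:] ^ N"
  have key: "ev g' x y \<noteq> 0 \<and> ev h' x y \<noteq> 0 \<and>
       Poly_Mapping.lookup (push_divisor ?M D) Q = fls_subdegree (ev g' x y) - fls_subdegree (ev h' x y)"
    if Q: "coordinates_at f' Q x y" for Q x y
  proof -
    let ?L = "cc c' * x + cc d'"
    let ?x = "(cc a' * x + cc b') / ?L" and ?y = "y / ?L ^ 3"
    have L: "?L \<noteq> 0" and P: "coordinates_at f (?M' Q) ?x ?y"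
      using moebius_coordinates[OF Q det(2) tr(2)] by auto
    have e: "lift [:d', c':] x = ?L" by (simp add: algebra_simps)
    have g': "ev g' x y = ?L ^ (N + K) * ev g ?x ?y"
      unfolding g'_def by (simp only: ev_mult ev_power ev_pCons ev_0 e g1[OF L]) (simp add: power_add)
    have h': "ev h' x y = ?L ^ (N + K) * ev h ?x ?y"
      unfolding h'_def by (simp only: ev_mult ev_power ev_pCons ev_0 e h1[OF L]) (simp add: power_add)
    have nz: "ev g ?x ?y \<noteq> 0" "ev h ?x ?y \<noteq> 0"
      using gh f.ev_eq_0_iff[OF P] by (auto simp: f.has_divisor_def)
    have "?M (?M' Q) = Q" using moebius_inverse[OF det(2) inv'] by simp
    hence "Poly_Mapping.lookup (push_divisor ?M D) Q = Poly_Mapping.lookup D (?M' Q)"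
      using lookup_push_divisor_inj[OF inj keys coordinates_on_curve[OF P f.degree_le]] by simp
    also have "\<dots> = fls_subdegree (ev g ?x ?y) - fls_subdegree (ev h ?x ?y)"
      using gh P by (auto simp: f.has_divisor_def)
    finally show ?thesis using nz L unfolding g' h' by simp
  qed
  have "\<exists>Q x y. coordinates_at f' Q x y"
    using f'.has_root f'.coordinates_exist by (auto simp: curve_points_def) (metis power_zero_numeral)
  hence "\<not> curve_equation f' dvd g'" "\<not> curve_equation f' dvd h'"
    using key f'.ev_eq_0_iff by metis+
  hence "f'.has_divisor g' h' (push_divisor ?M D)"
    using key unfolding f'.has_divisor_def by blast
  moreover have "Poly_Mapping.keys (push_divisor ?M D) \<subseteq> curve_points f'"
  proof -
    have "?M P \<in> curve_points f'" if "P \<in> curve_points f" for P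
      using f.coordinates_exist[OF that] moebius_coordinates(2)[OF _ det(1) tr(1)]
        coordinates_on_curve[OF _ f'.degree_le] by blast
    thus ?thesis using keys_push_divisor[of ?M D] keys by blast
  qed
  ultimately show ?thesis using f'.principal_divisors_iff by blast
qed

section \<open>The curve and its twist\<close>

text \<open>
  If \<open>b\<close> is the compositional inverse of \<open>(1 + t)\<^sup>n - 1\<close>, then \<open>1 + b\<close> is an \<open>n\<close>-th root of \<open>1 +
  t\<close>, and \<open>F - 1\<close> is substituted for \<open>t\<close>.
\<close>

lemma fps_root_exists:
  fixes F :: "'k::field fps"
  assumes "fps_nth F 0 = 1" "of_nat n \<noteq> (0::'k)"
  obtains S where "S ^ n = F" "fps_nth S 0 = 1"
proof -
  define a where "a = (1 + fps_X) ^ n - (1 :: 'k fps)"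
  have a0: "fps_nth a 0 = 0" by (simp add: a_def fps_power_zeroth)
  have a1: "fps_nth a 1 \<noteq> 0"
    using assms(2) by (simp add: a_def fps_power_first[unfolded One_nat_def])
  define b where "b = fps_inv a"
  have b0: "fps_nth b 0 = 0" by (simp add: b_def fps_inv_def)
  have F0: "fps_nth (F - 1) 0 = 0" using assms(1) by simp
  have "a oo b = fps_X" unfolding b_def by (rule fps_inv_right[OF a0 a1])
  moreover have "a oo b = (1 + b) ^ n - 1"
    unfolding a_def using b0
    by (simp add: fps_compose_sub_distrib fps_compose_add_distrib fps_X_fps_compose_startby0
        flip: fps_compose_power)
  ultimately have b: "(1 + b) ^ n = 1 + fps_X" by (simp add: algebra_simps)
  have "((1 + b) oo (F - 1)) ^ n = (1 + fps_X) oo (F - 1)"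
    by (simp only: fps_compose_power[OF F0] b)
  also have "\<dots> = F" using F0 by (simp add: fps_compose_add_distrib fps_X_fps_compose_startby0)
  finally show ?thesis using that b0 by force
qed

lemma lift_C_sextic [simp]: "lift C_sextic x = x ^ 6 + 1"
  by (simp add: C_sextic_def)

lemma poly_C_sextic [simp]: "poly C_sextic x = x ^ 6 + 1"
  by (simp add: C_sextic_def)

lemma C_sextic_monom: "C_sextic = monom 1 6 + 1"
  by (simp add: C_sextic_def monom_altdef)

lemma coeff_C_sextic_6 [simp]: "coeff C_sextic 6 = 1"
  by (simp add: C_sextic_monom)

lemma degree_C_sextic: "degree C_sextic \<le> 6"
  unfolding C_sextic_monom by (intro degree_add_le degree_monom_le) simp

locale fermat_sextic =
  fixes ty :: "'k::alg_closed_field itself"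
  assumes two: "(2::'k) \<noteq> 0" and three: "(3::'k) \<noteq> 0"
begin

lemma six: "of_nat 6 \<noteq> (0::'k)"
proof -
  have "of_nat 6 = (2::'k) * 3" by simp
  thus ?thesis using two three by (metis mult_eq_0_iff)
qed

lemma fps_sqrt_exists:
  assumes "fps_nth F 0 = (w::'k) ^ 2" "w \<noteq> 0"
  obtains S where "S ^ 2 = F" "fps_nth S 0 = w"
proof -
  have "fps_nth (fps_const (inverse (w ^ 2)) * F) 0 = 1" using assms by simp
  moreover have "of_nat 2 \<noteq> (0::'k)" using two by simp
  ultimately obtain S where S: "S ^ 2 = fps_const (inverse (w ^ 2)) * F" "fps_nth S 0 = 1"
    by (rule fps_root_exists)
  have "(fps_const w * S) ^ 2 = F"
    using assms(2) by (simp add: power_mult_distrib S flip: mult.assoc)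
  moreover have "fps_nth (fps_const w * S) 0 = w" using S by simp
  ultimately show ?thesis using that by blast
qed

lemma C_coordinates_exist:
  assumes "P \<in> curve_points (C_sextic :: 'k poly)"
  shows "\<exists>x y. coordinates_at C_sextic P x y"
proof -
  have "\<exists>X Y Z. parametrisation C_sextic X Y Z \<and> P = weighted_point (fps_nth X 0) (fps_nth Y 0) (fps_nth Z 0)"
  proof (cases P)
    case (Aff x0 y0)
    hence eq: "y0 ^ 2 = x0 ^ 6 + 1" using assms by (simp add: curve_points_def)
    show ?thesis
    proof (cases "y0 = 0")
      case False
      define X where "X = fps_const x0 + fps_X"
      have "fps_nth (X ^ 6 + 1) 0 = y0 ^ 2" by (simp add: X_def fps_power_zeroth eq)
      then obtain Y where Y: "Y ^ 2 = X ^ 6 + 1" "fps_nth Y 0 = y0"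
        using fps_sqrt_exists False by blast
      have "fps_to_fls Y ^ 2 = fps_to_fls X ^ 6 + 1"
        using arg_cong[OF Y(1), of fps_to_fls] by (simp add: fps_to_fls_power)
      hence "parametrisation C_sextic X Y 1"
        using False Y by (simp add: parametrisation_def X_def)
      moreover have "P = weighted_point (fps_nth X 0) (fps_nth Y 0) (fps_nth 1 0)"
        using Aff Y by (simp add: weighted_point_def X_def)
      ultimately show ?thesis by blast
    next
      case True
      hence x6: "x0 ^ 6 = - 1" using eq by (simp add: eq_neg_iff_add_eq_0)
      \<comment> \<open>Here \<open>y = t\<close> is the uniformiser, and \<open>x\<close> is the sixth root of \<open>t\<^sup>2 - 1\<close> with constant term \<open>x0\<close>.\<close>
      obtain S where S: "S ^ 6 = 1 - fps_X ^ 2" "fps_nth S 0 = (1::'k)"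
        using fps_root_exists[OF _ six, of "1 - fps_X ^ 2"] by auto
      have "fps_nth (S ^ 6) 1 = of_nat 6 * fps_nth S 1"
        by (simp add: fps_power_first S(2) del: One_nat_def of_nat_numeral)
      hence S1: "fps_nth S 1 = 0" using six by (simp add: S(1))
      define X where "X = fps_const x0 * S"
      have X6: "X ^ 6 = fps_X ^ 2 - 1" by (simp add: X_def power_mult_distrib S x6 algebra_simps)
      have "fps_to_fls X ^ 6 = fps_to_fls (X ^ 6)" by (simp only: fps_to_fls_power)
      also have "\<dots> = fls_X ^ 2 - 1" unfolding X6 by (simp add: fps_to_fls_power)
      finally have "fps_to_fls fps_X ^ 2 = fps_to_fls X ^ 6 + (1 :: 'k fls)" by simp
      hence "parametrisation C_sextic X fps_X 1"
        using S1 by (simp add: parametrisation_def X_def)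
      moreover have "P = weighted_point (fps_nth X 0) (fps_nth fps_X 0) (fps_nth 1 0)"
        using Aff True S by (simp add: weighted_point_def X_def)
      ultimately show ?thesis by blast
    qed
  next
    case (Inf w)
    hence w: "w ^ 2 = 1" using assms by (simp add: curve_points_def)
    hence "w \<noteq> 0" by auto
    have "fps_nth (1 + fps_X ^ 6) 0 = w ^ 2" by (simp add: w)
    then obtain Y where Y: "Y ^ 2 = 1 + fps_X ^ 6" "fps_nth Y 0 = w"
      using fps_sqrt_exists \<open>w \<noteq> 0\<close> by blast
    have "fps_to_fls Y ^ 2 = 1 + (fls_X :: 'k fls) ^ 6"
      using arg_cong[OF Y(1), of fps_to_fls] by (simp add: fps_to_fls_power)
    moreover have fls_X_nonzero: "(fls_X :: 'k fls) \<noteq> 0" by simp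
    moreover have "(u / t ^ 3) ^ 2 = (1 / t) ^ 6 + 1" if "u ^ 2 = 1 + t ^ 6" "t \<noteq> 0" for u t :: "'k fls"
      using that by (simp add: power_divide add_divide_distrib flip: power_mult)
    ultimately have "(fps_to_fls Y / fps_to_fls fps_X ^ 3) ^ 2 =
        lift C_sextic (fps_to_fls 1 / fps_to_fls fps_X)"
      unfolding lift_C_sextic fps_X_to_fls fps_one_to_fls using fls_X_nonzero by blast
    hence "parametrisation C_sextic 1 Y fps_X"
      unfolding parametrisation_def using Y \<open>w \<noteq> 0\<close> by (intro conjI) auto
    moreover have "P = weighted_point (fps_nth 1 0) (fps_nth Y 0) (fps_nth fps_X 0)"
      using Inf Y by (simp add: weighted_point_def)
    ultimately show ?thesis by blast
  qed
  thus ?thesis unfolding coordinates_at_def by blast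
qed

lemma minus_one_root: obtains e :: 'k where "e ^ 6 = - 1" "e \<noteq> 0"
proof -
  obtain e :: 'k where "e ^ 6 = - 1" using nth_root_exists[of 6 "- 1 :: 'k"] by auto
  moreover from this have "e \<noteq> 0" by auto
  ultimately show ?thesis using that by blast
qed

sublocale C: sextic_curve "C_sextic :: 'k poly"
proof
  show "(2::'k) \<noteq> 0" by (rule two)
  show "degree (C_sextic :: 'k poly) \<le> 6" by (rule degree_C_sextic)
  show "\<exists>x0. poly (C_sextic :: 'k poly) x0 = 0"
    using minus_one_root by (metis poly_C_sextic add.left_inverse)
qed (rule C_coordinates_exist)

end

lemma coeff_power_linear: "coeff ([:b, a:] ^ n) n = (a::'a::comm_ring_1) ^ n"
proof (induction n)
  case (Suc n)
  have "degree ([:b, a:] ^ n) \<le> n"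
    using degree_power_le[of "[:b, a:]" n] by (simp split: if_splits)
  hence "coeff ([:b, a:] ^ n) (Suc n) = 0" by (intro coeff_eq_0) simp
  thus ?case using Suc by simp
qed simp

lemma twist_coeff_6: "coeff (twist_sextic a b c d) 6 = a ^ 6 + c ^ 6"
  by (simp add: twist_sextic_def coeff_power_linear)

lemma degree_twist: "degree (twist_sextic a b c d) \<le> 6"
  unfolding twist_sextic_def
  by (intro degree_add_le order_trans[OF degree_power_le]) simp_all

lemma poly_twist: "poly (twist_sextic a b c d) x = (a * x + b) ^ 6 + (c * x + d) ^ 6"
  by (simp add: twist_sextic_def algebra_simps)

lemma lift_twist: "lift (twist_sextic a b c d) x = (cc a * x + cc b) ^ 6 + (cc c * x + cc d) ^ 6"
  by (simp add: twist_sextic_def algebra_simps)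

lemma twist_transports: "moebius_transports a b c d (twist_sextic a b c d) C_sextic"
  unfolding moebius_transports_def by (simp add: lift_twist distrib_right power_divide)

lemma twist_transports_inverse:
  assumes "a * a' + b * c' = 1" "a * b' + b * d' = 0" "c * a' + d * c' = 0" "c * b' + d * d' = 1"
  shows "moebius_transports a' b' c' d' C_sextic (twist_sextic a b c d)"
  unfolding moebius_transports_def
proof (intro allI impI)
  fix x
  let ?L = "cc c' * x + cc d'" and ?K = "cc a' * x + cc b'"
  assume L: "?L \<noteq> 0"
  have 1: "cc a * ?K + cc b * ?L = cc (a * a' + b * c') * x + cc (a * b' + b * d')"
    by (simp add: algebra_simps flip: fls_plus_const)
  have 2: "cc c * ?K + cc d * ?L = cc (c * a' + d * c') * x + cc (c * b' + d * d')"
    by (simp add: algebra_simps flip: fls_plus_const)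
  have "cc a * (?K / ?L) + cc b = (cc a * ?K + cc b * ?L) / ?L" "cc c * (?K / ?L) + cc d = (cc c * ?K + cc d * ?L) / ?L"
    using L by (simp_all add: field_simps)
  hence "cc a * (?K / ?L) + cc b = x / ?L" "cc c * (?K / ?L) + cc d = 1 / ?L"
    unfolding 1 2 using assms by simp_all
  thus "lift (twist_sextic a b c d) (?K / ?L) * ?L ^ 6 = lift C_sextic x"
    using L by (simp add: lift_twist power_divide distrib_right)
qed

lemma moebius_twist_points:
  assumes "a * d - b * c \<noteq> (0::'k::field)" "P \<in> curve_points (twist_sextic a b c d)"
  shows "moebius a b c d P \<in> curve_points C_sextic"
proof (cases P)
  case (Aff x y)
  hence y: "y ^ 2 = (a * x + b) ^ 6 + (c * x + d) ^ 6"
    using assms(2) by (simp add: curve_points_def poly_twist)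
  show ?thesis
  proof (cases "c * x + d = 0")
    case True
    have "a * x + b \<noteq> 0"
    proof
      assume "a * x + b = 0"
      moreover have "a * d - b * c = a * (c * x + d) - c * (a * x + b)" by (simp add: algebra_simps)
      ultimately show False using True assms(1) by simp
    qed
    thus ?thesis using Aff y True
      by (simp add: weighted_point_def curve_points_def power_divide flip: power_mult)
  next
    case False
    thus ?thesis using Aff y add_divide_distrib[of "(a * x + b) ^ 6" "(c * x + d) ^ 6" "(c * x + d) ^ 6"]
      by (simp add: weighted_point_def curve_points_def power_divide flip: power_mult)
  qed
next
  case (Inf w)
  hence w: "w ^ 2 = a ^ 6 + c ^ 6"
    using assms(2) by (simp add: curve_points_def twist_coeff_6)
  show ?thesis
  proof (cases "c = 0")
    case True
    hence "a \<noteq> 0" using assms(1) by auto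
    thus ?thesis using Inf w True
      by (simp add: weighted_point_def curve_points_def power_divide flip: power_mult)
  next
    case False
    thus ?thesis using Inf w
      by (simp add: weighted_point_def curve_points_def power_divide add_divide_distrib flip: power_mult)
  qed
qed

locale fermat_twist = fermat_sextic ty for ty :: "'k::alg_closed_field itself" +
  fixes a b c d :: 'k
  assumes det: "a * d - b * c \<noteq> 0"
begin

abbreviation "C' \<equiv> twist_sextic a b c d"

definition "a' = d / (a * d - b * c)"
definition "b' = - b / (a * d - b * c)"
definition "c' = - c / (a * d - b * c)"
definition "d' = a / (a * d - b * c)"

lemma inverse_matrix:
  "a' * a + b' * c = 1" "a' * b + b' * d = 0" "c' * a + d' * c = 0" "c' * b + d' * d = 1"
  "a * a' + b * c' = 1" "a * b' + b * d' = 0" "c * a' + d * c' = 0" "c * b' + d * d' = 1"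
  using det by (simp_all add: a'_def b'_def c'_def d'_def mult.commute diff_divide_distrib[symmetric] add_divide_distrib[symmetric])

lemma det': "a' * d' - b' * c' \<noteq> 0"
proof -
  have "(a' * d' - b' * c') * (a * d - b * c) =
      (a' * a + b' * c) * (c' * b + d' * d) - (a' * b + b' * d) * (c' * a + d' * c)"
    by (simp add: algebra_simps)
  hence "(a' * d' - b' * c') * (a * d - b * c) = 1" by (simp only: inverse_matrix) simp
  thus ?thesis by auto
qed

lemma moebius_left_inverse: "moebius a' b' c' d' (moebius a b c d P) = P"
  using moebius_inverse[OF det] inverse_matrix by blast

sublocale C': sextic_curve C'
proof
  show "(2::'k) \<noteq> 0" by (rule two)
  show "degree C' \<le> 6" by (rule degree_twist)
  show "\<exists>x y. coordinates_at C' P x y" if P: "P \<in> curve_points C'" for P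
  proof -
    obtain x y where "coordinates_at C_sextic (moebius a b c d P) x y"
      using C_coordinates_exist moebius_twist_points[OF det P] by blast
    from moebius_coordinates(2)[OF this det' twist_transports_inverse] show ?thesis
      using moebius_left_inverse inverse_matrix by metis
  qed
  \<comment> \<open>At most one of the roots \<open>e\<close> and \<open>- e\<close> of \<open>X\<^sup>6 + 1\<close> comes from infinity.\<close>
  show "\<exists>x0. poly C' x0 = 0"
  proof -
    obtain e :: 'k where e: "e ^ 6 = - 1" "e \<noteq> 0" using minus_one_root by blast
    have "\<exists>s. s ^ 6 = - 1 \<and> a - s * c \<noteq> 0"
    proof (rule ccontr)
      assume "\<not> ?thesis"
      hence "a - e * c = 0" "a - (- e) * c = 0" using e by (metis power_minus_even even_numeral)+
      hence "a = e * c" "2 * (e * c) = 0" by (auto simp: algebra_simps)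
      hence "a = 0" "c = 0" using two e by auto
      thus False using det by simp
    qed
    then obtain s where s: "s ^ 6 = - 1" "a - s * c \<noteq> 0" by blast
    define x0 where "x0 = (s * d - b) / (a - s * c)"
    have "(a - s * c) * x0 = s * d - b" using s by (simp add: x0_def)
    hence "a * x0 + b = s * (c * x0 + d)" by (simp add: algebra_simps)
    hence "poly C' x0 = 0" by (simp add: poly_twist power_mult_distrib s)
    thus ?thesis by blast
  qed
qed

lemma push_twist_principal:
  "D \<in> principal_divisors C' \<Longrightarrow> push_divisor (moebius a b c d) D \<in> principal_divisors C_sextic"
  by (rule moebius_push_principal[OF C'.sextic_curve_axioms C.sextic_curve_axioms det det'
      inverse_matrix twist_transports twist_transports_inverse[OF inverse_matrix(5-8)]])

lemma push_twist_principal_inverse: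
  "D \<in> principal_divisors C_sextic \<Longrightarrow> push_divisor (moebius a' b' c' d') D \<in> principal_divisors C'"
  by (rule moebius_push_principal[OF C.sextic_curve_axioms C'.sextic_curve_axioms det' det
      inverse_matrix(5-8) inverse_matrix(1-4) twist_transports_inverse[OF inverse_matrix(5-8)] twist_transports])

end

section \<open>Field automorphisms\<close>

context
  fixes \<sigma> :: "'k::field \<Rightarrow> 'k"
  assumes \<sigma>: "field_automorphism \<sigma>"
begin

lemma aut_add: "\<sigma> (x + y) = \<sigma> x + \<sigma> y" and aut_mult: "\<sigma> (x * y) = \<sigma> x * \<sigma> y"
  and aut_bij: "bij \<sigma>"
  using \<sigma> by (auto simp: field_automorphism_def)

lemma aut_0: "\<sigma> 0 = 0"
  using aut_add[of 0 0] by (metis add_0 add_cancel_left_right)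

lemma aut_eq_iff: "\<sigma> x = \<sigma> y \<longleftrightarrow> x = y"
  using aut_bij by (metis bij_is_inj inj_eq)

lemma aut_1: "\<sigma> 1 = 1"
proof -
  have "\<sigma> 1 \<noteq> \<sigma> 0" by (simp only: aut_eq_iff) simp
  thus ?thesis using aut_mult[of 1 1] by (simp add: aut_0)
qed

lemma aut_uminus: "\<sigma> (- x) = - \<sigma> x"
  using aut_add[of x "- x"] aut_0 by (simp add: eq_neg_iff_add_eq_0 add.commute)

lemma aut_power: "\<sigma> (x ^ n) = \<sigma> x ^ n"
  by (induction n) (simp_all add: aut_1 aut_mult)

lemma aut_poly_add: "map_poly \<sigma> (p + q) = map_poly \<sigma> p + map_poly \<sigma> q"
  by (rule poly_map_hom_add) (simp_all add: aut_0 aut_add)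

lemma aut_poly_mult: "map_poly \<sigma> (p * q) = map_poly \<sigma> p * map_poly \<sigma> q"
  by (rule poly_map_hom_mult) (simp_all add: aut_0 aut_add aut_mult)

lemma aut_poly: "poly (map_poly \<sigma> q) (\<sigma> x) = \<sigma> (poly q x)"
  by (induction q) (simp_all add: map_poly_pCons aut_0 aut_add aut_mult)

definition aut2 :: "'k poly poly \<Rightarrow> 'k poly poly" where
  "aut2 g = map_poly (map_poly \<sigma>) g"

lemma aut2_add: "aut2 (p + q) = aut2 p + aut2 q"
  unfolding aut2_def by (rule poly_map_hom_add) (simp_all add: aut_poly_add)

lemma aut2_mult: "aut2 (p * q) = aut2 p * aut2 q"
  unfolding aut2_def by (rule poly_map_hom_mult) (simp_all add: aut_poly_add aut_poly_mult)

lemma aut2_1: "aut2 1 = 1"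
  by (simp add: aut2_def aut_1)

lemma aut2_power: "aut2 (p ^ n) = aut2 p ^ n"
  by (induction n) (simp_all add: aut2_1 aut2_mult)

lemma aut2_sum: "aut2 (sum F A) = (\<Sum>i\<in>A. aut2 (F i))"
  by (induction A rule: infinite_finite_induct) (simp_all add: aut2_add, simp_all add: aut2_def)

lemma aut2_pCons: "aut2 (pCons q g) = pCons (map_poly \<sigma> q) (aut2 g)"
  by (simp add: aut2_def map_poly_pCons)

lemma aut2_0: "aut2 0 = 0"
  by (simp add: aut2_def)

lemma aut2_poly2: "poly2 (aut2 g) (\<sigma> x) (\<sigma> y) = \<sigma> (poly2 g x y)"
  by (induction g) (simp_all add: poly2_def aut2_0 aut2_pCons aut_0 aut_add aut_mult aut_poly)

lemma aut2_vanishes: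
  assumes "vanishes_to_order W x0 y0 n g"
  shows "vanishes_to_order (aut2 W) (\<sigma> x0) (\<sigma> y0) n (aut2 g)"
proof -
  obtain s c q where s: "poly2 s x0 y0 \<noteq> 0"
    "s * g = (\<Sum>i\<le>n. c i * [:[:- x0, 1:]:] ^ i * [:[:- y0:], 1:] ^ (n - i)) + q * W"
    using assms unfolding vanishes_to_order_def by blast
  have l: "aut2 [:[:- x0, 1:]:] = [:[:- \<sigma> x0, 1:]:]" "aut2 [:[:- y0:], 1:] = [:[:- \<sigma> y0:], 1:]"
    by (simp_all add: aut2_pCons aut2_0 map_poly_pCons aut_0 aut_1 aut_uminus one_pCons)
  have "aut2 s * aut2 g = (\<Sum>i\<le>n. aut2 (c i) * [:[:- \<sigma> x0, 1:]:] ^ i * [:[:- \<sigma> y0:], 1:] ^ (n - i)) + aut2 q * aut2 W"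
    using arg_cong[OF s(2), of aut2]
    by (simp only: aut2_mult aut2_add aut2_sum aut2_power l)
  moreover have "poly2 (aut2 s) (\<sigma> x0) (\<sigma> y0) \<noteq> 0"
    using s(1) aut2_poly2 aut_eq_iff aut_0 by metis
  ultimately show ?thesis unfolding vanishes_to_order_def by (intro exI conjI)
qed

lemma aut_degree: "degree (map_poly \<sigma> q) = degree q"
  by (intro degree_map_poly) (metis aut_0 aut_eq_iff)

lemma aut_map_poly_eq_0: "map_poly \<sigma> q = 0 \<longleftrightarrow> q = 0"
  by (intro map_poly_eq_0_iff) (auto simp: aut_0, metis aut_0 aut_eq_iff)

lemma aut2_degree: "degree (aut2 g) = degree g"
  unfolding aut2_def by (intro degree_map_poly) (simp add: aut_map_poly_eq_0)

lemma aut2_coeff: "coeff (aut2 g) j = map_poly \<sigma> (coeff g j)"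
  by (simp add: aut2_def coeff_map_poly)

lemma aut2_other_chart: "aut2 (other_chart n g) = other_chart n (aut2 g)"
  unfolding other_chart_def
  by (simp only: aut2_sum aut2_degree aut2_coeff aut_degree)
     (simp add: aut2_def map_poly_monom aut_0 coeff_map_poly)

lemma aut2_weighted_degree: "weighted_degree_le n g \<Longrightarrow> weighted_degree_le n (aut2 g)"
  unfolding weighted_degree_le_def by (metis aut2_coeff coeff_map_poly aut_0)

lemma aut2_curve_equation: "map_poly \<sigma> f = f \<Longrightarrow> aut2 (curve_equation f) = curve_equation f"
proof -
  have "map_poly \<sigma> (- f) = - map_poly \<sigma> f"
    by (intro poly_eqI) (simp add: coeff_map_poly aut_0 aut_uminus)
  thus "map_poly \<sigma> f = f \<Longrightarrow> aut2 (curve_equation f) = curve_equation f"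
    by (simp add: curve_equation_def aut2_pCons aut2_0 aut_1)
qed

lemma aut_curve_points:
  assumes "map_poly \<sigma> f = f" "P \<in> curve_points f"
  shows "map_curve_point \<sigma> P \<in> curve_points f"
proof -
  have "\<sigma> (coeff f 6) = coeff f 6"
    by (metis assms(1) aut_0 coeff_map_poly)
  moreover have "poly f (\<sigma> x) = \<sigma> (poly f x)" for x
    by (metis assms(1) aut_poly)
  ultimately show ?thesis
    using assms(2) by (auto simp: curve_points_def simp flip: aut_power)
qed

end

lemma field_automorphism_inv:
  assumes "field_automorphism \<sigma>"
  shows "field_automorphism (inv_into UNIV \<sigma>)"
  unfolding field_automorphism_def
proof (intro conjI allI)
  have b: "bij \<sigma>" using assms by (simp add: field_automorphism_def)
  thus "bij (inv_into UNIV \<sigma>)" by (rule bij_imp_bij_inv)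
  fix x y
  have s: "\<sigma> (inv_into UNIV \<sigma> z) = z" "inv_into UNIV \<sigma> (\<sigma> z) = z" for z
    using b by (simp_all add: bij_is_surj surj_f_inv_f bij_is_inj inv_f_f)
  show "inv_into UNIV \<sigma> (x + y) = inv_into UNIV \<sigma> x + inv_into UNIV \<sigma> y" "inv_into UNIV \<sigma> (x * y) = inv_into UNIV \<sigma> x * inv_into UNIV \<sigma> y"
    using s aut_add[OF assms] aut_mult[OF assms] by metis+
qed

lemma aut_inv_map_poly:
  assumes "field_automorphism \<sigma>"
  shows "map_poly (inv_into UNIV \<sigma>) (map_poly \<sigma> q) = q" "aut2 (inv_into UNIV \<sigma>) (aut2 \<sigma> g) = g"
proof -
  have i: "inv_into UNIV \<sigma> (\<sigma> z) = z" for z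
    using assms by (simp add: field_automorphism_def bij_is_inj inv_f_f)
  show *: "map_poly (inv_into UNIV \<sigma>) (map_poly \<sigma> q) = q" for q
    by (intro poly_eqI) (simp add: coeff_map_poly aut_0[OF assms] aut_0[OF field_automorphism_inv[OF assms]] i)
  show "aut2 (inv_into UNIV \<sigma>) (aut2 \<sigma> g) = g"
    by (intro poly_eqI) (simp add: aut2_def[OF assms] aut2_def[OF field_automorphism_inv[OF assms]] coeff_map_poly *)
qed

lemma aut2_vanishing_order:
  assumes "field_automorphism \<sigma>"
  shows "vanishing_order (aut2 \<sigma> W) (\<sigma> x0) (\<sigma> y0) (aut2 \<sigma> g) = vanishing_order W x0 y0 g"
proof -
  have i: "inv_into UNIV \<sigma> (\<sigma> z) = z" for z
    using assms by (simp add: field_automorphism_def bij_is_inj inv_f_f)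
  have "vanishes_to_order (aut2 \<sigma> W) (\<sigma> x0) (\<sigma> y0) n (aut2 \<sigma> g) \<longleftrightarrow> vanishes_to_order W x0 y0 n g" for n
    using aut2_vanishes[OF assms, of W x0 y0 n g]
      aut2_vanishes[OF field_automorphism_inv[OF assms], of "aut2 \<sigma> W" "\<sigma> x0" "\<sigma> y0" n "aut2 \<sigma> g"]
    by (auto simp: aut_inv_map_poly[OF assms] i)
  thus ?thesis by (simp add: vanishing_order_def)
qed

lemma aut_order_at:
  assumes "field_automorphism \<sigma>" "map_poly \<sigma> f = f"
  shows "order_at f n (aut2 \<sigma> g) (map_curve_point \<sigma> P) = order_at f n g P"
proof (cases P)
  case (Aff x y)
  thus ?thesis
    using aut2_vanishing_order[OF assms(1), of "curve_equation f" x y g]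
    by (simp add: aut2_curve_equation[OF assms])
next
  case (Inf w)
  thus ?thesis
    using aut2_vanishing_order[OF assms(1), of "other_chart 6 (curve_equation f)" 0 w "other_chart n g"]
    by (simp add: aut2_curve_equation[OF assms] aut2_other_chart[OF assms(1)] aut_0[OF assms(1)])
qed

text \<open>
  An automorphism of the field, applied to all coefficients, maps the witnesses of vanishing of
  \<open>g\<close> at \<open>P\<close> to witnesses for the conjugates of \<open>g\<close> and \<open>P\<close>.
\<close>

lemma aut_push_principal:
  assumes \<sigma>: "field_automorphism \<sigma>" "map_poly \<sigma> f = f" and D: "D \<in> principal_divisors f"
  shows "push_divisor (map_curve_point \<sigma>) D \<in> principal_divisors f"
proof -
  let ?s = "map_curve_point \<sigma>" and ?t = "map_curve_point (inv_into UNIV \<sigma>)"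
  have b: "bij \<sigma>" using \<sigma> by (simp add: field_automorphism_def)
  have \<tau>: "field_automorphism (inv_into UNIV \<sigma>)" "map_poly (inv_into UNIV \<sigma>) f = f"
    using field_automorphism_inv[OF \<sigma>(1)] aut_inv_map_poly(1)[OF \<sigma>(1), of f] \<sigma>(2) by simp_all
  have st: "?s (?t P) = P" "?t (?s P) = P" for P
    by (cases P; simp add: b bij_is_surj surj_f_inv_f bij_is_inj inv_f_f)+
  obtain n g h where *: "Poly_Mapping.keys D \<subseteq> curve_points f"
      "weighted_degree_le n g" "\<not> curve_equation f dvd g"
      "weighted_degree_le n h" "\<not> curve_equation f dvd h"
      "\<And>P. P \<in> curve_points f \<Longrightarrow>
         Poly_Mapping.lookup D P = int (order_at f n g P) - int (order_at f n h P)"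
    using D by (auto simp: principal_divisors_def)
  have dvd: "\<not> curve_equation f dvd aut2 \<sigma> k" if "\<not> curve_equation f dvd k" for k
  proof
    assume "curve_equation f dvd aut2 \<sigma> k"
    then obtain q where "aut2 \<sigma> k = curve_equation f * q" by (elim dvdE)
    hence "aut2 (inv_into UNIV \<sigma>) (aut2 \<sigma> k) = aut2 (inv_into UNIV \<sigma>) (curve_equation f) * aut2 (inv_into UNIV \<sigma>) q"
      by (simp add: aut2_mult[OF \<tau>(1)])
    thus False using that by (simp add: aut_inv_map_poly(2)[OF \<sigma>(1)] aut2_curve_equation[OF \<tau>])
  qed
  have inj: "inj_on ?s (curve_points f)" by (metis st(2) inj_onI)
  have "Poly_Mapping.lookup (push_divisor ?s D) P =
      int (order_at f n (aut2 \<sigma> g) P) - int (order_at f n (aut2 \<sigma> h) P)"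
    if P: "P \<in> curve_points f" for P
  proof -
    have Q: "?t P \<in> curve_points f" using aut_curve_points[OF \<tau> P] .
    show ?thesis
      using lookup_push_divisor_inj[OF inj *(1) Q] *(6)[OF Q]
        aut_order_at[OF \<sigma>, of n g "?t P"] aut_order_at[OF \<sigma>, of n h "?t P"]
      by (simp add: st)
  qed
  moreover have "Poly_Mapping.keys (push_divisor ?s D) \<subseteq> curve_points f"
    using keys_push_divisor[of ?s D] *(1) aut_curve_points[OF \<sigma>] by blast
  ultimately show ?thesis
    unfolding principal_divisors_def mem_Collect_eq carrier_free_Abelian_group_iff
    by (intro conjI exI[of _ n] exI[of _ "aut2 \<sigma> g"] exI[of _ "aut2 \<sigma> h"] ballI
        aut2_weighted_degree[OF \<sigma>(1)] dvd *(2-5))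
qed

section \<open>The hyperelliptic involution\<close>

fun hyper :: "'k::field curve_point \<Rightarrow> 'k curve_point" where
  "hyper (Aff x y) = Aff x (- y)"
| "hyper (Inf w) = Inf (- w)"

lemma hyper_hyper [simp]: "hyper (hyper P) = P"
  by (cases P) simp_all

lemma coordinates_hyper:
  assumes "coordinates_at f P x y"
  shows "coordinates_at f (hyper P) x (- y)"
proof -
  obtain X Y Z where *: "parametrisation f X Y Z"
      "P = weighted_point (fps_nth X 0) (fps_nth Y 0) (fps_nth Z 0)"
      "x = fps_to_fls X / fps_to_fls Z" "y = fps_to_fls Y / fps_to_fls Z ^ 3"
    using assms by (auto simp: coordinates_at_def)
  have "parametrisation f X (- Y) Z" using *(1) by (auto simp: parametrisation_def split: if_splits)
  moreover have "hyper P = weighted_point (fps_nth X 0) (fps_nth (- Y) 0) (fps_nth Z 0)"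
    using * by (simp add: weighted_point_def)
  ultimately show ?thesis unfolding coordinates_at_def using * by (intro exI conjI) auto
qed

lemma poly_roots_split: "poly q e = 0 \<Longrightarrow> \<exists>r. q = [:- e, 1:] * r" for q :: "'k::field poly"
  by (metis dvdE poly_eq_0_iff_dvd)

context fermat_sextic
begin

abbreviation "C \<equiv> (C_sextic :: 'k poly)"
abbreviation "Prin \<equiv> principal_divisors C"

lemma square_root_exists: "\<exists>s::'k. s ^ 2 = z"
  using nth_root_exists[of 2 z] by auto

lemma minus_eq_iff_0: "(z::'k) = - z \<longleftrightarrow> z = 0"
  using two by (metis add_eq_0_iff2 mult_2 mult_eq_0_iff neg_0_equal_iff_equal)

lemma C_coordinates_cases:
  assumes "coordinates_at C P x y"
  obtains (Aff) x0 y0 where "P = Aff x0 y0" "y0 ^ 2 = x0 ^ 6 + 1" "local_parameters C x0 y0 x y"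
      "vge 1 (x - cc x0)" "vge 1 (y - cc y0)"
  | (Inf) w where "P = Inf w" "w = 1 \<or> w = - 1" "x \<noteq> 0" "fls_subdegree x = - 1" "y \<noteq> 0" "fls_subdegree y = - 3"
  using assms degree_C_sextic
proof (cases rule: coordinates_cases)
  case (Aff x0 y0)
  have "y0 ^ 2 = x0 ^ 6 + 1" using local_point_on_curve[OF Aff(2)] by simp
  moreover have "vge 1 (x - cc x0)" "vge 1 (y - cc y0)"
    using Aff(2) by (simp_all add: local_parameters_def)
  ultimately show ?thesis using that(1) Aff by blast
next
  case (Inf w)
  have "w ^ 2 = 1"
    using coordinates_on_curve[OF assms degree_C_sextic] Inf(1) by (simp add: curve_points_def)
  hence w: "w = 1 \<or> w = - 1" by (simp add: power2_eq_1_iff)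
  hence w0: "w \<noteq> 0" by auto
  have ix: "fls_subdegree (inverse x) = 1" and yw: "vge 1 (y / x ^ 3 - cc w)"
    using Inf(4) w0 by (auto simp: local_parameters_def)
  have "fls_subdegree (x * inverse x) = fls_subdegree x + fls_subdegree (inverse x)"
    using Inf(2) by (intro fls_subdegree_mult) auto
  hence x: "fls_subdegree x = - 1" using ix Inf(2) by simp
  have q: "y / x ^ 3 \<noteq> 0" "fls_subdegree (y / x ^ 3) = 0"
    using approx_nonzero[OF yw w0] by auto
  hence y0: "y \<noteq> 0" by auto
  have "y = (y / x ^ 3) * x ^ 3" using Inf(2) by simp
  moreover have "fls_subdegree ((y / x ^ 3) * x ^ 3) = - 3"
    using q Inf(2) x by (subst fls_subdegree_mult) (auto simp: fls_subdegree_pow)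
  ultimately have "fls_subdegree y = - 3" by metis
  thus ?thesis using that(2)[OF Inf(1) w Inf(2) x y0] by blast
qed

lemma order_x_minus:
  assumes "coordinates_at C P x y"
  shows "x - cc e \<noteq> 0"
    and "fls_subdegree (x - cc e) =
      (case P of Aff x0 y0 \<Rightarrow> if x0 = e then (if y0 = 0 then 2 else 1) else 0 | Inf w \<Rightarrow> - 1)"
proof -
  have "x - cc e \<noteq> 0 \<and> fls_subdegree (x - cc e) =
      (case P of Aff x0 y0 \<Rightarrow> if x0 = e then (if y0 = 0 then 2 else 1) else 0 | Inf w \<Rightarrow> - 1)"
    using assms
  proof (cases rule: C_coordinates_cases)
    case (Aff x0 y0)
    show ?thesis
    proof (cases "x0 = e")
      case True
      thus ?thesis using Aff order_x_at_ramification_point[of C x0 x y]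
        by (cases "y0 = 0") (auto simp: local_parameters_def)
    next
      case False
      have "vge 1 ((x - cc e) - cc (x0 - e))" using Aff(4) by (simp flip: fls_minus_const)
      from approx_nonzero[OF this] show ?thesis using False Aff(1) by simp
    qed
  next
    case (Inf w)
    have "lift [:- e, 1:] x = x - cc e" by simp
    thus ?thesis using order_lift_at_pole[of x "[:- e, 1:]"] Inf by simp
  qed
  thus "x - cc e \<noteq> 0" and "fls_subdegree (x - cc e) =
      (case P of Aff x0 y0 \<Rightarrow> if x0 = e then (if y0 = 0 then 2 else 1) else 0 | Inf w \<Rightarrow> - 1)" by auto
qed

section \<open>Principal divisors have degree zero\<close>

text \<open>The divisor of the function \<open>x - e\<close>.\<close>

definition fiber :: "'k \<Rightarrow> 'k \<Rightarrow> 'k curve_point \<Rightarrow>\<^sub>0 int" where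
  "fiber e y0 = frag_of (Aff e y0) + frag_of (Aff e (- y0)) - frag_of (Inf 1) - frag_of (Inf (- 1))"

lemma lookup_fiber:
  assumes "coordinates_at C P x y" "y0 ^ 2 = e ^ 6 + 1"
  shows "Poly_Mapping.lookup (fiber e y0) P = fls_subdegree (x - cc e)"
  unfolding order_x_minus(2)[OF assms(1)]
  using assms(1)
proof (cases rule: C_coordinates_cases)
  case (Aff x1 y1)
  have "y1 = y0 \<or> y1 = - y0" if "x1 = e"
    using that Aff(2) assms(2) by (metis power2_eq_iff)
  thus "Poly_Mapping.lookup (fiber e y0) P =
      (case P of Aff x0 y0 \<Rightarrow> if x0 = e then (if y0 = 0 then 2 else 1) else 0 | Inf w \<Rightarrow> - 1)"
    using Aff(1) minus_eq_iff_0[of y0] minus_eq_iff_0[of "- y0"]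
    by (auto simp: fiber_def lookup_add lookup_minus)
next
  case (Inf w)
  thus "Poly_Mapping.lookup (fiber e y0) P =
      (case P of Aff x0 y0 \<Rightarrow> if x0 = e then (if y0 = 0 then 2 else 1) else 0 | Inf w \<Rightarrow> - 1)"
    using minus_eq_iff_0[of 1] by (auto simp: fiber_def lookup_add lookup_minus)
qed

lemma keys_fiber: "y0 ^ 2 = e ^ 6 + 1 \<Longrightarrow> Poly_Mapping.keys (fiber e y0) \<subseteq> curve_points C"
proof -
  assume "y0 ^ 2 = e ^ 6 + 1"
  hence "fiber e y0 \<in> carrier (free_Abelian_group (curve_points C))"
    unfolding fiber_def carrier_free_Abelian_group_iff
    by (intro order_trans[OF keys_diff] order_trans[OF keys_add] Un_least) (auto simp: curve_points_def)
  thus ?thesis by simp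
qed

lemma divisor_of_polynomial:
  fixes q :: "'k poly"
  assumes "q \<noteq> 0"
  shows "\<exists>E. Poly_Mapping.keys E \<subseteq> curve_points C \<and> divisor_degree E = 0 \<and>
    (\<forall>P x y. coordinates_at C P x y \<longrightarrow> Poly_Mapping.lookup E P = fls_subdegree (lift q x))"
  using assms
proof (induction "degree q" arbitrary: q rule: less_induct)
  case less
  show ?case
  proof (cases "degree q = 0")
    case True
    then obtain a where "q = [:a:]" by (rule degree_eq_zeroE)
    thus ?thesis by (intro exI[of _ 0]) simp
  next
    case False
    then obtain e where "poly q e = 0" using alg_closed_imp_poly_has_root[of q] by auto
    then obtain r where r: "q = [:- e, 1:] * r" using poly_roots_split by blast
    have r0: "r \<noteq> 0" using less.prems unfolding r by (rule contrapos_nn) simp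
    have "degree q = 1 + degree r" unfolding r using r0 by (subst degree_mult_eq) auto
    hence "degree r < degree q" by simp
    from less.hyps[OF this r0] obtain E where
        E: "Poly_Mapping.keys E \<subseteq> curve_points C" "divisor_degree E = 0"
        "\<And>P x y. coordinates_at C P x y \<Longrightarrow> Poly_Mapping.lookup E P = fls_subdegree (lift r x)"
      by blast
    obtain y0 where y0: "y0 ^ 2 = e ^ 6 + 1" using square_root_exists by blast
    have "Poly_Mapping.lookup (fiber e y0 + E) P = fls_subdegree (lift q x)"
      if P: "coordinates_at C P x y" for P x y
    proof -
      have "lift r x \<noteq> 0" using coordinate_transcendental[OF P degree_C_sextic] r0 by blast
      moreover have "lift q x = (x - cc e) * lift r x" unfolding r lift_mult by simp
      ultimately show ?thesis
        using order_x_minus(1)[OF P] by (simp add: lookup_add lookup_fiber[OF P y0] E(3)[OF P])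
    qed
    moreover have "Poly_Mapping.keys (fiber e y0 + E) \<subseteq> curve_points C"
      using keys_add[of "fiber e y0" E] keys_fiber[OF y0] E(1) by blast
    moreover have "divisor_degree (fiber e y0 + E) = 0" using E(2) by (simp add: fiber_def)
    ultimately show ?thesis by blast
  qed
qed

lemma hyper_points: "hyper P \<in> curve_points C \<longleftrightarrow> P \<in> curve_points C"
  by (cases P) (auto simp: curve_points_def)

lemma lookup_push_hyper: "Poly_Mapping.lookup (push_divisor hyper D) P = Poly_Mapping.lookup D (hyper P)"
proof -
  have "inj hyper" by (metis hyper_hyper injI)
  thus ?thesis using lookup_push_divisor_inj[of hyper UNIV D "hyper P"] by simp
qed

text \<open>
  Modulo the equation of the curve, \<open>g\<close> is \<open>A + B y\<close>, and its norm \<open>A\<^sup>2 - f B\<^sup>2\<close> is a polynomial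
  in \<open>x\<close>.
\<close>

lemma norm_of_function:
  assumes "\<not> C.W dvd g"
  obtains A B where "A ^ 2 - C * B ^ 2 \<noteq> 0"
    and "\<And>P x y. coordinates_at C P x y \<Longrightarrow> ev g x y = lift A x + y * lift B x"
    and "\<And>P x y. coordinates_at C P x y \<Longrightarrow> lift (A ^ 2 - C * B ^ 2) x = ev g x y * ev g x (- y)"
proof -
  obtain A B q where g: "g = q * C.W + [:A, B:]" using reduce_mod_curve by blast
  have e: "ev g x y = lift A x + y * lift B x" if "coordinates_at C P x y" for P x y
    using coordinates_equation[OF that] by (simp add: g)
  have "A ^ 2 - C * B ^ 2 \<noteq> 0"
  proof
    assume "A ^ 2 - C * B ^ 2 = 0"
    hence "A = 0 \<and> B = 0" using C.norm_nonzero[of A B] by simp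
    thus False using assms by (simp add: g)
  qed
  moreover have "lift (A ^ 2 - C * B ^ 2) x = ev g x y * ev g x (- y)" if "coordinates_at C P x y" for P x y
  proof -
    have "ev g x y * ev g x (- y) = lift A x ^ 2 - y ^ 2 * lift B x ^ 2"
      unfolding e[OF that] e[OF coordinates_hyper[OF that]] by (simp add: power2_eq_square algebra_simps)
    thus ?thesis by (simp add: coordinates_equation[OF that])
  qed
  ultimately show ?thesis using that e by blast
qed

text \<open>
  Adding the image of \<open>D\<close> under the hyperelliptic involution replaces \<open>g / h\<close> by the quotient of
  the norms, a rational function of \<open>x\<close>. Its divisor is a combination of divisors of linear
  polynomials, which have degree 0, and the involution preserves the degree.
\<close>

lemma principal_degree:
  assumes "D \<in> Prin"
  shows "divisor_degree D = 0"
proof -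
  obtain g h where gh: "C.has_divisor g h D" and keys: "Poly_Mapping.keys D \<subseteq> curve_points C"
    using assms C.principal_divisors_iff by blast
  obtain A B where g: "A ^ 2 - C * B ^ 2 \<noteq> 0"
      "\<And>P x y. coordinates_at C P x y \<Longrightarrow> lift (A ^ 2 - C * B ^ 2) x = ev g x y * ev g x (- y)"
    using norm_of_function gh by (metis C.has_divisor_def)
  obtain A' B' where h: "A' ^ 2 - C * B' ^ 2 \<noteq> 0"
      "\<And>P x y. coordinates_at C P x y \<Longrightarrow> lift (A' ^ 2 - C * B' ^ 2) x = ev h x y * ev h x (- y)"
    using norm_of_function gh by (metis C.has_divisor_def)
  obtain E where E: "Poly_Mapping.keys E \<subseteq> curve_points C" "divisor_degree E = 0"
      "\<And>P x y. coordinates_at C P x y \<Longrightarrow>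
         Poly_Mapping.lookup E P = fls_subdegree (lift (A ^ 2 - C * B ^ 2) x)"
    using divisor_of_polynomial[OF g(1)] by blast
  obtain F where F: "Poly_Mapping.keys F \<subseteq> curve_points C" "divisor_degree F = 0"
      "\<And>P x y. coordinates_at C P x y \<Longrightarrow>
         Poly_Mapping.lookup F P = fls_subdegree (lift (A' ^ 2 - C * B' ^ 2) x)"
    using divisor_of_polynomial[OF h(1)] by blast
  \<comment> \<open>The sum and \<open>E - F\<close> are both the divisor of the quotient of the norms.\<close>
  have "D + push_divisor hyper D = E - F"
  proof (rule poly_mapping_eqI)
    fix P
    show "Poly_Mapping.lookup (D + push_divisor hyper D) P = Poly_Mapping.lookup (E - F) P"
    proof (cases "P \<in> curve_points C")
      case True
      then obtain x y where P: "coordinates_at C P x y" using C_coordinates_exist by blast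
      note P' = coordinates_hyper[OF P]
      have nz: "ev g x y \<noteq> 0" "ev g x (- y) \<noteq> 0" "ev h x y \<noteq> 0" "ev h x (- y) \<noteq> 0"
        using C.ev_eq_0_iff[OF P] C.ev_eq_0_iff[OF P'] gh by (auto simp: C.has_divisor_def)
      have "Poly_Mapping.lookup D P = fls_subdegree (ev g x y) - fls_subdegree (ev h x y)"
          "Poly_Mapping.lookup D (hyper P) = fls_subdegree (ev g x (- y)) - fls_subdegree (ev h x (- y))"
        using gh P P' by (auto simp: C.has_divisor_def)
      thus ?thesis
        using nz by (simp add: lookup_add lookup_minus lookup_push_hyper E(3)[OF P] F(3)[OF P] g(2)[OF P] h(2)[OF P]
            del: lift_diff lift_mult lift_power)
    next
      case False
      hence "P \<notin> Poly_Mapping.keys D" "hyper P \<notin> Poly_Mapping.keys D" "P \<notin> Poly_Mapping.keys E" "P \<notin> Poly_Mapping.keys F"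
        using keys E(1) F(1) hyper_points by blast+
      thus ?thesis by (simp add: lookup_add lookup_minus lookup_push_hyper in_keys_iff)
    qed
  qed
  from arg_cong[OF this, of divisor_degree] show ?thesis using E F by simp
qed

section \<open>Functions with poles only at infinity\<close>

lemma C_point_coordinates:
  assumes "y0 ^ 2 = x0 ^ 6 + 1"
  obtains x y where "coordinates_at C (Aff x0 y0) x y" "vge 1 (x - cc x0)" "vge 1 (y - cc y0)"
    "local_parameters C x0 y0 x y"
proof -
  have "Aff x0 y0 \<in> curve_points C" using assms by (simp add: curve_points_def)
  then obtain x y where xy: "coordinates_at C (Aff x0 y0) x y" using C_coordinates_exist by blast
  thus ?thesis
  proof (cases rule: C_coordinates_cases)
    case (Aff x1 y1)
    thus ?thesis using that[OF xy] by simp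
  qed simp
qed

lemma vge_subdegree: "vge (fls_subdegree z) z"
  by (simp add: vge_def)

lemma vge_times_iff:
  assumes "u \<noteq> 0"
  shows "vge (fls_subdegree u + n) (u * z) \<longleftrightarrow> vge n z"
  using assms by (cases "z = 0") (simp_all add: vge_iff)

text \<open>
  The affine coordinate ring is integrally closed. At a root \<open>e\<close> of the denominator, \<open>A + B y\<close>
  vanishes at both points above \<open>e\<close>, which gives \<open>A(e) = B(e) = 0\<close>; if they coincide, it
  vanishes doubly, and \<open>y\<close> only simply.
\<close>

lemma denominator_divides:
  fixes A B D :: "'k poly"
  assumes "D \<noteq> 0"
    and "\<And>x0 y0 x y. coordinates_at C (Aff x0 y0) x y \<Longrightarrow>
           vge (fls_subdegree (lift D x)) (lift A x + y * lift B x)"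
  shows "\<exists>A' B'. A = D * A' \<and> B = D * B'"
  using assms
proof (induction "degree D" arbitrary: D A B rule: less_induct)
  case less
  show ?case
  proof (cases "degree D = 0")
    case True
    then obtain a where a: "D = [:a:]" by (rule degree_eq_zeroE)
    hence "a \<noteq> 0" using less.prems(1) by auto
    hence "A = D * smult (inverse a) A" "B = D * smult (inverse a) B" by (simp_all add: a)
    thus ?thesis by blast
  next
    case False
    then obtain e where "poly D e = 0" using alg_closed_imp_poly_has_root[of D] by auto
    then obtain D1 where D1: "D = [:- e, 1:] * D1" using poly_roots_split by blast
    have D10: "D1 \<noteq> 0" using less.prems(1) unfolding D1 by (rule contrapos_nn) simp
    have deg: "degree D = 1 + degree D1" unfolding D1 using D10 by (subst degree_mult_eq) auto
    have lD: "lift D x = (x - cc e) * lift D1 x" for x unfolding D1 lift_mult by simp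
    obtain y0 where y0: "y0 ^ 2 = e ^ 6 + 1" using square_root_exists by blast
    have ord: "fls_subdegree (lift D x) = (if z = 0 then 2 else 1) + fls_subdegree (lift D1 x)"
        "0 \<le> fls_subdegree (lift D1 x)"
      if P: "coordinates_at C (Aff e z) x y" "vge 1 (x - cc e)" for x y z
    proof -
      have nz: "lift D1 x \<noteq> 0" using coordinate_transcendental[OF P(1) degree_C_sextic] D10 by blast
      thus "fls_subdegree (lift D x) = (if z = 0 then 2 else 1) + fls_subdegree (lift D1 x)"
        using order_x_minus[OF P(1), of e] unfolding lD by simp
      have "vge 0 (lift D1 x)" using P(2) by (intro vge_lift vge_1_approx)
      thus "0 \<le> fls_subdegree (lift D1 x)" using nz by (simp add: vge_iff)
    qed
    have zero: "poly A e + z * poly B e = 0" if z: "z ^ 2 = e ^ 6 + 1" for z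
    proof -
      obtain x y where P: "coordinates_at C (Aff e z) x y" "vge 1 (x - cc e)" "vge 1 (y - cc z)"
        using C_point_coordinates[OF z] by blast
      have "vge 1 (lift A x + y * lift B x)"
        using less.prems(2)[OF P(1)] by (rule vge_mono) (use ord[OF P(1,2)] in auto)
      moreover have "vge 1 (lift A x + y * lift B x - cc (poly A e + z * poly B e))"
        using P by (intro vge_1_add_approx vge_1_mult_approx lift_approx)
      ultimately show ?thesis using approx_zero by blast
    qed
    have "poly A e + y0 * poly B e = 0" "poly A e + (- y0) * poly B e = 0"
      using zero[of y0] zero[of "- y0"] y0 by simp_all
    hence "2 * poly A e = 0" "2 * (y0 * poly B e) = 0" by (simp_all add: algebra_simps)
    hence Ae: "poly A e = 0" and yB: "y0 * poly B e = 0" using two by auto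
    obtain A1 where A1: "A = [:- e, 1:] * A1" using poly_roots_split[OF Ae] by blast
    have lA: "lift A x = (x - cc e) * lift A1 x" for x unfolding A1 lift_mult by simp
    have "poly B e = 0"
    proof (cases "y0 = 0")
      case True
      obtain x y where P: "coordinates_at C (Aff e 0) x y" "vge 1 (x - cc e)" and loc: "local_parameters C e 0 x y"
        using C_point_coordinates[OF y0] True by metis
      have "vge 2 (lift A x + y * lift B x)"
        using less.prems(2)[OF P(1)] by (rule vge_mono) (use ord[OF P] in auto)
      moreover have "vge 2 (lift A x)"
        unfolding lA using loc P(2)
        by (intro vge_0_mult vge_lift vge_1_approx[of x e]) (auto simp: local_parameters_def)
      ultimately have "vge 2 (lift A x + y * lift B x - lift A x)" by (rule vge_diff)
      hence "vge (fls_subdegree y + 1) (y * lift B x)"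
        using loc by (simp add: local_parameters_def)
      hence "vge 1 (lift B x)"
        using loc vge_times_iff[of y 1] by (simp add: local_parameters_def)
      thus ?thesis using approx_zero[OF lift_approx[OF P(2)]] by blast
    qed (use yB in auto)
    then obtain B1 where B1: "B = [:- e, 1:] * B1" using poly_roots_split by blast
    have lB: "lift B x = (x - cc e) * lift B1 x" for x unfolding B1 lift_mult by simp
    have "vge (fls_subdegree (lift D1 x)) (lift A1 x + y * lift B1 x)"
      if P: "coordinates_at C (Aff x0 z) x y" for x0 z x y
    proof -
      have nz: "lift D1 x \<noteq> 0" using coordinate_transcendental[OF P degree_C_sextic] D10 by blast
      have "lift A x + y * lift B x = (x - cc e) * (lift A1 x + y * lift B1 x)"
        by (simp add: lA lB algebra_simps)
      moreover have "fls_subdegree (lift D x) = fls_subdegree (x - cc e) + fls_subdegree (lift D1 x)"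
        unfolding lD using nz order_x_minus(1)[OF P] by simp
      ultimately show ?thesis
        using less.prems(2)[OF P] vge_times_iff[OF order_x_minus(1)[OF P]] by simp
    qed
    then obtain A' B' where "A1 = D1 * A'" "B1 = D1 * B'"
      using less.hyps[of D1 A1 B1] deg D10 by auto
    hence "A = D * A'" "B = D * B'" by (simp_all only: A1 B1 D1 mult.assoc)
    thus ?thesis by blast
  qed
qed

text \<open>
  The Riemann-Roch space of twice the divisor at infinity consists of polynomials in \<open>x\<close>:
  without affine poles the function is \<open>A + B y\<close>, and \<open>y\<close> has a pole of order 3.
\<close>

lemma function_of_x:
  assumes "D \<in> Prin"
    and aff: "\<And>x0 y0. 0 \<le> Poly_Mapping.lookup D (Aff x0 y0)"
    and inf: "\<And>w. - 2 \<le> Poly_Mapping.lookup D (Inf w)"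
  obtains A where "A \<noteq> 0"
    "\<And>P x y. coordinates_at C P x y \<Longrightarrow> Poly_Mapping.lookup D P = fls_subdegree (lift A x)"
proof -
  obtain g h where gh: "C.has_divisor g h D"
    using assms(1) C.principal_divisors_iff by blast
  obtain A0 B0 where g: "A0 ^ 2 - C * B0 ^ 2 \<noteq> 0"
      "\<And>P x y. coordinates_at C P x y \<Longrightarrow> ev g x y = lift A0 x + y * lift B0 x"
    using norm_of_function gh by (metis C.has_divisor_def)
  obtain A1 B1 where h: "A1 ^ 2 - C * B1 ^ 2 \<noteq> 0"
      "\<And>P x y. coordinates_at C P x y \<Longrightarrow> ev h x y = lift A1 x + y * lift B1 x"
      "\<And>P x y. coordinates_at C P x y \<Longrightarrow> lift (A1 ^ 2 - C * B1 ^ 2) x = ev h x y * ev h x (- y)"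
    using norm_of_function gh by (metis C.has_divisor_def)
  define N where "N = A1 ^ 2 - C * B1 ^ 2"
  define A where "A = A0 * A1 - C * B0 * B1"
  define B where "B = B0 * A1 - A0 * B1"
  have e: "lift A x + y * lift B x = ev g x y * ev h x (- y)" if P: "coordinates_at C P x y" for P x y
  proof -
    have "ev g x y * ev h x (- y) = lift A0 x * lift A1 x - y ^ 2 * (lift B0 x * lift B1 x) + y * lift B x"
      unfolding g(2)[OF P] h(2)[OF coordinates_hyper[OF P]] B_def
      by (simp add: power2_eq_square algebra_simps)
    thus ?thesis by (simp add: A_def coordinates_equation[OF P] mult.assoc)
  qed
  have nz: "ev g x y \<noteq> 0" "ev h x y \<noteq> 0" "ev h x (- y) \<noteq> 0" if P: "coordinates_at C P x y" for P x y
    using C.ev_eq_0_iff[OF P] C.ev_eq_0_iff[OF coordinates_hyper[OF P]] gh by (auto simp: C.has_divisor_def)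
  have D: "Poly_Mapping.lookup D P = fls_subdegree (lift A x + y * lift B x) - fls_subdegree (lift N x)"
    if P: "coordinates_at C P x y" for P x y
  proof -
    have "Poly_Mapping.lookup D P = fls_subdegree (ev g x y) - fls_subdegree (ev h x y)"
      using gh P by (auto simp: C.has_divisor_def)
    thus ?thesis using nz[OF P] unfolding e[OF P] N_def h(3)[OF P] by simp
  qed
  have N0: "N \<noteq> 0" using h(1) by (simp add: N_def)
  have "\<exists>A' B'. A = N * A' \<and> B = N * B'"
  proof (rule denominator_divides[OF N0])
    fix x0 y0 x y assume P: "coordinates_at C (Aff x0 y0) x y"
    show "vge (fls_subdegree (lift N x)) (lift A x + y * lift B x)"
      using D[OF P] aff[of x0 y0] nz[OF P] e[OF P] by (simp add: vge_iff)
  qed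
  then obtain A' B' where AB: "A = N * A'" "B = N * B'" by blast
  have D': "lift A' x + y * lift B' x \<noteq> 0 \<and> Poly_Mapping.lookup D P = fls_subdegree (lift A' x + y * lift B' x)"
    if P: "coordinates_at C P x y" for P x y
  proof -
    have eq: "lift A x + y * lift B x = lift N x * (lift A' x + y * lift B' x)"
      by (simp add: AB algebra_simps)
    have "lift A x + y * lift B x \<noteq> 0" using nz[OF P] e[OF P] by simp
    hence "lift N x \<noteq> 0" "lift A' x + y * lift B' x \<noteq> 0" using eq by auto
    thus ?thesis using D[OF P] unfolding eq by simp
  qed
  have "B' = 0"
  proof (rule ccontr)
    assume B': "B' \<noteq> 0"
    have "Inf 1 \<in> curve_points C" by (simp add: curve_points_def)
    then obtain x y where P: "coordinates_at C (Inf 1) x y" using C_coordinates_exist by blast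
    have xy: "fls_subdegree x = - 1" "y \<noteq> 0" "fls_subdegree y = - 3"
      using P by (cases rule: C_coordinates_cases; simp)+
    have "vge (- 2) (lift A' x + y * lift B' x)" "vge (- 2) (lift A' x + (- y) * lift B' x)"
      using D'[OF P] D'[OF coordinates_hyper[OF P]] inf[of 1] inf[of "- 1"] by (auto simp: vge_iff)
    hence "vge (- 2) ((lift A' x + y * lift B' x) - (lift A' x + (- y) * lift B' x))" by (rule vge_diff)
    hence "vge (- 2) (2 * (y * lift B' x))" by (simp add: algebra_simps)
    moreover have "(2 :: 'k fls) \<noteq> 0" "fls_subdegree (2 :: 'k fls) = 0"
      using two fls_const_eq_0_iff[of "2::'k"] by (simp_all add: fls_const_numeral del: fls_const_eq_0_iff)
    ultimately have "vge (- 2) (y * lift B' x)" using vge_unit_mult by blast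
    moreover have "lift B' x \<noteq> 0" "fls_subdegree (lift B' x) = - int (degree B')"
      using order_lift_at_pole[of x B'] xy B' by auto
    ultimately show False using xy by (simp add: vge_iff)
  qed
  hence "\<And>P x y. coordinates_at C P x y \<Longrightarrow> Poly_Mapping.lookup D P = fls_subdegree (lift A' x)"
    using D' by simp
  moreover have "A' \<noteq> 0"
  proof -
    have "Inf 1 \<in> curve_points C" by (simp add: curve_points_def)
    then obtain x y where P: "coordinates_at C (Inf 1) x y" using C_coordinates_exist by blast
    show ?thesis using D'[OF P] \<open>B' = 0\<close> by auto
  qed
  ultimately show ?thesis using that by blast
qed

end

lemma cubic_minus_line_square:
  fixes l m u1 u2 u3 z :: "'a::comm_ring_1"
  assumes coeffs: "l ^ 2 = u1 + u2 + u3" "- (2 * l * m) = u1 * u2 + u1 * u3 + u2 * u3" "m ^ 2 = 1 + u1 * u2 * u3"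
  shows "(z - u1) * (z - u2) * (z - u3) = z ^ 3 + 1 - (l * z + m) ^ 2"
proof -
  have "(z - u1) * (z - u2) * (z - u3) =
      z ^ 3 - (u1 + u2 + u3) * z ^ 2 + (u1 * u2 + u1 * u3 + u2 * u3) * z - u1 * u2 * u3"
    by (simp add: power2_eq_square power3_eq_cube algebra_simps)
  also have "\<dots> = z ^ 3 - l ^ 2 * z ^ 2 - 2 * l * m * z - (m ^ 2 - 1)"
    unfolding coeffs(1)[symmetric] coeffs(2)[symmetric] coeffs(3) by simp
  finally show ?thesis by (simp add: power2_eq_square algebra_simps)
qed

context fermat_sextic
begin

section \<open>The elliptic quotient\<close>

definition on_E :: "'k \<Rightarrow> 'k \<Rightarrow> bool" where
  "on_E u v \<longleftrightarrow> v ^ 2 = u ^ 3 + 1"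

text \<open>
  The pullback to \<open>C\<close> of the divisor \<open>(u, v) - O\<close> on \<open>v\<^sup>2 = u\<^sup>3 + 1\<close> under \<open>(x, y) \<mapsto> (x\<^sup>2, y)\<close>,
  where \<open>O\<close> is the point at infinity. Both square roots of \<open>u\<close> give the same divisor.
\<close>

definition ediv :: "'k \<Rightarrow> 'k \<Rightarrow> 'k curve_point \<Rightarrow>\<^sub>0 int" where
  "ediv u v = (let s = (SOME s. s ^ 2 = u) in
     frag_of (Aff s v) + frag_of (Aff (- s) v) - frag_of (Inf 1) - frag_of (Inf (- 1)))"

lemma ediv_eq:
  assumes "s ^ 2 = u"
  shows "ediv u v = frag_of (Aff s v) + frag_of (Aff (- s) v) - frag_of (Inf 1) - frag_of (Inf (- 1))"
proof -
  define t where "t = (SOME s. s ^ 2 = u)"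
  have "t ^ 2 = u" unfolding t_def by (rule someI[of _ s]) (rule assms)
  hence "t = s \<or> t = - s" using assms by (metis power2_eq_iff)
  thus ?thesis by (auto simp: ediv_def Let_def simp flip: t_def)
qed

lemma lookup_ediv_Aff:
  "Poly_Mapping.lookup (ediv u v) (Aff x y) = (if x ^ 2 = u \<and> y = v then if x = 0 then 2 else 1 else 0)"
proof -
  obtain s where s: "s ^ 2 = u" using square_root_exists by blast
  have *: "x ^ 2 = u \<longleftrightarrow> x = s \<or> x = - s" unfolding s[symmetric] by (rule power2_eq_iff)
  have L: "Poly_Mapping.lookup (ediv u v) (Aff x y) =
      (if x = s \<and> y = v then 1 else 0) + (if x = - s \<and> y = v then 1 else 0)"
    unfolding ediv_eq[OF s] lookup_add lookup_minus lookup_frag_of by simp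
  consider "x = s" "s = 0" | "x = s" "x \<noteq> - s" "s \<noteq> 0" | "x \<noteq> s" "x = - s" "s \<noteq> 0" | "x \<noteq> s" "x \<noteq> - s"
    using minus_eq_iff_0[of s] by (metis neg_0_equal_iff_equal)
  thus ?thesis unfolding L * by cases simp_all
qed

lemma lookup_ediv_Inf:
  "Poly_Mapping.lookup (ediv u v) (Inf w) = (if w = 1 \<or> w = - 1 then - 1 else 0)"
proof -
  obtain s where s: "s ^ 2 = u" using square_root_exists by blast
  show ?thesis
    unfolding ediv_eq[OF s] using minus_eq_iff_0[of 1] by (auto simp: lookup_add lookup_minus)
qed

lemma on_E_square: "on_E u v \<Longrightarrow> s ^ 2 = u \<Longrightarrow> v ^ 2 = s ^ 6 + 1"
  by (auto simp: on_E_def simp flip: power_mult)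

lemma on_E_uminus [simp]: "on_E u (- v) \<longleftrightarrow> on_E u v"
  by (simp add: on_E_def)

lemma keys_ediv:
  assumes "on_E u v"
  shows "Poly_Mapping.keys (ediv u v) \<subseteq> curve_points C"
proof -
  obtain s where s: "s ^ 2 = u" using square_root_exists by blast
  have "ediv u v \<in> carrier (free_Abelian_group (curve_points C))"
    unfolding ediv_eq[OF s] carrier_free_Abelian_group_iff
    using on_E_square[OF assms s]
    by (intro order_trans[OF keys_diff] order_trans[OF keys_add] Un_least) (auto simp: curve_points_def)
  thus ?thesis by simp
qed

lemma ediv_conjugates:
  assumes "s ^ 2 = u"
  shows "ediv u v + ediv u (- v) = fiber s v + fiber (- s) v"
  unfolding ediv_eq[OF assms] fiber_def by (simp add: algebra_simps)

lemma lookup_ediv_conjugates: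
  assumes "on_E u v" "coordinates_at C P x y"
  shows "Poly_Mapping.lookup (ediv u v) P + Poly_Mapping.lookup (ediv u (- v)) P = fls_subdegree (x ^ 2 - cc u)"
    and "x ^ 2 - cc u \<noteq> 0"
proof -
  obtain s where s: "s ^ 2 = u" using square_root_exists by blast
  have v: "v ^ 2 = s ^ 6 + 1" "v ^ 2 = (- s) ^ 6 + 1" using on_E_square[OF assms(1) s] by simp_all
  have f: "x ^ 2 - cc u = (x - cc s) * (x - cc (- s))"
    by (simp add: power2_eq_square algebra_simps flip: s fls_const_mult_const)
  show "x ^ 2 - cc u \<noteq> 0" 
    unfolding f using order_x_minus(1)[OF assms(2), of s] order_x_minus(1)[OF assms(2), of "- s"]
    by (metis mult_eq_0_iff)
  have "Poly_Mapping.lookup (ediv u v) P + Poly_Mapping.lookup (ediv u (- v)) P =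
      Poly_Mapping.lookup (fiber s v) P + Poly_Mapping.lookup (fiber (- s) v) P"
    using arg_cong[OF ediv_conjugates[OF s, of v], of "\<lambda>D. Poly_Mapping.lookup D P"]
    by (simp only: lookup_add)
  also have "\<dots> = fls_subdegree (x ^ 2 - cc u)"
    unfolding lookup_fiber[OF assms(2) v(1)] lookup_fiber[OF assms(2) v(2)] f
    using order_x_minus(1)[OF assms(2), of s] order_x_minus(1)[OF assms(2), of "- s"]
    by (simp only: fls_subdegree_mult not_False_eq_True)
  finally show "Poly_Mapping.lookup (ediv u v) P + Poly_Mapping.lookup (ediv u (- v)) P =
      fls_subdegree (x ^ 2 - cc u)" .
qed

lemma ediv_conjugates_principal:
  assumes "on_E u v"
  shows "ediv u v + ediv u (- v) \<in> Prin"
proof -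
  have e: "ev [:[:- u, 0, 1:]:] x y = x ^ 2 - cc u" for x y :: "'k fls"
    by (simp add: power2_eq_square algebra_simps)
  have "degree [:[:- u, 0, 1:]:] < degree C.W" by (simp add: curve_equation_def)
  hence "\<not> C.W dvd [:[:- u, 0, 1:]:]" by (auto dest: dvd_imp_degree_le)
  hence "C.has_divisor [:[:- u, 0, 1:]:] 1 (ediv u v + ediv u (- v))"
    using C.not_dvd_1 unfolding C.has_divisor_def e
    by (auto simp: lookup_add lookup_ediv_conjugates[OF assms])
  moreover have "Poly_Mapping.keys (ediv u v + ediv u (- v)) \<subseteq> curve_points C"
    using keys_add[of "ediv u v" "ediv u (- v)"] keys_ediv[of u v] keys_ediv[of u "- v"] assms by auto
  ultimately show ?thesis unfolding C.principal_divisors_iff by blast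
qed

text \<open>
  The divisor is that of a function of \<open>x\<close>, hence invariant under the hyperelliptic involution.
  It contains a point above \<open>(u, v)\<close>, so it also contains the conjugate of that point, which
  only \<open>T\<close> can provide. At a ramification point all multiplicities are even instead, and \<open>ediv u
  v\<close> contributes 1.
\<close>

lemma ediv_plus_principal:
  assumes D: "ediv u v + T \<in> Prin" and E: "on_E u v"
    and aff: "\<And>x0 y0. 0 \<le> Poly_Mapping.lookup T (Aff x0 y0)"
    and inf: "\<And>w. - 1 \<le> Poly_Mapping.lookup T (Inf w)"
  shows "\<exists>s. s ^ 2 = u \<and> 0 < Poly_Mapping.lookup T (Aff s (- v))"
proof -
  let ?D = "ediv u v + T"
  have "0 \<le> Poly_Mapping.lookup ?D (Aff x0 y0)" for x0 y0
    using aff[of x0 y0] by (simp add: lookup_add lookup_ediv_Aff)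
  moreover have "- 2 \<le> Poly_Mapping.lookup ?D (Inf w)" for w
    using inf[of w] by (simp add: lookup_add lookup_ediv_Inf)
  ultimately obtain A where A: "A \<noteq> 0"
    "\<And>P x y. coordinates_at C P x y \<Longrightarrow> Poly_Mapping.lookup ?D P = fls_subdegree (lift A x)"
    using function_of_x[OF D] by metis
  obtain s where s: "s ^ 2 = u" using square_root_exists by blast
  obtain x y where P: "coordinates_at C (Aff s v) x y" "vge 1 (x - cc s)"
    using C_point_coordinates[OF on_E_square[OF E s]] by blast
  have P': "coordinates_at C (Aff s (- v)) x (- y)" using coordinates_hyper[OF P(1)] by simp
  have pos: "1 \<le> Poly_Mapping.lookup (ediv u v) (Aff s v)" by (simp add: lookup_ediv_Aff s)
  have v1: "1 \<le> fls_subdegree (lift A x)"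
    using A(2)[OF P(1)] pos aff[of s v] by (simp add: lookup_add)
  have "0 < Poly_Mapping.lookup T (Aff s (- v))"
  proof (cases "v = 0")
    case False
    hence "Poly_Mapping.lookup (ediv u v) (Aff s (- v)) = 0"
      using minus_eq_iff_0[of v] by (auto simp: lookup_ediv_Aff)
    thus ?thesis using A(2)[OF P'] v1 by (simp add: lookup_add)
  next
    case True
    have nz: "lift A x \<noteq> 0" using coordinate_transcendental[OF P(1) degree_C_sextic] A(1) by blast
    hence "vge 1 (lift A x)" using v1 by (simp add: vge_iff)
    hence "poly A s = 0" using approx_zero[OF lift_approx[OF P(2)]] by blast
    then obtain A1 where A1: "A = [:- s, 1:] * A1" using poly_roots_split by blast
    have eq: "lift A x = (x - cc s) * lift A1 x" unfolding A1 lift_mult by simp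
    hence "lift A1 x \<noteq> 0" using nz by auto
    moreover have "vge 0 (lift A1 x)" using P(2) by (intro vge_lift vge_1_approx)
    ultimately have "2 \<le> fls_subdegree (lift A x)"
      unfolding eq using order_x_minus[OF P(1), of s] True by (simp add: vge_iff)
    moreover have "s \<noteq> 0" using on_E_square[OF E s] True by auto
    hence "Poly_Mapping.lookup (ediv u v) (Aff s v) = 1" by (simp add: lookup_ediv_Aff s)
    ultimately have "0 < Poly_Mapping.lookup T (Aff s v)" using A(2)[OF P(1)] by (simp add: lookup_add)
    thus ?thesis using True by simp
  qed
  thus ?thesis using s by blast
qed

lemma ediv_not_principal: "on_E u v \<Longrightarrow> ediv u v \<notin> Prin"
  using ediv_plus_principal[of u v 0] by auto

lemma ediv_inj:
  assumes "ediv u v - ediv u' v' \<in> Prin" "on_E u v" "on_E u' v'"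
  shows "u = u' \<and> v = v'"
proof -
  have "ediv u v - ediv u' v' + (ediv u' v' + ediv u' (- v')) \<in> Prin"
    using assms by (intro C.principal_add ediv_conjugates_principal)
  hence "ediv u v + ediv u' (- v') \<in> Prin" by simp
  hence "\<exists>s. s ^ 2 = u \<and> 0 < Poly_Mapping.lookup (ediv u' (- v')) (Aff s (- v))"
    using assms(2) by (rule ediv_plus_principal) (auto simp: lookup_ediv_Aff lookup_ediv_Inf)
  thus ?thesis by (auto simp: lookup_ediv_Aff split: if_splits)
qed

text \<open>
  The line \<open>v = l u + m\<close> pulls back to the zeros of \<open>y - l x\<^sup>2 - m\<close>. The product with \<open>y + l x\<^sup>2
  + m\<close> is the product of the \<open>x\<^sup>2 - u\<^sub>i\<close>, whose orders are known. At an affine point off the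
  ramification only one of the two factors can vanish, and at a ramification point on the line
  both have order 1.
\<close>

lemma line_divisor:
  assumes coeffs: "l ^ 2 = u1 + u2 + u3" "- (2 * l * m) = u1 * u2 + u1 * u3 + u2 * u3" "m ^ 2 = 1 + u1 * u2 * u3"
    and v: "v1 = l * u1 + m" "v2 = l * u2 + m" "v3 = l * u3 + m"
  shows "on_E u1 v1" "on_E u2 v2" "on_E u3 v3" "ediv u1 v1 + ediv u2 v2 + ediv u3 v3 \<in> Prin"
proof -
  note id = cubic_minus_line_square[OF coeffs]
  show E: "on_E u1 v1" "on_E u2 v2" "on_E u3 v3"
    using id[of u1] id[of u2] id[of u3] by (simp_all add: on_E_def v)
  have idx: "(x ^ 2 - cc u1) * (x ^ 2 - cc u2) * (x ^ 2 - cc u3) = x ^ 6 + 1 - (cc l * x ^ 2 + cc m) ^ 2"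
    for x
  proof -
    have c: "cc l ^ 2 = cc u1 + cc u2 + cc u3" "- (2 * cc l * cc m) = cc u1 * cc u2 + cc u1 * cc u3 + cc u2 * cc u3"
        "cc m ^ 2 = 1 + cc u1 * cc u2 * cc u3"
      using coeffs[THEN arg_cong[of _ _ cc]] by (simp_all add: fls_const_power flip: fls_plus_const fls_const_numeral)
    show ?thesis using cubic_minus_line_square[OF c, of "x ^ 2"] by (simp flip: power_mult)
  qed
  define T where "T = ediv u1 v1 + ediv u2 v2 + ediv u3 v3"
  define T' where "T' = ediv u1 (- v1) + ediv u2 (- v2) + ediv u3 (- v3)"
  define g where "g = [:[:- m, 0, - l:], 1:]"
  have g: "ev g x y = y - (cc l * x ^ 2 + cc m)" for x y
    by (simp add: g_def power2_eq_square algebra_simps)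
  have "degree g < degree C.W" by (simp add: curve_equation_def g_def)
  moreover have "g \<noteq> 0" by (simp add: g_def)
  ultimately have ndvd: "\<not> C.W dvd g" by (auto dest: dvd_imp_degree_le)
  have "Poly_Mapping.lookup T P = fls_subdegree (ev g x y)" if P: "coordinates_at C P x y" for P x y
  proof -
    let ?l = "cc l * x ^ 2 + cc m"
    have prod: "(y - ?l) * (y + ?l) = (x ^ 2 - cc u1) * (x ^ 2 - cc u2) * (x ^ 2 - cc u3)"
      unfolding idx using coordinates_equation[OF P] by (simp add: power2_eq_square algebra_simps)
    hence nz: "y - ?l \<noteq> 0" "y + ?l \<noteq> 0"
      using lookup_ediv_conjugates(2)[OF _ P] E by auto
    have sum: "fls_subdegree (y - ?l) + fls_subdegree (y + ?l) =
        Poly_Mapping.lookup T P + Poly_Mapping.lookup T' P"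
    proof -
      have "fls_subdegree (y - ?l) + fls_subdegree (y + ?l) = fls_subdegree ((y - ?l) * (y + ?l))"
        using nz by simp
      also have "\<dots> = fls_subdegree (x ^ 2 - cc u1) + fls_subdegree (x ^ 2 - cc u2) + fls_subdegree (x ^ 2 - cc u3)"
        unfolding prod using lookup_ediv_conjugates(2)[OF _ P] E by simp
      finally show ?thesis
        using lookup_ediv_conjugates(1)[OF E(1) P] lookup_ediv_conjugates(1)[OF E(2) P]
          lookup_ediv_conjugates(1)[OF E(3) P]
        by (simp add: T_def T'_def lookup_add)
    qed
    show ?thesis
      unfolding g using P
    proof (cases rule: C_coordinates_cases)
      case (Aff x0 y0)
      let ?val = "l * x0 ^ 2 + m"
      have lapprox: "vge 1 (?l - cc ?val)"
        using lift_approx[OF Aff(4), of "[:m, 0, l:]"] by (simp add: power2_eq_square algebra_simps)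
      have zero: "Poly_Mapping.lookup T P = 0" if "y0 \<noteq> ?val"
        using that unfolding T_def lookup_add Aff(1) lookup_ediv_Aff v by auto
      have zero': "Poly_Mapping.lookup T' P = 0" if "y0 \<noteq> - ?val"
        using that unfolding T'_def lookup_add Aff(1) lookup_ediv_Aff v by auto
      consider "y0 \<noteq> ?val" | "y0 = ?val" "y0 \<noteq> 0" | "y0 = ?val" "y0 = 0" by blast
      thus "Poly_Mapping.lookup T P = fls_subdegree (y - ?l)"
      proof cases
        case 1
        have "vge 1 (y - ?l - cc (y0 - ?val))"
          using vge_diff[OF Aff(5) lapprox] by (simp add: algebra_simps flip: fls_minus_const)
        from approx_nonzero[OF this] show ?thesis using 1 zero by simp
      next
        case 2
        have "y0 + ?val \<noteq> 0" using 2 two by (metis mult_2 mult_eq_0_iff)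
        hence "fls_subdegree (y + ?l) = 0"
          using approx_nonzero[OF vge_1_add_approx[OF Aff(5) lapprox]] by simp
        moreover have "y0 \<noteq> - ?val" using 2 minus_eq_iff_0[of y0] by auto
        ultimately show ?thesis using sum zero' by simp
      next
        case 3
        have y: "y \<noteq> 0" "fls_subdegree y = 1" "vge 2 (x - cc x0)"
          using Aff(3) 3 by (auto simp: local_parameters_def)
        have "poly [:m, 0, l:] x0 = 0" using 3 by (simp add: power2_eq_square algebra_simps)
        then obtain k where k: "[:m, 0, l:] = [:- x0, 1:] * k" using poly_roots_split by blast
        have "lift [:m, 0, l:] x = (x - cc x0) * lift k x" unfolding k lift_mult by simp
        hence l2: "?l = (x - cc x0) * lift k x" by (simp add: power2_eq_square algebra_simps)
        have "vge 2 ?l" unfolding l2 using y Aff(4) by (intro vge_0_mult vge_lift) (auto intro: vge_1_approx)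
        hence *: "?l \<noteq> 0 \<Longrightarrow> 2 \<le> fls_subdegree ?l" by (simp add: vge_iff)
        have "fls_subdegree (y - ?l) = 1" "fls_subdegree (y + ?l) = 1"
          using * y by (cases "?l = 0"; simp add: fls_subdegree_diff_eq1 fls_subdegree_add_eq1)+
        moreover have "Poly_Mapping.lookup (ediv u (- (l * u + m))) P = Poly_Mapping.lookup (ediv u (l * u + m)) P" for u
        proof (cases "x0 ^ 2 = u")
          case True
          hence "l * u + m = 0" using 3 by simp
          thus ?thesis by simp
        next
          case False
          thus ?thesis by (simp add: Aff(1) lookup_ediv_Aff)
        qed
        hence "Poly_Mapping.lookup T' P = Poly_Mapping.lookup T P"
          by (simp only: T_def T'_def lookup_add v)
        ultimately show ?thesis using sum by simp
      qed
    next
      case (Inf w)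
      have "Poly_Mapping.lookup T P = - 3"
        using Inf by (simp add: T_def lookup_add lookup_ediv_Inf)
      moreover have "fls_subdegree (y - ?l) = - 3"
      proof (cases "?l = 0")
        case False
        have "vge 0 (cc m)" by simp
        hence "vge (- 2) (cc m)" by (rule vge_mono) simp
        moreover have "vge (- 2) (cc l * x ^ 2)"
          using vge_0_mult'[OF vge_const, of "- 2" "x ^ 2" l] vge_subdegree[of "x ^ 2"] Inf(4)
          by (simp add: fls_subdegree_pow)
        ultimately have "vge (- 2) ?l" by (intro vge_add)
        hence "- 2 \<le> fls_subdegree ?l" using False by (simp add: vge_iff)
        thus ?thesis using Inf by (subst fls_subdegree_diff_eq1) auto
      next
        case True
        thus ?thesis using Inf by simp
      qed
      ultimately show "Poly_Mapping.lookup T P = fls_subdegree (y - ?l)" by simp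
    qed
  qed
  hence "C.has_divisor g 1 T" using ndvd C.not_dvd_1 by (auto simp: C.has_divisor_def)
  moreover have "Poly_Mapping.keys T \<subseteq> curve_points C"
  proof -
    have "T \<in> carrier (free_Abelian_group (curve_points C))"
      unfolding T_def carrier_free_Abelian_group_iff
      using keys_ediv E by (intro order_trans[OF keys_add] Un_least) auto
    thus ?thesis by simp
  qed
  ultimately have "T \<in> Prin" unfolding C.principal_divisors_iff by blast
  thus "ediv u1 v1 + ediv u2 v2 + ediv u3 v3 \<in> Prin" by (simp add: T_def)
qed

end

section \<open>Addition on the elliptic quotient\<close>

lemmas expand_powers = algebra_simps power2_eq_square power3_eq_cube power4_eq_xxxx

lemma frag_cmul_diff2: "frag_cmul n (D - E) = frag_cmul n D - frag_cmul n E"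
  by (rule poly_mapping_eqI) (simp add: lookup_minus right_diff_distrib)

lemma push_divisor_cmul: "push_divisor s (frag_cmul n D) = frag_cmul n (push_divisor s D)"
  by (simp add: push_divisor_def frag_extend_cmul)

context fermat_sextic
begin

definition eqv :: "('k curve_point \<Rightarrow>\<^sub>0 int) \<Rightarrow> ('k curve_point \<Rightarrow>\<^sub>0 int) \<Rightarrow> bool" (infix \<open>\<sim>\<close> 50) where
  "D \<sim> E \<longleftrightarrow> D - E \<in> Prin"

lemma eqv_refl [simp]: "D \<sim> D"
  by (simp add: eqv_def C.principal_0)

lemma eqv_sym: "D \<sim> E \<Longrightarrow> E \<sim> D"
  using C.principal_uminus[of "D - E"] by (simp add: eqv_def)

lemma eqv_trans [trans]: "D \<sim> E \<Longrightarrow> E \<sim> F \<Longrightarrow> D \<sim> F"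
  using C.principal_add[of "D - E" "E - F"] by (simp add: eqv_def)

lemma eqv_add: "D \<sim> E \<Longrightarrow> D' \<sim> E' \<Longrightarrow> D + D' \<sim> E + E'"
  using C.principal_add[of "D - E" "D' - E'"] by (simp add: eqv_def algebra_simps)

lemma eqv_uminus: "D \<sim> E \<Longrightarrow> - D \<sim> - E"
  using C.principal_uminus[of "D - E"] by (simp add: eqv_def)

lemma eqv_diff: "D \<sim> E \<Longrightarrow> D' \<sim> E' \<Longrightarrow> D - D' \<sim> E - E'"
  using eqv_add[of D E "- D'" "- E'"] eqv_uminus[of D' E'] by simp

lemma principal_cmul: "D \<in> Prin \<Longrightarrow> frag_cmul n D \<in> Prin"
  by (rule frag_closure_minus_cmul) (auto intro: C.principal_0 C.principal_diff)

lemma eqv_cmul: "D \<sim> E \<Longrightarrow> frag_cmul n D \<sim> frag_cmul n E"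
  using principal_cmul[of "D - E" n] by (simp add: eqv_def frag_cmul_diff2)

lemma eqv_0_iff: "D \<sim> 0 \<longleftrightarrow> D \<in> Prin"
  by (simp add: eqv_def)

lemma ediv_uminus: "on_E u v \<Longrightarrow> - ediv u v \<sim> ediv u (- v)"
  using C.principal_uminus[OF ediv_conjugates_principal[of u v]] by (simp add: eqv_def)

text \<open>\<open>None\<close> is the neutral element, the point at infinity.\<close>

fun point_on_E :: "('k \<times> 'k) option \<Rightarrow> bool" where
  "point_on_E None \<longleftrightarrow> True"
| "point_on_E (Some (u, v)) \<longleftrightarrow> on_E u v"

fun point_divisor :: "('k \<times> 'k) option \<Rightarrow> 'k curve_point \<Rightarrow>\<^sub>0 int" where
  "point_divisor None = 0"
| "point_divisor (Some (u, v)) = ediv u v"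

lemma point_divisor_inj:
  assumes "point_divisor p \<sim> point_divisor q" "point_on_E p" "point_on_E q"
  shows "p = q"
proof (cases p; cases q)
  fix a b assume *: "p = Some a" "q = Some b"
  obtain u v u' v' where "a = (u, v)" "b = (u', v')" by fastforce
  thus ?thesis using assms ediv_inj[of u v u' v'] * by (auto simp: eqv_def)
next
  fix a assume *: "p = None" "q = Some a"
  obtain u v where "a = (u, v)" by fastforce
  thus ?thesis using assms(1,3) ediv_not_principal[of u v] eqv_sym[OF assms(1)] * by (auto simp: eqv_0_iff)
next
  fix a assume *: "p = Some a" "q = None"
  obtain u v where "a = (u, v)" by fastforce
  thus ?thesis using assms ediv_not_principal[of u v] * by (auto simp: eqv_0_iff)
qed simp

lemma third_point:
  assumes "ediv u1 v1 + ediv u2 v2 + ediv u3 w \<in> Prin" "on_E u3 w"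
  shows "ediv u1 v1 + ediv u2 v2 \<sim> ediv u3 (- w)"
  using C.principal_diff[OF assms(1) ediv_conjugates_principal[OF assms(2)]]
  by (simp add: eqv_def algebra_simps)

text \<open>
  The chord through the two points: its slope squared is the sum of the three abscissae.
\<close>

lemma add_distinct:
  assumes E: "on_E u1 v1" "on_E u2 v2" and ne: "u1 \<noteq> u2"
  defines "l \<equiv> (v2 - v1) / (u2 - u1)"
  shows "\<exists>v3. on_E (l ^ 2 - u1 - u2) v3 \<and> ediv u1 v1 + ediv u2 v2 \<sim> ediv (l ^ 2 - u1 - u2) v3"
proof -
  define u3 where "u3 = l ^ 2 - u1 - u2"
  define m where "m = v1 - l * u1"
  have v1: "v1 = l * u1 + m" by (simp add: m_def)
  have "l * (u2 - u1) = v2 - v1" using ne by (simp add: l_def)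
  hence v2: "v2 = l * u2 + m" by (simp add: m_def algebra_simps)
  have e1: "(l * u1 + m) ^ 2 = u1 ^ 3 + 1" and e2: "(l * u2 + m) ^ 2 = u2 ^ 3 + 1"
    using E v1 v2 by (simp_all add: on_E_def)
  have l2: "l ^ 2 = u1 + u2 + u3" by (simp add: u3_def)
  have "(u1 - u2) * (l ^ 2 * (u1 + u2) + 2 * l * m - (u1 ^ 2 + u1 * u2 + u2 ^ 2)) = 0"
  proof -
    have "(u1 - u2) * (l ^ 2 * (u1 + u2) + 2 * l * m - (u1 ^ 2 + u1 * u2 + u2 ^ 2)) =
        ((l * u1 + m) ^ 2 - (u1 ^ 3 + 1)) - ((l * u2 + m) ^ 2 - (u2 ^ 3 + 1))"
      by (simp add: expand_powers)
    thus ?thesis unfolding e1 e2 by simp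
  qed
  hence s2: "l ^ 2 * (u1 + u2) + 2 * l * m = u1 ^ 2 + u1 * u2 + u2 ^ 2" using ne by simp
  have c2: "- (2 * l * m) = u1 * u2 + u1 * u3 + u2 * u3"
  proof -
    have "- (2 * l * m) - (u1 * u2 + u1 * u3 + u2 * u3) =
        (u1 + u2) * (l ^ 2 - (u1 + u2 + u3))
        - (l ^ 2 * (u1 + u2) + 2 * l * m - (u1 ^ 2 + u1 * u2 + u2 ^ 2))"
      by (simp add: expand_powers)
    also have "\<dots> = 0" unfolding s2 unfolding l2 by simp
    finally show ?thesis by (simp only: right_minus_eq)
  qed
  have c3: "m ^ 2 = 1 + u1 * u2 * u3"
  proof -
    have "m ^ 2 - (1 + u1 * u2 * u3) = ((l * u1 + m) ^ 2 - (u1 ^ 3 + 1)) - u1 ^ 2 * (l ^ 2 - (u1 + u2 + u3))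
        + u1 * (- (2 * l * m) - (u1 * u2 + u1 * u3 + u2 * u3))"
      by (simp add: expand_powers)
    also have "\<dots> = 0" unfolding e1 unfolding c2 unfolding l2 by simp
    finally show ?thesis by (simp only: right_minus_eq)
  qed
  have E3: "on_E u3 (l * u3 + m)" and "ediv u1 v1 + ediv u2 v2 + ediv u3 (l * u3 + m) \<in> Prin"
    using line_divisor[OF l2 c2 c3 v1 v2 refl] by auto
  from third_point[OF this(2) E3] have "ediv u1 v1 + ediv u2 v2 \<sim> ediv u3 (- (l * u3 + m))" .
  moreover have "on_E u3 (- (l * u3 + m))" using E3 by (simp only: on_E_uminus)
  ultimately have "on_E u3 (- (l * u3 + m)) \<and> ediv u1 v1 + ediv u2 v2 \<sim> ediv u3 (- (l * u3 + m))" by blast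
  thus ?thesis unfolding u3_def by blast
qed

text \<open>The same for the tangent.\<close>

lemma add_double:
  assumes E: "on_E u v" and ne: "v \<noteq> 0"
  defines "l \<equiv> 3 * u ^ 2 / (2 * v)"
  shows "\<exists>v3. on_E (l ^ 2 - u - u) v3 \<and> ediv u v + ediv u v \<sim> ediv (l ^ 2 - u - u) v3"
proof -
  define u3 where "u3 = l ^ 2 - u - u"
  define m where "m = v - l * u"
  have v: "v = l * u + m" by (simp add: m_def)
  have lv: "2 * (l * v) = 3 * u ^ 2" using ne two by (simp add: l_def)
  have e: "v ^ 2 = u ^ 3 + 1" using E by (simp add: on_E_def)
  have l2: "l ^ 2 = u + u + u3" by (simp add: u3_def)
  have c2: "- (2 * l * m) = u * u + u * u3 + u * u3"
  proof -
    have "- (2 * l * m) - (u * u + u * u3 + u * u3) =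
        2 * u * (l ^ 2 - (u + u + u3)) - (2 * (l * v) - 3 * u ^ 2)"
      unfolding m_def by (simp add: expand_powers)
    also have "\<dots> = 0" unfolding lv unfolding l2 by simp
    finally show ?thesis by (simp only: right_minus_eq)
  qed
  have c3: "m ^ 2 = 1 + u * u * u3"
  proof -
    have "m ^ 2 - (1 + u * u * u3) =
        (v ^ 2 - (u ^ 3 + 1)) - u * (2 * (l * v) - 3 * u ^ 2) + u ^ 2 * (l ^ 2 - (u + u + u3))"
      unfolding m_def by (simp add: expand_powers)
    also have "\<dots> = 0" unfolding lv unfolding e unfolding l2 by simp
    finally show ?thesis by (simp only: right_minus_eq)
  qed
  have E3: "on_E u3 (l * u3 + m)" and "ediv u v + ediv u v + ediv u3 (l * u3 + m) \<in> Prin"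
    using line_divisor[OF l2 c2 c3 v v refl] by auto
  from third_point[OF this(2) E3] have "ediv u v + ediv u v \<sim> ediv u3 (- (l * u3 + m))" .
  moreover have "on_E u3 (- (l * u3 + m))" using E3 by (simp only: on_E_uminus)
  ultimately have "on_E u3 (- (l * u3 + m)) \<and> ediv u v + ediv u v \<sim> ediv u3 (- (l * u3 + m))" by blast
  thus ?thesis unfolding u3_def by blast
qed

lemma add_points_Some:
  assumes "on_E u1 v1" "on_E u2 v2"
  shows "\<exists>q. point_on_E q \<and> ediv u1 v1 + ediv u2 v2 \<sim> point_divisor q"
proof (cases "u1 = u2")
  case False
  thus ?thesis using add_distinct[OF assms] by (metis point_on_E.simps(2) point_divisor.simps(2))
next
  case True
  hence "v1 ^ 2 = v2 ^ 2" using assms by (simp add: on_E_def)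
  hence "v2 = - v1 \<or> v2 = v1 \<and> v1 \<noteq> 0" by (auto simp: power2_eq_iff)
  thus ?thesis
  proof
    assume "v2 = - v1"
    hence "ediv u1 v1 + ediv u2 v2 \<sim> point_divisor None"
      using ediv_conjugates_principal[OF assms(1)] True by (simp add: eqv_0_iff)
    thus ?thesis using point_on_E.simps(1) by blast
  next
    assume "v2 = v1 \<and> v1 \<noteq> 0"
    thus ?thesis using add_double[OF assms(1)] True
      by (metis point_on_E.simps(2) point_divisor.simps(2))
  qed
qed

lemma add_points:
  assumes "point_on_E p" "point_on_E q"
  shows "\<exists>s. point_on_E s \<and> point_divisor p + point_divisor q \<sim> point_divisor s"
proof (cases p)
  case None
  thus ?thesis using assms(2) by (intro exI[of _ q]) simp
next
  case p: (Some a)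
  show ?thesis
  proof (cases q)
    case None
    thus ?thesis using assms(1) by (intro exI[of _ p]) simp
  next
    case (Some b)
    thus ?thesis using assms p add_points_Some by (cases a; cases b) simp
  qed
qed

lemma uminus_point:
  assumes "point_on_E p"
  shows "\<exists>q. point_on_E q \<and> - point_divisor p \<sim> point_divisor q"
proof (cases p)
  case None
  thus ?thesis by (intro exI[of _ None]) simp
next
  case (Some a)
  obtain u v where a: "a = (u, v)" by fastforce
  thus ?thesis using assms Some ediv_uminus[of u v]
    by (intro exI[of _ "Some (u, - v)"]) simp
qed

section \<open>Division polynomials\<close>

text \<open>
  \<open>X / Z\<close> is the abscissa of \<open>p\<close>, stated so that it remains true when \<open>X\<close> and \<open>Z\<close> both vanish.
  The recursion for the multiples of a point can thus work with unreduced fractions.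
\<close>

definition has_abscissa :: "('k \<times> 'k) option \<Rightarrow> 'k \<Rightarrow> 'k \<Rightarrow> bool" where
  "has_abscissa p X Z \<longleftrightarrow> (case p of None \<Rightarrow> Z = 0 | Some (u, v) \<Rightarrow> X = Z * u)"

lemma has_abscissa_double:
  assumes p: "point_on_E p" and q: "point_on_E q" and eq: "point_divisor p + point_divisor p \<sim> point_divisor q"
    and X: "has_abscissa p X Z"
  shows "has_abscissa q (X ^ 4 - 8 * X * Z ^ 3) (4 * Z * (X ^ 3 + Z ^ 3))"
proof (cases p)
  case None
  hence "point_divisor None \<sim> point_divisor q" using eq by simp
  hence "q = None" using point_divisor_inj[of None q] q by simp
  thus ?thesis using X None by (simp add: has_abscissa_def)
next
  case (Some a)
  obtain u v where a: "a = (u, v)" by fastforce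
  have E: "on_E u v" and XZ: "X = Z * u" using p X Some a by (auto simp: has_abscissa_def)
  have e: "v ^ 2 = u ^ 3 + 1" using E by (simp add: on_E_def)
  show ?thesis
  proof (cases "v = 0")
    case True
    hence "ediv u v + ediv u v \<sim> 0" using ediv_conjugates_principal[OF E] by (simp add: eqv_0_iff)
    hence "point_divisor None \<sim> point_divisor q"
      using eqv_trans[OF eqv_sym eq] Some a by simp
    hence q: "q = None" using point_divisor_inj[of None q] q by simp
    have "Z * (X ^ 3 + Z ^ 3) = Z ^ 4 * (u ^ 3 + 1)"
      unfolding XZ by (simp add: expand_powers)
    thus ?thesis using e True q by (simp add: has_abscissa_def mult.assoc)
  next
    case False
    define l where "l = 3 * u ^ 2 / (2 * v)"
    obtain v3 where v3: "on_E (l ^ 2 - u - u) v3" "ediv u v + ediv u v \<sim> ediv (l ^ 2 - u - u) v3"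
      using add_double[OF E False] unfolding l_def by blast
    have "point_divisor (Some (l ^ 2 - u - u, v3)) \<sim> point_divisor q"
      using eqv_trans[OF eqv_sym[OF v3(2)], of "point_divisor q"] eq Some a by simp
    hence q: "q = Some (l ^ 2 - u - u, v3)"
      using point_divisor_inj[of "Some (l ^ 2 - u - u, v3)" q] q v3(1) by simp
    have lv: "2 * (l * v) = 3 * u ^ 2" using False two by (simp add: l_def)
    have "u ^ 4 - 8 * u - 4 * (u ^ 3 + 1) * (l ^ 2 - u - u) =
        4 * l ^ 2 * (v ^ 2 - (u ^ 3 + 1)) - (2 * (l * v) - 3 * u ^ 2) * (3 * u ^ 2 + 2 * (l * v))"
      by (simp add: expand_powers)
    also have "\<dots> = 0" unfolding lv unfolding e by simp
    finally have "u ^ 4 - 8 * u = 4 * (u ^ 3 + 1) * (l ^ 2 - u - u)" by (simp only: right_minus_eq)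
    moreover have "X ^ 4 - 8 * X * Z ^ 3 = Z ^ 4 * (u ^ 4 - 8 * u)"
      unfolding XZ by (simp add: expand_powers)
    moreover have "4 * Z * (X ^ 3 + Z ^ 3) = Z ^ 4 * (4 * (u ^ 3 + 1))"
      unfolding XZ by (simp add: expand_powers)
    ultimately have "X ^ 4 - 8 * X * Z ^ 3 = 4 * Z * (X ^ 3 + Z ^ 3) * (l ^ 2 - u - u)"
      by (simp only: mult.assoc)
    thus ?thesis by (simp add: has_abscissa_def q)
  qed
qed

text \<open>
  The abscissae of the sum and of the difference of two points have a product that is rational
  in the two abscissae.
\<close>

lemma abscissa_product:
  assumes "on_E u1 v1" "on_E u2 v2" "u1 \<noteq> u2"
  shows "(((v2 - v1) / (u2 - u1)) ^ 2 - u1 - u2) * (((v2 + v1) / (u2 - u1)) ^ 2 - u1 - u2) * (u1 - u2) ^ 2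
           = (u1 * u2) ^ 2 - 4 * (u1 + u2)"
proof -
  define s where "s = (v2 - v1) / (u2 - u1)"
  define t where "t = (v2 + v1) / (u2 - u1)"
  have st: "s * (u2 - u1) = v2 - v1" "t * (u2 - u1) = v2 + v1" using assms(3) by (simp_all add: s_def t_def)
  have e: "v1 ^ 2 = u1 ^ 3 + 1" "v2 ^ 2 = u2 ^ 3 + 1" using assms by (simp_all add: on_E_def)
  have 1: "(s * (u2 - u1)) ^ 2 + (t * (u2 - u1)) ^ 2 = 2 * (u1 ^ 3 + u2 ^ 3 + 2)"
  proof -
    have "(v2 - v1) ^ 2 + (v2 + v1) ^ 2 = 2 * (v1 ^ 2 + v2 ^ 2)" by (simp add: expand_powers)
    thus ?thesis unfolding st e by simp
  qed
  have 2: "(s * (u2 - u1)) * (t * (u2 - u1)) = u2 ^ 3 - u1 ^ 3"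
  proof -
    have "(v2 - v1) * (v2 + v1) = v2 ^ 2 - v1 ^ 2" by (simp add: expand_powers)
    thus ?thesis unfolding st e by simp
  qed
  have "(u2 - u1) ^ 2 * ((s ^ 2 - u1 - u2) * (t ^ 2 - u1 - u2) * (u1 - u2) ^ 2) =
      (u2 - u1) ^ 2 * ((u1 * u2) ^ 2 - 4 * (u1 + u2))"
  proof -
    have "(u2 - u1) ^ 2 * ((s ^ 2 - u1 - u2) * (t ^ 2 - u1 - u2) * (u1 - u2) ^ 2) =
        ((s * (u2 - u1)) * (t * (u2 - u1))) ^ 2
        - (u1 + u2) * (u2 - u1) ^ 2 * ((s * (u2 - u1)) ^ 2 + (t * (u2 - u1)) ^ 2)
        + (u1 + u2) ^ 2 * (u2 - u1) ^ 4"
      by (simp add: expand_powers)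
    also have "\<dots> = (u2 ^ 3 - u1 ^ 3) ^ 2 - (u1 + u2) * (u2 - u1) ^ 2 * (2 * (u1 ^ 3 + u2 ^ 3 + 2))
        + (u1 + u2) ^ 2 * (u2 - u1) ^ 4"
      by (simp only: 1 2)
    also have "\<dots> = (u2 - u1) ^ 2 * ((u1 * u2) ^ 2 - 4 * (u1 + u2))"
      by (simp add: expand_powers)
    finally show ?thesis .
  qed
  thus ?thesis using assms(3) by (simp add: s_def t_def)
qed

text \<open>
  Here \<open>q - p\<close> is the point \<open>(u, v)\<close>, so the abscissa of the sum is found from that of the
  difference.
\<close>

lemma has_abscissa_add:
  assumes p: "point_on_E p" and q: "point_on_E q" and s: "point_on_E s" and E: "on_E u v"
    and diff: "point_divisor q \<sim> point_divisor p + ediv u v"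
    and sum: "point_divisor p + point_divisor q \<sim> point_divisor s"
    and X: "has_abscissa p X Z" and X': "has_abscissa q X' Z'"
  shows "has_abscissa s ((X * X') ^ 2 - 4 * Z * Z' * (X * Z' + X' * Z)) (u * (X * Z' - X' * Z) ^ 2)"
proof (cases p)
  case p0: None
  have "point_divisor q \<sim> point_divisor (Some (u, v))" using diff p0 by simp
  hence q0: "q = Some (u, v)" using point_divisor_inj[of q "Some (u, v)"] q E by simp
  hence "s = Some (u, v)" using point_divisor_inj[of q s] sum q s p0 by simp
  thus ?thesis using X X' p0 q0 by (simp add: has_abscissa_def power2_eq_square)
next
  case (Some a)
  obtain u1 v1 where p1: "p = Some (u1, v1)" using Some by (cases a) auto
  have E1: "on_E u1 v1" and X1: "X = Z * u1" using p X p1 by (auto simp: has_abscissa_def)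
  show ?thesis
  proof (cases q)
    case q0: None
    have "0 \<sim> ediv u1 v1 + ediv u v" using diff p1 q0 by simp
    from eqv_diff[OF eqv_sym[OF this] eqv_refl, of "ediv u v"] have "ediv u1 v1 \<sim> - ediv u v" by simp
    hence "ediv u1 v1 \<sim> ediv u (- v)" using ediv_uminus[OF E] eqv_trans by blast
    hence "u1 = u" using ediv_inj[of u1 v1 u "- v"] E1 E by (simp add: eqv_def)
    moreover have "s = p" using point_divisor_inj[of p s] sum p s q0 by simp
    ultimately show ?thesis using X1 X' p1 q0 by (simp add: has_abscissa_def power2_eq_square)
  next
    case (Some b)
    obtain u2 v2 where q1: "q = Some (u2, v2)" using Some by (cases b) auto
    have E2: "on_E u2 v2" and X2: "X' = Z' * u2" using q X' q1 by (auto simp: has_abscissa_def)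
    show ?thesis
    proof (cases "u1 = u2")
      case True
      have "v1 \<noteq> v2"
      proof
        assume "v1 = v2"
        hence "ediv u1 v1 \<sim> ediv u1 v1 + ediv u v" using diff p1 q1 True by simp
        hence "- ediv u v \<in> Prin" by (simp add: eqv_def)
        hence "ediv u v \<in> Prin" using C.principal_uminus[of "- ediv u v"] by simp
        thus False using ediv_not_principal[OF E] by simp
      qed
      moreover have "v1 ^ 2 = v2 ^ 2" using E1 E2 True by (simp add: on_E_def)
      ultimately have "v2 = - v1" using power2_eq_iff by fastforce
      hence "point_divisor p + point_divisor q \<sim> 0"
        using ediv_conjugates_principal[OF E1] True p1 q1 by (simp add: eqv_0_iff)
      hence "point_divisor None \<sim> point_divisor s" using eqv_trans[OF eqv_sym sum] by simp
      hence "s = None" using point_divisor_inj[of None s] s by simp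
      thus ?thesis using X1 X2 True by (simp add: has_abscissa_def)
    next
      case False
      define us where "us = ((v2 - v1) / (u2 - u1)) ^ 2 - u1 - u2"
      define ud where "ud = ((v2 + v1) / (u2 - u1)) ^ 2 - u1 - u2"
      obtain vs where vs: "on_E us vs" "ediv u1 v1 + ediv u2 v2 \<sim> ediv us vs"
        using add_distinct[OF E1 E2 False] unfolding us_def by blast
      have "point_divisor (Some (us, vs)) \<sim> point_divisor s"
        using eqv_trans[OF eqv_sym[OF vs(2)], of "point_divisor s"] sum p1 q1 by simp
      hence s1: "s = Some (us, vs)" using point_divisor_inj[of "Some (us, vs)" s] s vs(1) by simp
      obtain vd where vd: "on_E ud vd" "ediv u1 (- v1) + ediv u2 v2 \<sim> ediv ud vd"
        using add_distinct[of u1 "- v1" u2 v2] E1 E2 False unfolding ud_def by auto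
      have "ediv u1 (- v1) + ediv u2 v2 \<sim> - ediv u1 v1 + (ediv u1 v1 + ediv u v)"
        using diff p1 q1 eqv_sym[OF ediv_uminus[OF E1]] by (intro eqv_add) auto
      hence "ediv u v \<sim> ediv ud vd" using eqv_trans[OF eqv_sym vd(2)] by simp
      hence u: "u = ud" using ediv_inj E vd(1) by (simp add: eqv_def)
      have prod: "us * ud * (u1 - u2) ^ 2 = (u1 * u2) ^ 2 - 4 * (u1 + u2)"
        unfolding us_def ud_def by (rule abscissa_product[OF E1 E2 False])
      have "(X * X') ^ 2 - 4 * Z * Z' * (X * Z' + X' * Z) = u * (X * Z' - X' * Z) ^ 2 * us"
      proof -
        have "(X * X') ^ 2 - 4 * Z * Z' * (X * Z' + X' * Z) =
            (Z * Z') ^ 2 * ((u1 * u2) ^ 2 - 4 * (u1 + u2))"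
          unfolding X1 X2 by (simp add: expand_powers)
        also have "\<dots> = (Z * Z') ^ 2 * (us * ud * (u1 - u2) ^ 2)" by (simp only: prod)
        also have "\<dots> = u * (X * Z' - X' * Z) ^ 2 * us"
          unfolding X1 X2 u by (simp add: expand_powers)
        finally show ?thesis .
      qed
      thus ?thesis by (simp add: has_abscissa_def s1)
    qed
  qed
qed

text \<open>
  Numerator and denominator of the abscissa of the \<open>n\<close>-th multiple of a point with abscissa \<open>u\<close>,
  from duplication and from the product formula for two consecutive multiples. These fractions
  are not reduced: the degree is up to \<open>2 n\<^sup>2 - 1\<close> instead of \<open>n\<^sup>2\<close>, which leaves the count of
  torsion points below \<open>2 r\<^sup>2\<close>.
\<close>

function div_polys :: "nat \<Rightarrow> 'k poly \<times> 'k poly" where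
  "div_polys n = (if n = 0 then (1, 0) else if n = 1 then ([:0, 1:], 1) else
     let (X, Z) = div_polys (n div 2) in
     if even n then (X ^ 4 - 8 * X * Z ^ 3, 4 * Z * (X ^ 3 + Z ^ 3))
     else let (X', Z') = div_polys (n div 2 + 1) in
       ((X * X') ^ 2 - 4 * Z * Z' * (X * Z' + X' * Z), [:0, 1:] * (X * Z' - X' * Z) ^ 2))"
  by auto
termination
proof (relation "Wellfounded.measure id", goal_cases)
  case (3 n x X Z)
  hence "odd n" "n \<noteq> 1" by auto
  hence "n \<ge> 3" by (cases n) (auto elim!: oddE)
  thus ?case by simp
qed auto

declare div_polys.simps [simp del]

fun div_degree :: "nat \<Rightarrow> nat" where
  "div_degree n = (if n = 0 then 0 else if n = 1 then 1 else
     if even n then 4 * div_degree (n div 2) else 2 * (div_degree (n div 2) + div_degree (n - n div 2)))"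

declare div_degree.simps [simp del]

lemma nat_double_cases:
  obtains (zero) "n = (0::nat)" | (one) "n = 1" | (even) m where "n = 2 * m" "0 < m" "m < n"
  | (odd) m where "n = 2 * m + 1" "0 < m" "m + 1 < n"
proof (cases "even n")
  case True
  then obtain m where "n = 2 * m" by (elim evenE)
  thus ?thesis using zero even[of m] by (cases "m = 0") auto
next
  case False
  then obtain m where "n = 2 * m + 1" by (elim oddE)
  thus ?thesis using one odd[of m] by (cases "m = 0") auto
qed

lemma div_degree_even: "0 < m \<Longrightarrow> div_degree (2 * m) = 4 * div_degree m"
  by (subst div_degree.simps) simp

lemma div_degree_odd: "0 < m \<Longrightarrow> div_degree (2 * m + 1) = 2 * (div_degree m + div_degree (m + 1))"
proof -
  have "2 * m + 1 - (2 * m + 1) div 2 = m + 1" by simp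
  thus "0 < m \<Longrightarrow> ?thesis" by (subst div_degree.simps) simp
qed

lemma div_polys_even:
  "0 < m \<Longrightarrow> div_polys m = (X, Z) \<Longrightarrow>
     div_polys (2 * m) = (X ^ 4 - 8 * X * Z ^ 3, 4 * Z * (X ^ 3 + Z ^ 3))"
  by (subst div_polys.simps) simp

lemma div_polys_odd:
  "0 < m \<Longrightarrow> div_polys m = (X, Z) \<Longrightarrow> div_polys (m + 1) = (X', Z') \<Longrightarrow>
     div_polys (2 * m + 1) =
       ((X * X') ^ 2 - 4 * Z * Z' * (X * Z' + X' * Z), [:0, 1:] * (X * Z' - X' * Z) ^ 2)"
  by (subst div_polys.simps) simp

lemma div_polys_abscissa:
  assumes E: "on_E u v"
  shows "div_polys n = (X, Z) \<Longrightarrow>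
    \<exists>p. point_on_E p \<and> frag_cmul (int n) (ediv u v) \<sim> point_divisor p \<and> has_abscissa p (poly X u) (poly Z u)"
proof (induction n arbitrary: X Z rule: less_induct)
  case (less n)
  show ?case
  proof (cases n rule: nat_double_cases)
    case zero
    hence "Z = 0" using less.prems by (simp add: div_polys.simps)
    thus ?thesis using zero by (intro exI[of _ None]) (simp add: has_abscissa_def)
  next
    case one
    hence "X = [:0, 1:]" "Z = 1" using less.prems by (simp_all add: div_polys.simps)
    thus ?thesis using one E by (intro exI[of _ "Some (u, v)"]) (simp add: has_abscissa_def)
  next
    case (even m)
    obtain X1 Z1 where 1: "div_polys m = (X1, Z1)" by fastforce
    obtain p where p: "point_on_E p" "frag_cmul (int m) (ediv u v) \<sim> point_divisor p"
        "has_abscissa p (poly X1 u) (poly Z1 u)"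
      using less.IH[OF even(3) 1] by blast
    obtain q where q: "point_on_E q" "point_divisor p + point_divisor p \<sim> point_divisor q"
      using add_points p(1) by blast
    have "frag_cmul (int n) (ediv u v) = frag_cmul (int m) (ediv u v) + frag_cmul (int m) (ediv u v)"
      using even(1) by (simp flip: frag_cmul_distrib)
    hence "frag_cmul (int n) (ediv u v) \<sim> point_divisor q"
      using eqv_trans[OF eqv_add[OF p(2) p(2)] q(2)] by simp
    moreover have "has_abscissa q (poly X u) (poly Z u)"
      using has_abscissa_double[OF p(1) q p(3)] div_polys_even[OF even(2) 1] less.prems even(1) by auto
    ultimately show ?thesis using q(1) by blast
  next
    case (odd m)
    obtain X1 Z1 X2 Z2 where 1: "div_polys m = (X1, Z1)" and 2: "div_polys (m + 1) = (X2, Z2)" by fastforce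
    have "m < n" using odd by simp
    then obtain p where p: "point_on_E p" "frag_cmul (int m) (ediv u v) \<sim> point_divisor p"
        "has_abscissa p (poly X1 u) (poly Z1 u)"
      using less.IH[OF _ 1] by blast
    obtain q where q: "point_on_E q" "frag_cmul (int (m + 1)) (ediv u v) \<sim> point_divisor q"
        "has_abscissa q (poly X2 u) (poly Z2 u)"
      using less.IH[OF odd(3) 2] by blast
    obtain s where s: "point_on_E s" "point_divisor p + point_divisor q \<sim> point_divisor s"
      using add_points p(1) q(1) by blast
    have "point_divisor q \<sim> frag_cmul (int m) (ediv u v) + ediv u v"
      using eqv_sym[OF q(2)] by (simp add: frag_cmul_distrib add.commute)
    hence diff: "point_divisor q \<sim> point_divisor p + ediv u v"
      using eqv_trans eqv_add[OF p(2) eqv_refl] by blast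
    have "int n = int m + int (m + 1)" using odd(1) by simp
    hence "frag_cmul (int n) (ediv u v) = frag_cmul (int m) (ediv u v) + frag_cmul (int (m + 1)) (ediv u v)"
      by (simp only: frag_cmul_distrib)
    hence "frag_cmul (int n) (ediv u v) \<sim> point_divisor s"
      using eqv_trans[OF eqv_add[OF p(2) q(2)] s(2)] by simp
    moreover have "has_abscissa s (poly X u) (poly Z u)"
      using has_abscissa_add[OF p(1) q(1) s(1) E diff s(2) p(3) q(3)]
        div_polys_odd[OF odd(2) 1 2] less.prems odd(1) by auto
    ultimately show ?thesis using s(1) by blast
  qed
qed

lemma opposite_points_abscissa:
  assumes "point_on_E p" "point_on_E q" "point_divisor p + point_divisor q \<sim> 0"
    and "has_abscissa p X Z" "has_abscissa q X' Z'"
  shows "X * Z' = X' * Z"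
proof (cases p)
  case None
  hence "point_divisor q \<sim> point_divisor None" using assms(3) by simp
  hence "q = None" using point_divisor_inj[of q None] assms(2) by simp
  thus ?thesis using None assms by (simp add: has_abscissa_def)
next
  case (Some a)
  obtain u v where p: "p = Some (u, v)" using Some by (cases a) auto
  have E: "on_E u v" using assms(1) p by simp
  have "point_divisor q \<sim> - ediv u v"
    using eqv_diff[OF assms(3) eqv_refl, of "ediv u v"] p by simp
  hence "point_divisor q \<sim> point_divisor (Some (u, - v))"
    using ediv_uminus[OF E] eqv_trans by simp
  hence "q = Some (u, - v)" using point_divisor_inj[of q "Some (u, - v)"] assms(2) E by simp
  thus ?thesis using p assms by (simp add: has_abscissa_def)
qed

end

text \<open>
  Here \<open>n\<close> is only an upper bound for the degree, and \<open>a\<close> may be 0.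
\<close>

definition leading :: "'a::comm_ring_1 poly \<Rightarrow> nat \<Rightarrow> 'a \<Rightarrow> bool" where
  "leading p n a \<longleftrightarrow> degree p \<le> n \<and> coeff p n = a"

lemma leading_mult: "leading p m a \<Longrightarrow> leading q n b \<Longrightarrow> leading (p * q) (m + n) (a * b)"
proof -
  assume *: "leading p m a" "leading q n b"
  have "coeff (p * q) (m + n) = (\<Sum>i\<le>m + n. coeff p i * coeff q (m + n - i))"
    by (rule coeff_mult)
  also have "\<dots> = (\<Sum>i\<in>{m}. coeff p i * coeff q (m + n - i))"
  proof (rule sum.mono_neutral_right)
    show "\<forall>i\<in>{..m + n} - {m}. coeff p i * coeff q (m + n - i) = 0"
    proof
      fix i assume "i \<in> {..m + n} - {m}"
      hence "i > m \<or> m + n - i > n" by auto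
      thus "coeff p i * coeff q (m + n - i) = 0"
        using * by (auto simp: leading_def coeff_eq_0)
    qed
  qed auto
  finally have "coeff (p * q) (m + n) = a * b" using * by (simp add: leading_def)
  moreover have "degree (p * q) \<le> m + n"
    using * degree_mult_le[of p q] by (simp add: leading_def)
  ultimately show ?thesis by (simp add: leading_def)
qed

lemma leading_add: "leading p n a \<Longrightarrow> leading q n b \<Longrightarrow> leading (p + q) n (a + b)"
  by (auto simp: leading_def intro: degree_add_le)

lemma leading_diff: "leading p n a \<Longrightarrow> leading q n b \<Longrightarrow> leading (p - q) n (a - b)"
  by (auto simp: leading_def intro: degree_diff_le)

lemma leading_numeral: "leading (numeral k) 0 (numeral k)"
  using coeff_pCons_0[of "numeral k :: 'a" 0]
  by (simp add: leading_def numeral_poly del: coeff_pCons_0)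

lemma leading_power: "leading p m a \<Longrightarrow> leading (p ^ k) (k * m) (a ^ k)"
proof (induction k)
  case 0
  show ?case by (simp add: leading_def)
next
  case (Suc k)
  thus ?case using leading_mult[of p m a "p ^ k" "k * m" "a ^ k"] by simp
qed

lemma leading_pCons_0: "leading (pCons 0 p) n a \<Longrightarrow> leading p n 0"
proof -
  assume *: "leading (pCons 0 p) n a"
  show ?thesis
  proof (cases "p = 0")
    case False
    hence "degree p < n" using * by (simp add: leading_def)
    thus ?thesis by (simp add: leading_def coeff_eq_0)
  qed (simp add: leading_def)
qed

context fermat_sextic
begin

text \<open>
  Near the point at infinity multiplication by \<open>n\<close> divides the abscissa by \<open>n\<^sup>2\<close>. The factor \<open>u\<close>
  avoids a truncated exponent for \<open>n = 0\<close>, where the denominator is 0.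
\<close>

lemma div_polys_leading:
  "div_polys n = (X, Z) \<Longrightarrow>
     leading X (div_degree n) 1 \<and> leading ([:0, 1:] * Z) (div_degree n) (of_nat n ^ 2)"
proof (induction n arbitrary: X Z rule: less_induct)
  case (less n)
  show ?case
  proof (cases n rule: nat_double_cases)
    case zero
    thus ?thesis using less.prems by (auto simp: div_polys.simps div_degree.simps leading_def)
  next
    case one
    thus ?thesis using less.prems by (auto simp: div_polys.simps div_degree.simps leading_def)
  next
    case (even m)
    obtain X1 Z1 where 1: "div_polys m = (X1, Z1)" by fastforce
    let ?e = "div_degree m"
    have n: "div_degree n = 4 * ?e" using even by (simp add: div_degree_even)
    have l: "leading X1 ?e 1" "leading ([:0, 1:] * Z1) ?e (of_nat m ^ 2)"
      using less.IH[OF even(3) 1] by auto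
    have z: "leading Z1 ?e 0" using leading_pCons_0[of Z1] l(2) by simp
    have XZ: "X = X1 ^ 4 - 8 * X1 * Z1 ^ 3" "Z = 4 * Z1 * (X1 ^ 3 + Z1 ^ 3)"
      using div_polys_even[OF even(2) 1] less.prems even(1) by auto
    have "leading (X1 ^ 4 - (8 * X1) * Z1 ^ 3) (4 * ?e) (1 ^ 4 - (8 * 1) * 0 ^ 3)"
    proof (rule leading_diff)
      show "leading (X1 ^ 4) (4 * ?e) (1 ^ 4)" using leading_power[OF l(1)] .
      have "leading ((8 * X1) * Z1 ^ 3) ((0 + ?e) + 3 * ?e) ((8 * 1) * 0 ^ 3)"
        by (intro leading_mult leading_power leading_numeral l z)
      thus "leading ((8 * X1) * Z1 ^ 3) (4 * ?e) ((8 * 1) * 0 ^ 3)" by simp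
    qed
    moreover have "leading (4 * ([:0, 1:] * Z1) * (X1 ^ 3 + Z1 ^ 3)) ((0 + ?e) + 3 * ?e)
        ((4 * of_nat m ^ 2) * (1 ^ 3 + 0 ^ 3))"
      by (intro leading_mult leading_add leading_power leading_numeral l z)
    moreover have "4 * ([:0, 1:] * Z1) * (X1 ^ 3 + Z1 ^ 3) = [:0, 1:] * Z"
      unfolding XZ by (simp only: mult_ac)
    moreover have "of_nat n ^ 2 = (4 :: 'k) * of_nat m ^ 2" using even(1) by (simp add: power_mult_distrib)
    ultimately show ?thesis unfolding n XZ(1) by simp
  next
    case (odd m)
    obtain X1 Z1 X2 Z2 where 1: "div_polys m = (X1, Z1)" and 2: "div_polys (m + 1) = (X2, Z2)" by fastforce
    let ?e = "div_degree m" and ?f = "div_degree (m + 1)"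
    have n: "div_degree n = 2 * (?e + ?f)" unfolding odd(1) by (rule div_degree_odd[OF odd(2)])
    have "m < n" using odd by simp
    hence l: "leading X1 ?e 1" "leading ([:0, 1:] * Z1) ?e (of_nat m ^ 2)" using less.IH[OF _ 1] by auto
    have k: "leading X2 ?f 1" "leading ([:0, 1:] * Z2) ?f (of_nat (m + 1) ^ 2)"
      using less.IH[OF odd(3) 2] by auto
    have z: "leading Z1 ?e 0" "leading Z2 ?f 0" using leading_pCons_0[of Z1] leading_pCons_0[of Z2] l(2) k(2) by simp_all
    have XZ: "X = (X1 * X2) ^ 2 - 4 * Z1 * Z2 * (X1 * Z2 + X2 * Z1)" "Z = [:0, 1:] * (X1 * Z2 - X2 * Z1) ^ 2"
      using div_polys_odd[OF odd(2) 1 2] less.prems odd(1) by auto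
    have a: "leading (X1 * Z2) (?e + ?f) (1 * 0)" "leading (X2 * Z1) (?e + ?f) (1 * 0)"
      using leading_mult[OF l(1) z(2)] leading_mult[OF k(1) z(1)] by (simp_all add: add.commute)
    have "leading ((X1 * X2) ^ 2 - 4 * Z1 * Z2 * (X1 * Z2 + X2 * Z1)) (2 * (?e + ?f))
        ((1 * 1) ^ 2 - 4 * 0 * 0 * (1 * 0 + 1 * 0))"
    proof (rule leading_diff)
      show "leading ((X1 * X2) ^ 2) (2 * (?e + ?f)) ((1 * 1) ^ 2)"
        by (intro leading_power leading_mult l k)
      have "leading (4 * Z1 * Z2 * (X1 * Z2 + X2 * Z1)) (((0 + ?e) + ?f) + (?e + ?f)) (4 * 0 * 0 * (1 * 0 + 1 * 0))"
        by (intro leading_mult leading_add leading_numeral z a)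
      thus "leading (4 * Z1 * Z2 * (X1 * Z2 + X2 * Z1)) (2 * (?e + ?f)) (4 * 0 * 0 * (1 * 0 + 1 * 0))"
        by (simp only: add_0 mult_2)
    qed
    moreover have "leading ([:0, 1:] * Z) (2 * (?e + ?f)) ((1 * of_nat (m + 1) ^ 2 - 1 * of_nat m ^ 2) ^ 2)"
    proof -
      have "leading (X1 * ([:0, 1:] * Z2) - X2 * ([:0, 1:] * Z1)) (?e + ?f)
          (1 * of_nat (m + 1) ^ 2 - 1 * of_nat m ^ 2)"
      proof (rule leading_diff)
        show "leading (X1 * ([:0, 1:] * Z2)) (?e + ?f) (1 * of_nat (m + 1) ^ 2)"
          by (intro leading_mult l k)
        have "leading (X2 * ([:0, 1:] * Z1)) (?f + ?e) (1 * of_nat m ^ 2)"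
          by (intro leading_mult l k)
        thus "leading (X2 * ([:0, 1:] * Z1)) (?e + ?f) (1 * of_nat m ^ 2)" by (simp add: add.commute)
      qed
      from leading_power[OF this, of 2] show ?thesis
        unfolding XZ by (simp only: power2_eq_square left_diff_distrib right_diff_distrib mult_ac)
    qed
    moreover have "(1 * of_nat (m + 1) ^ 2 - 1 * of_nat m ^ 2) ^ 2 = (of_nat n ^ 2 :: 'k)"
      using odd(1) by (simp add: power2_eq_square algebra_simps)
    ultimately show ?thesis unfolding n XZ(1) by simp
  qed
qed

lemma div_degree_bound: "0 < n \<Longrightarrow> div_degree n + 1 \<le> 2 * n ^ 2"
proof (induction n rule: less_induct)
  case (less n)
  show ?case
  proof (cases n rule: nat_double_cases)
    case zero
    thus ?thesis using less.prems by simp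
  next
    case one
    thus ?thesis by (simp add: div_degree.simps)
  next
    case (even m)
    have "div_degree n = 4 * div_degree m" using even by (simp add: div_degree_even)
    thus ?thesis using less.IH[OF even(3,2)] even(1) by (simp add: power2_eq_square)
  next
    case (odd m)
    have "div_degree n = 2 * (div_degree m + div_degree (m + 1))"
      unfolding odd(1) by (rule div_degree_odd[OF odd(2)])
    moreover have "div_degree m + 1 \<le> 2 * m ^ 2" "div_degree (m + 1) + 1 \<le> 2 * (m + 1) ^ 2"
      using less.IH[of m] less.IH[of "m + 1"] odd by auto
    ultimately show ?thesis using odd(1) by (simp add: power2_eq_square algebra_simps)
  qed
qed

lemma card_square_roots: "finite {v::'k. v ^ 2 = z}" "card {v::'k. v ^ 2 = z} \<le> 2"
proof -
  obtain w where w: "w ^ 2 = z" using square_root_exists by blast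
  have "{v. v ^ 2 = z} \<subseteq> {w, - w}" using w by (auto simp: power2_eq_iff)
  moreover have "card {w, - w} \<le> 2" by (simp add: card_insert_le_m1)
  ultimately show "finite {v::'k. v ^ 2 = z}" "card {v::'k. v ^ 2 = z} \<le> 2"
    using card_mono[of "{w, - w}" "{v. v ^ 2 = z}"] by (auto intro: finite_subset)
qed

text \<open>
  Let \<open>r = 2 m + 1\<close>. At an \<open>r\<close>-torsion point the \<open>m\<close>-th and the \<open>(m + 1)\<close>-st multiple are
  opposite, so their abscissae agree and \<open>X Z' - X' Z\<close> vanishes. After multiplication by \<open>u\<close> the
  leading coefficient is \<open>(m + 1)\<^sup>2 - m\<^sup>2 = r\<close>, so the polynomial is not zero.
\<close>

lemma torsion_points_bound:
  assumes "odd r" "1 < r" "of_nat r \<noteq> (0::'k)"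
  shows "finite {p. point_on_E p \<and> frag_cmul (int r) (point_divisor p) \<sim> 0}"
    and "card {p. point_on_E p \<and> frag_cmul (int r) (point_divisor p) \<sim> 0} < 2 * r ^ 2"
proof -
  obtain m where m: "r = 2 * m + 1" "0 < m" using assms(1,2) by (auto elim!: oddE)
  obtain X Z X' Z' where 1: "div_polys m = (X, Z)" and 2: "div_polys (m + 1) = (X', Z')" by fastforce
  define T where "T = X * Z' - X' * Z"
  let ?e = "div_degree m" and ?f = "div_degree (m + 1)"
  note l = div_polys_leading[OF 1] and k = div_polys_leading[OF 2]
  have "leading (X * ([:0, 1:] * Z') - X' * ([:0, 1:] * Z)) (?e + ?f)
      (1 * of_nat (m + 1) ^ 2 - 1 * of_nat m ^ 2)"
    using leading_diff[OF leading_mult[of X ?e 1] leading_mult[of X' ?f 1, of "[:0, 1:] * Z" ?e, unfolded add.commute[of ?f ?e]]]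
      l k by blast
  moreover have "X * ([:0, 1:] * Z') - X' * ([:0, 1:] * Z) = pCons 0 T"
    by (simp add: T_def algebra_simps)
  moreover have "1 * of_nat (m + 1) ^ 2 - 1 * of_nat m ^ 2 = (of_nat r :: 'k)"
    by (simp add: m(1) power2_eq_square algebra_simps)
  ultimately have T: "leading (pCons 0 T) (?e + ?f) (of_nat r)" by simp
  have T0: "T \<noteq> 0" using T assms(3) by (auto simp: leading_def)
  have "degree T + 1 \<le> ?e + ?f" using T T0 by (simp add: leading_def)
  moreover have "?e + 1 \<le> 2 * m ^ 2" "?f + 1 \<le> 2 * (m + 1) ^ 2"
    using div_degree_bound m by auto
  ultimately have deg: "degree T + 2 \<le> r ^ 2"
    by (simp add: m(1) power2_eq_square algebra_simps)
  define S where "S = (SIGMA u:{u. poly T u = 0}. {v. v ^ 2 = u ^ 3 + 1})"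
  have fin: "finite {u. poly T u = 0}" using T0 by (rule poly_roots_finite)
  have finS: "finite S" unfolding S_def using fin card_square_roots by auto
  have "card S = (\<Sum>u\<in>{u. poly T u = 0}. card {v. v ^ 2 = u ^ 3 + 1})"
    unfolding S_def using fin card_square_roots by (intro card_SigmaI) auto
  also have "\<dots> \<le> (\<Sum>u\<in>{u. poly T u = 0}. 2)" by (intro sum_mono card_square_roots)
  also have "\<dots> \<le> 2 * degree T" using card_poly_roots_bound[OF T0] by simp
  finally have cardS: "card S \<le> 2 * degree T" .
  have sub: "{p. point_on_E p \<and> frag_cmul (int r) (point_divisor p) \<sim> 0} \<subseteq> insert None (Some ` S)"
  proof
    fix p assume "p \<in> {p. point_on_E p \<and> frag_cmul (int r) (point_divisor p) \<sim> 0}"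
    hence p: "point_on_E p" "frag_cmul (int r) (point_divisor p) \<sim> 0" by auto
    show "p \<in> insert None (Some ` S)"
    proof (cases p)
      case (Some a)
      obtain u v where uv: "p = Some (u, v)" using Some by (cases a) auto
      have E: "on_E u v" using p uv by simp
      obtain q1 where q1: "point_on_E q1" "frag_cmul (int m) (ediv u v) \<sim> point_divisor q1"
          "has_abscissa q1 (poly X u) (poly Z u)" using div_polys_abscissa[OF E 1] by blast
      obtain q2 where q2: "point_on_E q2" "frag_cmul (int (m + 1)) (ediv u v) \<sim> point_divisor q2"
          "has_abscissa q2 (poly X' u) (poly Z' u)" using div_polys_abscissa[OF E 2] by blast
      have "int r = int m + int (m + 1)" using m(1) by simp
      hence "frag_cmul (int r) (ediv u v) = frag_cmul (int m) (ediv u v) + frag_cmul (int (m + 1)) (ediv u v)"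
        by (simp only: frag_cmul_distrib)
      hence "point_divisor q1 + point_divisor q2 \<sim> 0"
        using eqv_trans[OF eqv_sym[OF eqv_add[OF q1(2) q2(2)]]] p(2) uv by simp
      from opposite_points_abscissa[OF q1(1) q2(1) this q1(3) q2(3)]
      have "poly T u = 0" by (simp add: T_def)
      thus ?thesis using E uv by (simp add: S_def on_E_def)
    qed simp
  qed
  thus "finite {p. point_on_E p \<and> frag_cmul (int r) (point_divisor p) \<sim> 0}"
    using finS finite_subset by blast
  have "card {p. point_on_E p \<and> frag_cmul (int r) (point_divisor p) \<sim> 0} \<le> card (insert None (Some ` S))"
    using sub finS by (intro card_mono) auto
  also have "\<dots> \<le> 1 + card S"
    using card_insert_le_m1[of "1 + card S" "Some ` S" None] card_image_le[OF finS, of Some] by simp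
  also have "\<dots> < 2 * r ^ 2" using cardS deg by simp
  finally show "card {p. point_on_E p \<and> frag_cmul (int r) (point_divisor p) \<sim> 0} < 2 * r ^ 2" .
qed

end

section \<open>The endomorphisms acting on divisors\<close>

lemma rho_Aff [simp]: "rho_point z (Aff x y) = Aff (z * x) (y :: 'k::field)"
  and rho_Inf [simp]: "rho_point z (Inf w) = Inf (w / z ^ 3)"
  by (simp_all add: rho_point_def weighted_point_def)

lemma chi_Aff [simp]: "chi_point (Aff x y) = (if x = 0 then Inf y else Aff (1 / x) (y / x ^ 3 :: 'k::field))"
  and chi_Inf [simp]: "chi_point (Inf w) = Aff 0 w"
  by (simp_all add: chi_point_def weighted_point_def)

lemma chi_chi [simp]: "chi_point (chi_point P) = (P :: 'k::field curve_point)"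
  by (cases P) (auto simp: power_divide)

locale fermat_torsion = fermat_sextic ty for ty :: "'k::alg_closed_field itself" +
  fixes \<zeta> :: 'k and p r :: nat
  assumes zeta: "\<zeta> ^ 2 = \<zeta> - 1"
    and char: "CHAR('k) = p" and prime_p: "prime p" and p_mod: "p mod 6 = 5"
    and prime_r: "prime r" and r: "r \<noteq> 2" "r \<noteq> 3" "r \<noteq> p"
begin

lemma zeta_3: "\<zeta> ^ 3 = - 1"
proof -
  have "\<zeta> ^ 3 = \<zeta> * \<zeta> ^ 2" by (simp add: power3_eq_cube power2_eq_square)
  also have "\<dots> = \<zeta> * (\<zeta> - 1)" by (simp only: zeta)
  also have "\<dots> = \<zeta> ^ 2 - \<zeta>" by (simp add: power2_eq_square algebra_simps)
  finally show ?thesis by (simp add: zeta)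
qed

lemma zeta_6: "\<zeta> ^ 6 = 1"
proof -
  have "\<zeta> ^ 6 = (\<zeta> ^ 3) ^ 2" by (simp flip: power_mult)
  thus ?thesis by (simp add: zeta_3)
qed

lemma zeta_nonzero: "\<zeta> \<noteq> 0"
  using zeta_6 by auto

lemma zeta_p: "\<zeta> ^ p = \<zeta> ^ 5"
proof -
  have "p = 6 * (p div 6) + 5" using p_mod by (metis mult_div_mod_eq)
  hence "\<zeta> ^ p = (\<zeta> ^ 6) ^ (p div 6) * \<zeta> ^ 5" by (metis power_add power_mult)
  thus ?thesis by (simp add: zeta_6)
qed

lemma power_p_add: "((x::'k) + y) ^ p = x ^ p + y ^ p"
  by (rule freshmans_dream) (simp_all add: char prime_p)

lemma power_p_automorphism: "field_automorphism (\<lambda>x::'k. x ^ p)"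
  unfolding field_automorphism_def
proof (intro conjI allI)
  have p0: "p > 0" using prime_p prime_gt_0_nat by blast
  show "bij (\<lambda>x::'k. x ^ p)"
  proof (rule bijI)
    show "inj (\<lambda>x::'k. x ^ p)"
    proof (rule injI)
      fix x y :: 'k assume "x ^ p = y ^ p"
      hence "(x - y) ^ p = 0" using power_p_add[of "x - y" y] by simp
      thus "x = y" by simp
    qed
    show "surj (\<lambda>x::'k. x ^ p)"
      using nth_root_exists[OF p0] by (metis surjI)
  qed
qed (simp_all add: power_p_add power_mult_distrib)

lemma power_p_minus_1: "(- 1 :: 'k) ^ p = - 1"
proof -
  have "odd p" using p_mod by presburger
  thus ?thesis by simp
qed

abbreviation "rho \<equiv> push_divisor (rho_point \<zeta>)"
abbreviation "chi \<equiv> push_divisor (chi_point :: 'k curve_point \<Rightarrow> _)"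
abbreviation "frob \<equiv> push_divisor (frobenius_point p :: 'k curve_point \<Rightarrow> _)"
abbreviation "hyp \<equiv> push_divisor (hyper :: 'k curve_point \<Rightarrow> _)"

lemma rho_principal: "D \<in> Prin \<Longrightarrow> rho D \<in> Prin"
  unfolding rho_point_def
  by (rule moebius_push_principal[OF C.sextic_curve_axioms C.sextic_curve_axioms,
        where a' = "inverse \<zeta>" and b' = 0 and c' = 0 and d' = 1])
     (auto simp: zeta_nonzero moebius_transports_def power_mult_distrib zeta_6 fls_const_power[symmetric] power_inverse)

lemma chi_principal: "D \<in> Prin \<Longrightarrow> chi D \<in> Prin"
  unfolding chi_point_def
  by (rule moebius_push_principal[OF C.sextic_curve_axioms C.sextic_curve_axioms,
        where a' = 0 and b' = 1 and c' = 1 and d' = 0])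
     (auto simp: moebius_transports_def power_divide distrib_right)

lemma aut_C_sextic:
  assumes "field_automorphism \<sigma>"
  shows "map_poly \<sigma> C = C"
  by (intro poly_eqI)
     (auto simp: coeff_map_poly aut_0[OF assms] aut_1[OF assms] C_sextic_monom one_pCons coeff_pCons split: nat.splits)

lemma frob_principal_iff: "frob D \<in> Prin \<longleftrightarrow> D \<in> Prin"
proof
  let ?t = "inv_into UNIV (\<lambda>x::'k. x ^ p)"
  note inv = field_automorphism_inv[OF power_p_automorphism]
  assume "frob D \<in> Prin"
  from aut_push_principal[OF inv aut_C_sextic[OF inv] this]
  have "push_divisor (map_curve_point ?t \<circ> frobenius_point p) D \<in> Prin"
    by (simp add: push_divisor_push_divisor)
  moreover have "(map_curve_point ?t \<circ> frobenius_point p) P = P" for P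
  proof -
    have "?t (x ^ p) = x" for x
    proof -
      have "inj (\<lambda>x::'k. x ^ p)"
        using power_p_automorphism by (simp add: field_automorphism_def bij_is_inj)
      from inv_into_f_f[OF this UNIV_I, of x] show ?thesis .
    qed
    thus ?thesis by (cases P) (simp_all add: frobenius_point_def)
  qed
  ultimately show "D \<in> Prin" by (simp add: push_divisor_id)
next
  assume "D \<in> Prin"
  thus "frob D \<in> Prin"
    unfolding frobenius_point_def
    by (rule aut_push_principal[OF power_p_automorphism aut_C_sextic[OF power_p_automorphism]])
qed

lemma rho_eqv: "D \<sim> E \<Longrightarrow> rho D \<sim> rho E"
  using rho_principal[of "D - E"] by (simp add: eqv_def)

lemma chi_eqv: "D \<sim> E \<Longrightarrow> chi D \<sim> chi E"
  using chi_principal[of "D - E"] by (simp add: eqv_def)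

lemma frob_eqv: "D \<sim> E \<Longrightarrow> frob D \<sim> frob E"
  using frob_principal_iff[of "D - E"] by (simp add: eqv_def)

lemma rho_ediv: "rho (ediv u v) = ediv (\<zeta> ^ 2 * u) v"
proof -
  obtain s where s: "s ^ 2 = u" using square_root_exists by blast
  have "(\<zeta> * s) ^ 2 = \<zeta> ^ 2 * u" by (simp add: power_mult_distrib s)
  thus ?thesis by (simp add: ediv_eq[OF s] ediv_eq zeta_3)
qed

lemma frob_ediv: "frob (ediv u v) = ediv (u ^ p) (v ^ p)"
proof -
  obtain s where s: "s ^ 2 = u" using square_root_exists by blast
  have "(s ^ p) ^ 2 = u ^ p" by (simp add: s[symmetric] power_mult[symmetric] mult.commute)
  moreover have "(- s) ^ p = - (s ^ p)" using power_p_minus_1 by (metis mult_minus1 power_mult_distrib)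
  ultimately show ?thesis
    by (simp add: ediv_eq[OF s] ediv_eq frobenius_point_def power_p_minus_1)
qed

lemma on_E_rho: "on_E u v \<Longrightarrow> on_E (\<zeta> ^ 2 * u) v"
  by (simp add: on_E_def power_mult_distrib zeta_6 flip: power_mult)

lemma on_E_frob: "on_E u v \<Longrightarrow> on_E (u ^ p) (v ^ p)"
proof -
  assume "on_E u v"
  hence "(v ^ 2) ^ p = (u ^ 3 + 1) ^ p" by (simp add: on_E_def)
  thus ?thesis by (simp add: on_E_def power_p_add mult.commute flip: power_mult)
qed

text \<open>The three points lie on the line \<open>v = const\<close>.\<close>

lemma rho_relation:
  assumes "on_E u v"
  shows "ediv u v + rho (ediv u v) + rho (rho (ediv u v)) \<in> Prin"
proof -
  have z4: "\<zeta> ^ 2 * \<zeta> ^ 2 = - \<zeta>" 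
  proof -
    have "\<zeta> ^ 2 * \<zeta> ^ 2 = \<zeta> ^ 3 * \<zeta>" by (simp add: power2_eq_square power3_eq_cube)
    thus ?thesis by (simp add: zeta_3)
  qed
  have s: "1 + \<zeta> ^ 2 + \<zeta> ^ 2 * \<zeta> ^ 2 = 0" unfolding z4 by (simp add: zeta)
  have "0 ^ 2 = (1 + \<zeta> ^ 2 + \<zeta> ^ 2 * \<zeta> ^ 2) * u" unfolding s by simp
  hence 1: "0 ^ 2 = u + \<zeta> ^ 2 * u + \<zeta> ^ 2 * (\<zeta> ^ 2 * u)" by (simp add: algebra_simps)
  have "- (2 * 0 * v) = (1 + \<zeta> ^ 2 + \<zeta> ^ 2 * \<zeta> ^ 2) * \<zeta> ^ 2 * u ^ 2" unfolding s by simp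
  hence 2: "- (2 * 0 * v) = u * (\<zeta> ^ 2 * u) + u * (\<zeta> ^ 2 * (\<zeta> ^ 2 * u)) + (\<zeta> ^ 2 * u) * (\<zeta> ^ 2 * (\<zeta> ^ 2 * u))"
    by (simp add: algebra_simps power2_eq_square)
  have "u * (\<zeta> ^ 2 * u) * (\<zeta> ^ 2 * (\<zeta> ^ 2 * u)) = \<zeta> ^ 6 * u ^ 3"
    by (simp add: power2_eq_square power3_eq_cube eval_nat_numeral)
  hence 3: "v ^ 2 = 1 + u * (\<zeta> ^ 2 * u) * (\<zeta> ^ 2 * (\<zeta> ^ 2 * u))"
    using assms by (simp add: zeta_6 on_E_def)
  show ?thesis
    unfolding rho_ediv using line_divisor(4)[OF 1 2 3, of v v v] by simp
qed

section \<open>Irreducibility of the torsion of the elliptic quotient\<close>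

lemma torsion_annihilator:
  assumes "frag_cmul n D \<sim> 0" "frag_cmul (int r) D \<sim> 0" "\<not> D \<sim> 0"
  shows "int r dvd n"
proof (rule ccontr)
  assume "\<not> int r dvd n"
  hence "coprime (int r) n" using prime_r by (simp add: prime_imp_coprime)
  then obtain s t where "s * int r + t * n = 1" using bezout_int[of "int r" n] by auto
  hence "frag_cmul s (frag_cmul (int r) D) + frag_cmul t (frag_cmul n D) = D"
    by (simp flip: frag_cmul_distrib)
  moreover have "frag_cmul s (frag_cmul (int r) D) + frag_cmul t (frag_cmul n D) \<sim> frag_cmul s 0 + frag_cmul t 0"
    by (intro eqv_add eqv_cmul assms)
  ultimately show False using assms(3) by simp
qed

text \<open>
  If \<open>\<rho> x = k x\<close> and \<open>\<pi> x = j x\<close>, then \<open>y = \<pi> x\<close> satisfies \<open>\<rho> y = k y\<close>. But also \<open>\<rho>\<^sup>2 y = \<pi> \<rho> x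
  = k y\<close>, since \<open>\<pi>\<close> inverts roots of unity of order 3. So \<open>k\<^sup>2 = k\<close> modulo \<open>r\<close>, which
  contradicts \<open>1 + k + k\<^sup>2 = 0\<close> as \<open>r \<noteq> 3\<close>.
\<close>

lemma not_both_eigenvector:
  assumes E: "on_E u v" and tor: "frag_cmul (int r) (ediv u v) \<sim> 0"
    and k: "rho (ediv u v) \<sim> frag_cmul k (ediv u v)" and j: "frob (ediv u v) \<sim> frag_cmul j (ediv u v)"
  shows False
proof -
  define x where "x = ediv u v"
  define y where "y = frob x"
  have E': "on_E (u ^ p) (v ^ p)" by (rule on_E_frob[OF E])
  have y: "y = ediv (u ^ p) (v ^ p)" by (simp add: y_def x_def frob_ediv)
  have ny: "\<not> y \<sim> 0" using ediv_not_principal[OF E'] by (simp add: y eqv_0_iff)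
  have "frob (frag_cmul (int r) x) \<sim> frob 0" using tor by (intro frob_eqv) (simp add: x_def)
  hence ry: "frag_cmul (int r) y \<sim> 0" by (simp add: y_def push_divisor_cmul)
  have "rho y \<sim> rho (frag_cmul j x)" unfolding y_def using j by (intro rho_eqv) (simp add: x_def)
  also have "rho (frag_cmul j x) \<sim> frag_cmul j (frag_cmul k x)"
    unfolding push_divisor_cmul using k by (intro eqv_cmul) (simp add: x_def)
  also have "frag_cmul j (frag_cmul k x) = frag_cmul k (frag_cmul j x)" by (simp add: mult.commute)
  also have "frag_cmul k (frag_cmul j x) \<sim> frag_cmul k y"
    unfolding y_def using j by (intro eqv_cmul eqv_sym[of "frob x"]) (simp add: x_def)
  finally have ky: "rho y \<sim> frag_cmul k y" .
  have "rho (rho y) \<sim> rho (frag_cmul k y)" by (rule rho_eqv[OF ky])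
  also have "rho (frag_cmul k y) \<sim> frag_cmul k (frag_cmul k y)"
    unfolding push_divisor_cmul by (rule eqv_cmul[OF ky])
  finally have k2: "rho (rho y) \<sim> frag_cmul (k * k) y" by simp
  \<comment> \<open>The Frobenius inverts the roots of unity.\<close>
  have zp: "\<zeta> ^ 2 * \<zeta> ^ 2 = (\<zeta> ^ p) ^ 2"
  proof -
    have "(\<zeta> ^ p) ^ 2 = \<zeta> ^ 6 * (\<zeta> ^ 2 * \<zeta> ^ 2)" by (simp add: zeta_p flip: power_mult power_add)
    thus ?thesis by (simp add: zeta_6)
  qed
  have "\<zeta> ^ 2 * (\<zeta> ^ 2 * u ^ p) = (\<zeta> ^ p) ^ 2 * u ^ p" by (simp only: zp mult.assoc[symmetric])
  also have "\<dots> = (\<zeta> ^ 2 * u) ^ p"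
    by (metis power_mult_distrib power_mult mult.commute)
  finally have "rho (rho y) = frob (rho x)" by (simp only: y x_def rho_ediv frob_ediv)
  moreover have "frob (rho x) \<sim> frob (frag_cmul k x)" using k by (intro frob_eqv) (simp add: x_def)
  ultimately have k1: "rho (rho y) \<sim> frag_cmul k y" by (simp add: y_def push_divisor_cmul)
  have "frag_cmul (k * k - k) y \<sim> 0"
    using eqv_trans[OF eqv_sym[OF k2] k1] by (simp add: eqv_def frag_cmul_diff_distrib)
  hence d1: "int r dvd k * k - k" using torsion_annihilator ry ny by blast
  have "y + rho y + rho (rho y) \<sim> 0" using rho_relation[OF E'] by (simp add: y eqv_0_iff)
  moreover have "y + rho y + rho (rho y) \<sim> y + frag_cmul k y + frag_cmul (k * k) y"
    by (intro eqv_add ky k2 eqv_refl)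
  ultimately have "y + frag_cmul k y + frag_cmul (k * k) y \<sim> 0" using eqv_trans eqv_sym by blast
  moreover have "y + frag_cmul k y + frag_cmul (k * k) y = frag_cmul (1 + k + k * k) y"
    by (simp add: frag_cmul_distrib)
  ultimately have d2: "int r dvd 1 + k + k * k" using torsion_annihilator ry ny by simp
  have pr: "prime (int r)" using prime_r by simp
  have "k * k - k = k * (k - 1)" by (simp add: algebra_simps)
  hence "int r dvd k \<or> int r dvd k - 1" using d1 prime_dvd_mult_iff[OF pr] by simp
  thus False
  proof
    assume "int r dvd k"
    from dvd_diff[OF d2 dvd_mult2[OF this]]
    have "int r dvd 1 + k + k * k - k * (1 + k)" .
    hence "int r dvd 1" by (simp add: algebra_simps)
    thus False using pr by (simp add: not_prime_unit)
  next
    assume "int r dvd k - 1"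
    from dvd_diff[OF d2 dvd_mult2[OF this]]
    have "int r dvd 1 + k + k * k - (k - 1) * (k + 2)" .
    hence "int r dvd 3" by (simp add: algebra_simps)
    hence "r dvd 3" by (metis of_nat_dvd_iff of_nat_numeral)
    moreover have "prime (3::nat)" by simp
    ultimately have "r = 3" using prime_r primes_dvd_imp_eq by blast
    thus False using r by simp
  qed
qed

lemma r_gt_1: "1 < r"
  using prime_r by (rule prime_gt_1_nat)

lemma r_odd: "odd r"
  using prime_r r(1) by (metis primes_dvd_imp_eq two_is_prime_nat)

lemma r_nonzero: "of_nat r \<noteq> (0::'k)"
  using prime_r prime_p r(3) by (metis char of_nat_eq_0_iff_char_dvd primes_dvd_imp_eq)

lemma inverse_mod_r:
  assumes "\<not> int r dvd n"
  obtains m where "int r dvd m * n - 1"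
proof -
  have "coprime (int r) n" using prime_r assms by (simp add: prime_imp_coprime)
  then obtain s t where "s * int r + t * n = 1" using bezout_int[of "int r" n] by auto
  hence "t * n - 1 = int r * (- s)" by (simp add: algebra_simps)
  thus ?thesis using that[of t] by (metis dvd_triv_left)
qed

lemma cmul_cong_mod_r:
  assumes "frag_cmul (int r) D \<sim> 0" "int r dvd m - n"
  shows "frag_cmul m D \<sim> frag_cmul n D"
proof -
  obtain t where "m - n = int r * t" using assms(2) by (elim dvdE)
  hence "m - n = t * int r" by (simp add: mult.commute)
  hence "frag_cmul m D - frag_cmul n D = frag_cmul t (frag_cmul (int r) D)"
    by (simp flip: frag_cmul_diff_distrib)
  moreover have "frag_cmul t (frag_cmul (int r) D) \<sim> frag_cmul t 0" by (rule eqv_cmul[OF assms(1)])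
  ultimately show ?thesis by (simp add: eqv_def)
qed

text \<open>
  A set of divisors that is a union of classes. It contains the negatives of its torsion
  elements, which are positive multiples of them up to equivalence.
\<close>

definition submodule :: "('k curve_point \<Rightarrow>\<^sub>0 int) set \<Rightarrow> bool" where
  "submodule M \<longleftrightarrow>
     (\<forall>D\<in>M. \<forall>E\<in>M. D + E \<in> M) \<and> (\<forall>D\<in>M. \<forall>E. D \<sim> E \<longrightarrow> E \<in> M) \<and>
     (\<forall>D\<in>M. rho D \<in> M \<and> chi D \<in> M \<and> frob D \<in> M)"

context
  fixes M
  assumes M: "submodule M"
begin

lemma M_add: "D \<in> M \<Longrightarrow> E \<in> M \<Longrightarrow> D + E \<in> M"
  and M_eqv: "D \<in> M \<Longrightarrow> D \<sim> E \<Longrightarrow> E \<in> M"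
  and M_rho: "D \<in> M \<Longrightarrow> rho D \<in> M"
  and M_chi: "D \<in> M \<Longrightarrow> chi D \<in> M"
  and M_frob: "D \<in> M \<Longrightarrow> frob D \<in> M"
  using M by (auto simp: submodule_def)

lemma M_cmul_Suc: "D \<in> M \<Longrightarrow> frag_cmul (int (Suc n)) D \<in> M"
proof (induction n)
  case (Suc n)
  have "frag_cmul (int (Suc (Suc n))) D = D + frag_cmul (int (Suc n)) D"
    using frag_cmul_distrib[of 1 "int (Suc n)" D] by simp
  thus ?case using Suc M_add by simp
qed simp

lemma M_cmul:
  assumes "D \<in> M" "frag_cmul (int r) D \<sim> 0"
  shows "frag_cmul n D \<in> M"
proof -
  \<comment> \<open>A positive representative of \<open>n\<close> modulo \<open>r\<close>, as only positive multiples are known to lie in \<open>M\<close>.\<close>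
  define m where "m = n mod int r + int r"
  have pos: "int r > 0" using r_gt_1 by simp
  hence "m > 0" using pos_mod_sign[OF pos, of n] pos unfolding m_def by linarith
  hence "m = int (Suc (nat (m - 1)))" by simp
  hence "frag_cmul m D \<in> M" using M_cmul_Suc[OF assms(1)] by metis
  moreover have "m - n = int r * (1 - n div int r)"
    using mult_div_mod_eq[of "int r" n] by (simp add: m_def algebra_simps)
  hence "frag_cmul m D \<sim> frag_cmul n D" using cmul_cong_mod_r[OF assms(2)] by simp
  ultimately show ?thesis by (rule M_eqv)
qed

text \<open>
  With \<open>z\<close> one of \<open>\<rho> x\<close> and \<open>\<pi> x\<close> that is no multiple of \<open>x\<close>, and \<open>y\<close> outside of \<open>M\<close>, the \<open>2
  r\<^sup>2\<close> combinations \<open>i x + j z + k y\<close> with \<open>i, j < r\<close> and \<open>k < 2\<close> are pairwise inequivalent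
  torsion points of the elliptic curve. There are not that many.
\<close>

lemma plus_irreducible:
  assumes E: "on_E u v" and xM: "ediv u v \<in> M" and rx: "frag_cmul (int r) (ediv u v) \<sim> 0"
    and q: "point_on_E q" and rq: "frag_cmul (int r) (point_divisor q) \<sim> 0"
  shows "point_divisor q \<in> M"
proof (rule ccontr)
  assume notM: "point_divisor q \<notin> M"
  define x where "x = ediv u v"
  define y where "y = point_divisor q"
  have x: "\<not> x \<sim> 0" using ediv_not_principal[OF E] by (simp add: x_def eqv_0_iff)
  obtain z where z: "z = rho x \<or> z = frob x" "\<And>k. \<not> z \<sim> frag_cmul k x"
    using not_both_eigenvector[OF E rx] unfolding x_def by blast
  have zM: "z \<in> M" using z(1) xM M_rho M_frob by (auto simp: x_def)
  have "rho (frag_cmul (int r) x) \<sim> rho 0" "frob (frag_cmul (int r) x) \<sim> frob 0"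
    using rx by (intro rho_eqv frob_eqv; simp add: x_def)+
  hence rz: "frag_cmul (int r) z \<sim> 0" using z(1) by (auto simp: push_divisor_cmul)
  have zE: "\<exists>s. point_on_E s \<and> z \<sim> point_divisor s"
    using z(1)
  proof
    assume "z = rho x"
    thus ?thesis using on_E_rho[OF E] by (intro exI[of _ "Some (\<zeta> ^ 2 * u, v)"]) (simp add: x_def rho_ediv)
  next
    assume "z = frob x"
    thus ?thesis using on_E_frob[OF E] by (intro exI[of _ "Some (u ^ p, v ^ p)"]) (simp add: x_def frob_ediv)
  qed
  have indep: "a = 0 \<and> b = 0 \<and> c = 0"
    if 0: "frag_cmul a x + frag_cmul b z + frag_cmul c y \<sim> 0"
      and bound: "\<bar>a\<bar> < int r" "\<bar>b\<bar> < int r" "\<bar>c\<bar> < 2" for a b c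
  proof -
    have c0: "c = 0"
    proof (rule ccontr)
      assume "c \<noteq> 0"
      hence cc: "c * c = 1" using bound(3) by (cases "c = 1"; cases "c = - 1") auto
      have "frag_cmul c (frag_cmul a x + frag_cmul b z + frag_cmul c y) \<sim> frag_cmul c 0"
        by (rule eqv_cmul[OF 0])
      hence "frag_cmul (c * a) x + frag_cmul (c * b) z + y \<sim> 0"
        by (simp add: frag_cmul_distrib2 cc)
      from eqv_diff[OF this eqv_refl, of "frag_cmul (c * a) x + frag_cmul (c * b) z"]
      have "y \<sim> 0 - (frag_cmul (c * a) x + frag_cmul (c * b) z)" by (simp only: add_diff_cancel_left')
      moreover have "0 - (frag_cmul (c * a) x + frag_cmul (c * b) z) = frag_cmul (- (c * a)) x + frag_cmul (- (c * b)) z"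
        by (rule poly_mapping_eqI) (simp add: lookup_add lookup_minus)
      ultimately have "y \<sim> frag_cmul (- (c * a)) x + frag_cmul (- (c * b)) z" by metis
      moreover have "frag_cmul (- (c * a)) x + frag_cmul (- (c * b)) z \<in> M"
        using M_cmul xM rx zM rz by (intro M_add) (auto simp: x_def)
      ultimately have "y \<in> M" using M_eqv eqv_sym by blast
      thus False using notM by (simp add: y_def)
    qed
    have small: "n = 0" if "int r dvd n" "\<bar>n\<bar> < int r" for n
      using that zdvd_imp_le[of "int r" "\<bar>n\<bar>"] by (cases "n = 0") auto
    have b0: "b = 0"
    proof (rule ccontr)
      assume "b \<noteq> 0"
      hence "\<not> int r dvd b" using small bound(2) by blast
      then obtain m where m: "int r dvd m * b - 1" by (rule inverse_mod_r)
      have "frag_cmul m (frag_cmul a x + frag_cmul b z) \<sim> frag_cmul m 0"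
        using 0 c0 by (intro eqv_cmul) simp
      hence "frag_cmul (m * a) x + frag_cmul (m * b) z \<sim> 0" by (simp add: frag_cmul_distrib2)
      from eqv_diff[OF this eqv_refl, of "frag_cmul (m * a) x"]
      have "frag_cmul (m * b) z \<sim> frag_cmul (- (m * a)) x" by simp
      moreover have "z \<sim> frag_cmul (m * b) z"
        using eqv_sym[OF cmul_cong_mod_r[OF rz m]] by simp
      ultimately have "z \<sim> frag_cmul (- (m * a)) x" using eqv_trans by blast
      thus False using z(2) by blast
    qed
    have "frag_cmul a x \<sim> 0" using 0 b0 c0 by simp
    hence "int r dvd a" using torsion_annihilator rx x by (simp add: x_def)
    thus ?thesis using small bound(1) b0 c0 by blast
  qed
  have cmulE: "\<exists>s. point_on_E s \<and> frag_cmul (int n) D \<sim> point_divisor s"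
    if DE: "\<exists>s. point_on_E s \<and> D \<sim> point_divisor s" for n D
  proof (induction n)
    case 0
    show ?case by (intro exI[of _ None]) simp
  next
    case (Suc n)
    obtain s t where s: "point_on_E s" "D \<sim> point_divisor s"
      and t: "point_on_E t" "frag_cmul (int n) D \<sim> point_divisor t" using DE Suc by blast
    obtain w where w: "point_on_E w" "point_divisor s + point_divisor t \<sim> point_divisor w"
      using add_points s t by blast
    have "frag_cmul (int (Suc n)) D = D + frag_cmul (int n) D"
      using frag_cmul_distrib[of 1 "int n" D] by simp
    hence "frag_cmul (int (Suc n)) D \<sim> point_divisor w"
      using eqv_trans[OF eqv_add[OF s(2) t(2)] w(2)] by simp
    thus ?case using w(1) by blast
  qed
  define I where "I = {..<r} \<times> {..<r} \<times> {..<2::nat}"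
  define comb where "comb = (\<lambda>(i, j, k). frag_cmul (int i) x + frag_cmul (int j) z + frag_cmul (int k) y)"
  have "\<exists>s. point_on_E s \<and> comb t \<sim> point_divisor s" for t
  proof -
    obtain i j k where t: "t = (i, j, k)" by (cases t)
    have "\<exists>s. point_on_E s \<and> x \<sim> point_divisor s"
      using E by (intro exI[of _ "Some (u, v)"]) (simp add: x_def)
    from cmulE[OF this] obtain s1 where s1: "point_on_E s1" "frag_cmul (int i) x \<sim> point_divisor s1" by blast
    from cmulE[OF zE] obtain s2 where s2: "point_on_E s2" "frag_cmul (int j) z \<sim> point_divisor s2" by blast
    have "\<exists>s. point_on_E s \<and> y \<sim> point_divisor s" using q by (intro exI[of _ q]) (simp add: y_def)
    from cmulE[OF this] obtain s3 where s3: "point_on_E s3" "frag_cmul (int k) y \<sim> point_divisor s3" by blast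
    obtain s12 where s12: "point_on_E s12" "point_divisor s1 + point_divisor s2 \<sim> point_divisor s12"
      using add_points s1 s2 by blast
    obtain s where s: "point_on_E s" "point_divisor s12 + point_divisor s3 \<sim> point_divisor s"
      using add_points s12 s3 by blast
    have "comb t \<sim> point_divisor s12 + point_divisor s3"
      unfolding t comb_def prod.case
      by (intro eqv_add eqv_trans[OF eqv_add s12(2)] s1 s2 s3)
    thus ?thesis using s eqv_trans by blast
  qed
  then obtain g where g: "\<And>t. point_on_E (g t)" "\<And>t. comb t \<sim> point_divisor (g t)" by metis
  let ?T = "{s. point_on_E s \<and> frag_cmul (int r) (point_divisor s) \<sim> 0}"
  have "inj_on g I"
  proof (rule inj_onI)
    fix t t' assume t: "t \<in> I" "t' \<in> I" "g t = g t'"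
    obtain i j k i' j' k' where ijk: "t = (i, j, k)" "t' = (i', j', k')" by (cases t; cases t')
    have "comb t \<sim> comb t'" using g(2)[of t] g(2)[of t'] t(3) eqv_trans eqv_sym by metis
    hence "comb t - comb t' \<sim> 0" by (simp add: eqv_def)
    moreover have "comb t - comb t' =
        frag_cmul (int i - int i') x + frag_cmul (int j - int j') z + frag_cmul (int k - int k') y"
      by (simp add: ijk comb_def frag_cmul_diff_distrib)
    ultimately have "frag_cmul (int i - int i') x + frag_cmul (int j - int j') z + frag_cmul (int k - int k') y \<sim> 0"
      by simp
    hence "int i - int i' = 0 \<and> int j - int j' = 0 \<and> int k - int k' = 0"
      by (rule indep) (use t ijk in \<open>auto simp: I_def\<close>)
    thus "t = t'" by (simp add: ijk)
  qed
  moreover have "g ` I \<subseteq> ?T"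
  proof
    fix s assume "s \<in> g ` I"
    then obtain t where t: "s = g t" by blast
    obtain i j k where ijk: "t = (i, j, k)" by (cases t)
    have "frag_cmul (int r) (comb t) = frag_cmul (int i) (frag_cmul (int r) x) +
        frag_cmul (int j) (frag_cmul (int r) z) + frag_cmul (int k) (frag_cmul (int r) y)"
      by (simp add: ijk comb_def frag_cmul_distrib2 mult.commute)
    also have "\<dots> \<sim> frag_cmul (int i) 0 + frag_cmul (int j) 0 + frag_cmul (int k) 0"
      using rx rz rq by (intro eqv_add eqv_cmul) (auto simp: x_def y_def)
    finally have "frag_cmul (int r) (comb t) \<sim> 0" by simp
    moreover have "frag_cmul (int r) (point_divisor s) \<sim> frag_cmul (int r) (comb t)"
      using eqv_cmul[OF eqv_sym[OF g(2)[of t]]] t by simp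
    ultimately show "s \<in> ?T" using g(1)[of t] t eqv_trans by blast
  qed
  ultimately have "card I \<le> card ?T"
    using card_inj_on_le torsion_points_bound(1)[OF r_odd r_gt_1 r_nonzero] by blast
  moreover have "card I = 2 * r ^ 2" by (simp add: I_def power2_eq_square)
  ultimately show False using torsion_points_bound(2)[OF r_odd r_gt_1 r_nonzero] by simp
qed

end

section \<open>Irreducibility of the torsion of the Jacobian\<close>

definition eps :: "('k curve_point \<Rightarrow>\<^sub>0 int) \<Rightarrow> ('k curve_point \<Rightarrow>\<^sub>0 int)" where
  "eps D = rho (rho (rho D))"

text \<open>The third power of \<open>\<rho>\<close>.\<close>

fun eps_point :: "'k curve_point \<Rightarrow> 'k curve_point" where
  "eps_point (Aff x y) = Aff (- x) y"
| "eps_point (Inf w) = Inf (- w)"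

lemma eps_eq: "eps D = push_divisor eps_point D"
proof -
  have "rho_point \<zeta> (rho_point \<zeta> (rho_point \<zeta> P)) = eps_point P" for P
    using zeta_3 by (cases P) (simp_all add: power3_eq_cube flip: mult.assoc)
  hence "rho_point \<zeta> \<circ> (rho_point \<zeta> \<circ> rho_point \<zeta>) = eps_point" by (simp add: fun_eq_iff)
  thus ?thesis by (simp add: eps_def push_divisor_push_divisor)
qed

lemma eps_eqv: "D \<sim> E \<Longrightarrow> eps D \<sim> eps E"
  unfolding eps_def by (intro rho_eqv)

abbreviation "infinity_divisor \<equiv> frag_of (Inf 1) + frag_of (Inf (- 1 :: 'k))"

text \<open>
  For an affine point \<open>P\<close>, the divisor \<open>P + \<epsilon> P\<close> is a pullback from the elliptic quotient, up to
  points at infinity.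
\<close>

lemma symmetric_divisor:
  assumes "Poly_Mapping.keys D \<subseteq> curve_points C"
  shows "\<exists>q. point_on_E q \<and> D + eps D - frag_cmul (divisor_degree D) infinity_divisor \<sim> point_divisor q"
  using assms
proof (induction D rule: frag_induction)
  case zero
  show ?case by (intro exI[of _ None]) (simp add: eps_eq)
next
  case (one P)
  show ?case
  proof (cases P)
    case (Aff x y)
    have "y ^ 2 = x ^ 6 + 1" using one Aff by (simp add: curve_points_def)
    hence "on_E (x ^ 2) y" by (simp add: on_E_def flip: power_mult)
    moreover have "frag_of P + eps (frag_of P) - frag_cmul (divisor_degree (frag_of P)) infinity_divisor = ediv (x ^ 2) y"
      by (simp add: Aff eps_eq ediv_eq[of x])
    ultimately show ?thesis by (intro exI[of _ "Some (x ^ 2, y)"]) simp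
  next
    case (Inf w)
    hence "w = 1 \<or> w = - 1" using one by (simp add: curve_points_def power2_eq_1_iff)
    hence "frag_of P + eps (frag_of P) - frag_cmul (divisor_degree (frag_of P)) infinity_divisor = 0"
      by (auto simp: Inf eps_eq)
    thus ?thesis by (intro exI[of _ None]) simp
  qed
next
  case (diff a b)
  then obtain s t where s: "point_on_E s" "a + eps a - frag_cmul (divisor_degree a) infinity_divisor \<sim> point_divisor s"
    and t: "point_on_E t" "b + eps b - frag_cmul (divisor_degree b) infinity_divisor \<sim> point_divisor t" by blast
  obtain t' where t': "point_on_E t'" "- point_divisor t \<sim> point_divisor t'" using uminus_point[OF t(1)] by blast
  obtain w where w: "point_on_E w" "point_divisor s + point_divisor t' \<sim> point_divisor w"
    using add_points s(1) t'(1) by blast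
  have "(a + eps a - frag_cmul (divisor_degree a) infinity_divisor) - (b + eps b - frag_cmul (divisor_degree b) infinity_divisor)
      \<sim> point_divisor s + (- point_divisor t)"
    using eqv_diff[OF s(2) t(2)] by simp
  also have "\<dots> \<sim> point_divisor s + point_divisor t'" by (intro eqv_add eqv_refl t')
  also have "\<dots> \<sim> point_divisor w" by (rule w(2))
  finally have "a - b + eps (a - b) - frag_cmul (divisor_degree (a - b)) infinity_divisor \<sim> point_divisor w"
    by (simp add: eps_eq frag_cmul_diff_distrib algebra_simps)
  thus ?case using w(1) by blast
qed

lemma fiber_principal: "y0 ^ 2 = e ^ 6 + 1 \<Longrightarrow> fiber e y0 \<in> Prin"
proof -
  assume y0: "y0 ^ 2 = e ^ 6 + 1"
  have e: "ev [:[:- e, 1:]:] x y = x - cc e" for x y :: "'k fls" by simp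
  have "degree [:[:- e, 1:]:] < degree C.W" by (simp add: curve_equation_def)
  hence "\<not> C.W dvd [:[:- e, 1:]:]" by (auto dest: dvd_imp_degree_le)
  hence "C.has_divisor [:[:- e, 1:]:] 1 (fiber e y0)"
    using C.not_dvd_1 unfolding C.has_divisor_def e by (auto simp: lookup_fiber[OF _ y0])
  thus ?thesis using keys_fiber[OF y0] unfolding C.principal_divisors_iff by blast
qed

text \<open>A point and its conjugate form a fibre of \<open>x\<close>.\<close>

lemma hyper_is_minus_one:
  assumes "Poly_Mapping.keys D \<subseteq> curve_points C" "divisor_degree D = 0"
  shows "hyp D \<sim> - D"
proof -
  have "D + hyp D - frag_cmul (divisor_degree D) infinity_divisor \<in> Prin"
    using assms(1)
  proof (induction D rule: frag_induction)
    case zero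
    show ?case by (simp add: C.principal_0)
  next
    case (one P)
    show ?case
    proof (cases P)
      case (Aff x y)
      have "fiber x y \<in> Prin" using one Aff by (intro fiber_principal) (simp add: curve_points_def)
      thus ?thesis by (simp add: Aff fiber_def algebra_simps)
    next
      case (Inf w)
      hence "w = 1 \<or> w = - 1" using one by (simp add: curve_points_def power2_eq_1_iff)
      thus ?thesis using C.principal_0 by (auto simp: Inf)
    qed
  next
    case (diff a b)
    have "a - b + hyp (a - b) - frag_cmul (divisor_degree (a - b)) infinity_divisor =
        (a + hyp a - frag_cmul (divisor_degree a) infinity_divisor) - (b + hyp b - frag_cmul (divisor_degree b) infinity_divisor)"
      by (simp add: frag_cmul_diff_distrib algebra_simps)
    thus ?case using C.principal_diff diff by metis
  qed
  thus ?thesis using assms(2) by (simp add: eqv_def algebra_simps)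
qed

definition degree_zero :: "('k curve_point \<Rightarrow>\<^sub>0 int) \<Rightarrow> bool" where
  "degree_zero D \<longleftrightarrow> Poly_Mapping.keys D \<subseteq> curve_points C \<and> divisor_degree D = 0"

lemma moebius_C_points:
  assumes "moebius_transports a b c d C C" "a * d - b * c \<noteq> 0" "P \<in> curve_points C"
  shows "moebius a b c d P \<in> curve_points C"
  using C_coordinates_exist[OF assms(3)] moebius_coordinates(2)[OF _ assms(2,1)]
    coordinates_on_curve[OF _ degree_C_sextic] by blast

lemma rho_points: "P \<in> curve_points C \<Longrightarrow> rho_point \<zeta> P \<in> curve_points C"
  unfolding rho_point_def
  by (rule moebius_C_points)
     (auto simp: zeta_nonzero moebius_transports_def power_mult_distrib zeta_6 fls_const_power[symmetric])

lemma chi_points: "P \<in> curve_points C \<Longrightarrow> chi_point P \<in> curve_points C"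
  unfolding chi_point_def
  by (rule moebius_C_points) (auto simp: moebius_transports_def power_divide distrib_right)

lemma frob_points: "P \<in> curve_points C \<Longrightarrow> frobenius_point p P \<in> curve_points C"
  unfolding frobenius_point_def
  by (rule aut_curve_points[OF power_p_automorphism aut_C_sextic[OF power_p_automorphism]])

lemma degree_zero_push:
  assumes "degree_zero D" "\<And>P. P \<in> curve_points C \<Longrightarrow> s P \<in> curve_points C"
  shows "degree_zero (push_divisor s D)"
  using assms keys_push_divisor[of s D] by (auto simp: degree_zero_def)

lemma eps_degree_zero: "degree_zero D \<Longrightarrow> degree_zero (eps D)"
  unfolding eps_def by (intro degree_zero_push rho_points)

lemma chi_degree_zero: "degree_zero D \<Longrightarrow> degree_zero (chi D)"
  by (intro degree_zero_push chi_points)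

text \<open>
  On points, \<open>\<chi> \<epsilon>\<close> is \<open>\<epsilon> \<chi>\<close> followed by the hyperelliptic involution.
\<close>

lemma chi_eps:
  assumes "degree_zero D"
  shows "chi (eps D) \<sim> - eps (chi D)"
proof -
  have "chi_point (eps_point P) = hyper (eps_point (chi_point P))" for P
    by (cases P) (auto simp: power3_eq_cube)
  hence "chi_point \<circ> eps_point = hyper \<circ> (eps_point \<circ> chi_point)" by (simp add: fun_eq_iff)
  hence "chi (eps D) = hyp (eps (chi D))" by (simp add: eps_eq push_divisor_push_divisor)
  thus ?thesis
    using hyper_is_minus_one eps_degree_zero[OF chi_degree_zero[OF assms]] by (simp add: degree_zero_def)
qed

lemma chi_involution: "chi (chi D) = D"
  by (simp add: push_divisor_push_divisor push_divisor_id)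

text \<open>
  Either \<open>D\<close> or \<open>\<chi> D\<close> has a non-zero projection \<open>F + \<epsilon> F\<close> to the fixed space of \<open>\<epsilon>\<close>, so \<open>M\<close>
  contains that whole space. Applying this to \<open>E\<close> and to \<open>\<chi> E\<close>, and \<open>\<chi>\<close> to the latter, gives \<open>E
  + \<epsilon> E\<close> and \<open>E - \<epsilon> E\<close> in \<open>M\<close>, hence \<open>2 E\<close>, and \<open>r\<close> is odd.
\<close>

lemma torsion_irreducible:
  assumes M: "submodule M"
    and D: "D \<in> M" "degree_zero D" "frag_cmul (int r) D \<sim> 0" "\<not> D \<sim> 0"
    and E: "degree_zero E" "frag_cmul (int r) E \<sim> 0"
  shows "E \<in> M"
proof -
  have eps_M: "eps F \<in> M" if "F \<in> M" for F unfolding eps_def using that M_rho[OF M] by blast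
  have chi_tor: "frag_cmul (int r) (chi F) \<sim> 0" if "frag_cmul (int r) F \<sim> 0" for F
    using chi_eqv[OF that] by (simp add: push_divisor_cmul)
  have plus: "\<exists>q. point_on_E q \<and> F + eps F \<sim> point_divisor q \<and> frag_cmul (int r) (point_divisor q) \<sim> 0"
    if F: "degree_zero F" "frag_cmul (int r) F \<sim> 0" for F
  proof -
    obtain q where q: "point_on_E q" "F + eps F \<sim> point_divisor q"
      using symmetric_divisor[of F] F(1) by (auto simp: degree_zero_def)
    have "eps (frag_cmul (int r) F) \<sim> eps 0" by (rule eps_eqv[OF F(2)])
    hence "frag_cmul (int r) (F + eps F) \<sim> 0 + 0"
      unfolding frag_cmul_distrib2 using F(2) by (intro eqv_add) (simp_all add: eps_eq push_divisor_cmul)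
    hence "frag_cmul (int r) (point_divisor q) \<sim> 0"
      using eqv_trans[OF eqv_sym[OF eqv_cmul[OF q(2)]]] by simp
    thus ?thesis using q by blast
  qed
  have chi_eps_chi: "chi (eps (chi F)) \<sim> - eps F" if "degree_zero F" for F
    using chi_eps[OF chi_degree_zero[OF that]] by (simp add: chi_involution)
  have two_tor: "F \<sim> 0" if F: "frag_cmul (int r) F \<sim> 0" "F + F \<sim> 0" for F
  proof (rule ccontr)
    assume "\<not> F \<sim> 0"
    moreover have "frag_cmul 2 F \<sim> 0" using F(2) frag_cmul_distrib[of 1 1 F] by simp
    ultimately have "int r dvd 2" using torsion_annihilator F(1) by blast
    hence "r dvd 2" by (metis of_nat_dvd_iff of_nat_numeral)
    thus False using prime_r r(1) primes_dvd_imp_eq two_is_prime_nat by blast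
  qed
  have "\<exists>u v. on_E u v \<and> ediv u v \<in> M \<and> frag_cmul (int r) (ediv u v) \<sim> 0"
  proof -
    have "\<exists>F. F \<in> M \<and> degree_zero F \<and> frag_cmul (int r) F \<sim> 0 \<and> \<not> F + eps F \<sim> 0"
    proof (cases "D + eps D \<sim> 0")
      case False
      thus ?thesis using D by blast
    next
      case True
      let ?F = "chi D"
      from eqv_diff[OF True eqv_refl, of D] have "eps D \<sim> - D" by simp
      hence "chi (eps D) \<sim> - ?F" using chi_eqv[of "eps D" "- D"] by simp
      hence "- eps ?F \<sim> - ?F" using eqv_trans[OF eqv_sym[OF chi_eps[OF D(2)]]] by blast
      hence "eps ?F \<sim> ?F" using eqv_uminus[of "- eps ?F" "- ?F"] by simp
      hence FF: "?F + eps ?F \<sim> ?F + ?F" by (intro eqv_add eqv_refl)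
      have "\<not> ?F + eps ?F \<sim> 0"
      proof
        assume "?F + eps ?F \<sim> 0"
        hence "?F + ?F \<sim> 0" using eqv_trans[OF eqv_sym[OF FF]] by blast
        hence "?F \<sim> 0" using two_tor chi_tor[OF D(3)] by blast
        from chi_eqv[OF this] show False using D(4) by (simp add: chi_involution)
      qed
      thus ?thesis using M_chi[OF M D(1)] chi_degree_zero[OF D(2)] chi_tor[OF D(3)] by blast
    qed
    then obtain F where F: "F \<in> M" "degree_zero F" "frag_cmul (int r) F \<sim> 0" "\<not> F + eps F \<sim> 0" by blast
    obtain q where q: "point_on_E q" "F + eps F \<sim> point_divisor q" "frag_cmul (int r) (point_divisor q) \<sim> 0"
      using plus[OF F(2,3)] by blast
    have "q \<noteq> None"
    proof
      assume "q = None"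
      thus False using q(2) F(4) by simp
    qed
    then obtain u v where uv: "q = Some (u, v)" using option.exhaust prod.exhaust by metis
    have "F + eps F \<in> M" using M_add[OF M] eps_M F(1) by blast
    hence "ediv u v \<in> M" using M_eqv[OF M] q(2) uv by auto
    thus ?thesis using q uv by auto
  qed
  then obtain u v where uv: "on_E u v" "ediv u v \<in> M" "frag_cmul (int r) (ediv u v) \<sim> 0" by blast
  have plus_M: "F + eps F \<in> M" if F: "degree_zero F" "frag_cmul (int r) F \<sim> 0" for F
  proof -
    obtain q where q: "point_on_E q" "F + eps F \<sim> point_divisor q" "frag_cmul (int r) (point_divisor q) \<sim> 0"
      using plus[OF F] by blast
    have "point_divisor q \<in> M" using plus_irreducible[OF M uv q(1,3)] .
    thus ?thesis using M_eqv[OF M _ eqv_sym[OF q(2)]] by blast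
  qed
  have "chi (chi E + eps (chi E)) \<in> M"
    using plus_M[OF chi_degree_zero[OF E(1)] chi_tor[OF E(2)]] M_chi[OF M] by blast
  moreover have "chi (chi E + eps (chi E)) \<sim> E + (- eps E)"
    using eqv_add[OF eqv_refl chi_eps_chi[OF E(1)], of E] by (simp add: chi_involution)
  ultimately have "E - eps E \<in> M" using M_eqv[OF M] by simp
  hence "(E + eps E) + (E - eps E) \<in> M" using M_add[OF M plus_M[OF E]] by blast
  moreover have "(E + eps E) + (E - eps E) = frag_cmul 2 E"
    using frag_cmul_distrib[of 1 1 E] by simp
  ultimately have 2: "frag_cmul 2 E \<in> M" by simp
  have "frag_cmul 2 (frag_cmul (int r) E) \<sim> frag_cmul 2 0" by (rule eqv_cmul[OF E(2)])
  hence "frag_cmul (int r) (frag_cmul 2 E) \<sim> 0" by (simp add: mult.commute)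
  \<comment> \<open>\<open>(r + 1) / 2\<close> inverts 2 modulo \<open>r\<close>.\<close>
  from M_cmul[OF M 2 this, of "(int r + 1) div 2"]
  have "frag_cmul ((int r + 1) div 2 * 2) E \<in> M" by simp
  moreover have "(int r + 1) div 2 * 2 = int r + 1" using r_odd by (auto elim!: oddE)
  ultimately have "frag_cmul (int r + 1) E \<in> M" by simp
  moreover have "frag_cmul (int r + 1) E \<sim> frag_cmul 1 E"
    by (rule cmul_cong_mod_r[OF E(2)]) simp
  ultimately show ?thesis using M_eqv[OF M] by simp
qed

end

section \<open>Divisor classes\<close>

text \<open>
  Degree zero makes the principal divisors a subgroup of the group whose quotient is the
  Jacobian.
\<close>

locale sextic_jacobian = sextic_curve +
  assumes degree_principal: "D \<in> principal_divisors f \<Longrightarrow> divisor_degree D = 0"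
begin

definition cls :: "('a curve_point \<Rightarrow>\<^sub>0 int) \<Rightarrow> ('a curve_point \<Rightarrow>\<^sub>0 int) set" where
  "cls D = (\<lambda>Q. Q + D) ` principal_divisors f"

definition deg0 :: "('a curve_point \<Rightarrow>\<^sub>0 int) set" where
  "deg0 = {D. Poly_Mapping.keys D \<subseteq> curve_points f \<and> divisor_degree D = 0}"

lemma degree_zero_divisors_simps [simp]:
  "carrier (degree_zero_divisors f) = deg0"
  "D \<otimes>\<^bsub>degree_zero_divisors f\<^esub> E = D + E"
  by (auto simp: degree_zero_divisors_def deg0_def free_Abelian_group_def)

lemma carrier_Jac: "carrier (Jac f) = cls ` deg0"
  by (auto simp: Jac_def FactGroup_def RCOSETS_def r_coset_def cls_def)

lemma one_Jac: "\<one>\<^bsub>Jac f\<^esub> = cls 0"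
  by (simp add: Jac_def FactGroup_def cls_def)

lemma cls_mult: "cls D \<otimes>\<^bsub>Jac f\<^esub> cls E = cls (D + E)"
proof -
  have "cls D \<otimes>\<^bsub>Jac f\<^esub> cls E = {P + D + (Q + E) | P Q. P \<in> principal_divisors f \<and> Q \<in> principal_divisors f}"
    by (auto simp: Jac_def FactGroup_def set_mult_def cls_def)
  also have "\<dots> = cls (D + E)"
  proof (intro equalityI subsetI)
    fix F assume "F \<in> {P + D + (Q + E) | P Q. P \<in> principal_divisors f \<and> Q \<in> principal_divisors f}"
    then obtain P Q where "F = P + D + (Q + E)" "P \<in> principal_divisors f" "Q \<in> principal_divisors f" by blast
    thus "F \<in> cls (D + E)" unfolding cls_def
      by (intro image_eqI[of _ _ "P + Q"]) (auto simp: algebra_simps principal_add)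
  next
    fix F assume "F \<in> cls (D + E)"
    then obtain P where P: "F = P + (D + E)" "P \<in> principal_divisors f" by (auto simp: cls_def)
    hence "F = P + D + (0 + E)" by (simp add: algebra_simps)
    thus "F \<in> {P + D + (Q + E) | P Q. P \<in> principal_divisors f \<and> Q \<in> principal_divisors f}"
      using P principal_0 by blast
  qed
  finally show ?thesis .
qed

lemma cls_eq_iff: "cls D = cls E \<longleftrightarrow> D - E \<in> principal_divisors f"
proof
  assume "cls D = cls E"
  moreover have "D \<in> cls D" unfolding cls_def using principal_0 by (intro image_eqI[of _ _ 0]) auto
  ultimately have "D \<in> cls E" by simp
  then obtain P where "D = P + E" "P \<in> principal_divisors f" by (auto simp: cls_def)
  thus "D - E \<in> principal_divisors f" by simp
next
  have sub: "cls D \<subseteq> cls E" if "D - E \<in> principal_divisors f" for D E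
  proof
    fix F assume "F \<in> cls D"
    then obtain P where P: "F = P + D" "P \<in> principal_divisors f" by (auto simp: cls_def)
    hence "F = (P + (D - E)) + E" by simp
    thus "F \<in> cls E" unfolding cls_def using principal_add[OF P(2) that] by (intro image_eqI)
  qed
  assume "D - E \<in> principal_divisors f"
  moreover from this have "E - D \<in> principal_divisors f" using principal_uminus[of "D - E"] by simp
  ultimately show "cls D = cls E" using sub by blast
qed

lemma cls_power: "cls D [^]\<^bsub>Jac f\<^esub> (n::nat) = cls (frag_cmul (int n) D)"
proof (induction n)
  case 0
  show ?case by (simp add: nat_pow_def one_Jac)
next
  case (Suc n)
  have "cls D [^]\<^bsub>Jac f\<^esub> Suc n = cls D [^]\<^bsub>Jac f\<^esub> n \<otimes>\<^bsub>Jac f\<^esub> cls D" by (simp add: nat_pow_def)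
  thus ?case using frag_cmul_distrib[of "int n" 1 D] by (simp add: Suc cls_mult add.commute)
qed

lemma deg0_principal: "D \<in> principal_divisors f \<Longrightarrow> D \<in> deg0"
  using degree_principal by (simp add: deg0_def principal_divisors_def)

lemma deg0_diff: "D \<in> deg0 \<Longrightarrow> E \<in> deg0 \<Longrightarrow> D - E \<in> deg0"
  using keys_diff[of D E] by (auto simp: deg0_def)

lemma deg0_add: "D \<in> deg0 \<Longrightarrow> E \<in> deg0 \<Longrightarrow> D + E \<in> deg0"
  using keys_add[of D E] by (auto simp: deg0_def)

lemma torsion_cls_iff:
  "D \<in> deg0 \<Longrightarrow> cls D \<in> torsion (Jac f) r \<longleftrightarrow> frag_cmul (int r) D \<in> principal_divisors f"
  by (auto simp: torsion_def carrier_Jac cls_power one_Jac cls_eq_iff)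

end

lemma Jac_map_cls:
  assumes "sextic_jacobian f" "sextic_jacobian f'"
    and push: "\<And>D. D \<in> principal_divisors f \<Longrightarrow> push_divisor s D \<in> principal_divisors f'"
    and D: "D \<in> sextic_jacobian.deg0 f"
  shows "Jac_map f f' s (sextic_jacobian.cls f D) = sextic_jacobian.cls f' (push_divisor s D)"
proof -
  interpret f: sextic_jacobian f by fact
  interpret f': sextic_jacobian f' by fact
  have "Jac_map f f' s (f.cls D) =
      principal_divisors f' <#>\<^bsub>degree_zero_divisors f'\<^esub> (push_divisor s ` f.cls D)"
    using D by (simp add: Jac_map_def f.carrier_Jac)
  also have "\<dots> = {Q + push_divisor s (P + D) | Q P. Q \<in> principal_divisors f' \<and> P \<in> principal_divisors f}"
    by (auto simp: set_mult_def f.cls_def)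
  also have "\<dots> = f'.cls (push_divisor s D)"
  proof (intro equalityI subsetI)
    fix F assume "F \<in> {Q + push_divisor s (P + D) | Q P. Q \<in> principal_divisors f' \<and> P \<in> principal_divisors f}"
    then obtain Q P where *: "F = Q + push_divisor s (P + D)" "Q \<in> principal_divisors f'" "P \<in> principal_divisors f"
      by blast
    hence "F = (Q + push_divisor s P) + push_divisor s D" by (simp add: algebra_simps)
    thus "F \<in> f'.cls (push_divisor s D)"
      unfolding f'.cls_def using f'.principal_add[OF *(2) push[OF *(3)]] by (intro image_eqI)
  next
    fix F assume "F \<in> f'.cls (push_divisor s D)"
    then obtain Q where Q: "F = Q + push_divisor s D" "Q \<in> principal_divisors f'" by (auto simp: f'.cls_def)
    hence "F = Q + push_divisor s (0 + D)" by simp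
    thus "F \<in> {Q + push_divisor s (P + D) | Q P. Q \<in> principal_divisors f' \<and> P \<in> principal_divisors f}"
      using Q(2) f.principal_0 by blast
  qed
  finally show ?thesis .
qed

lemma (in fermat_sextic) C_jacobian: "sextic_jacobian C"
  by unfold_locales (rule principal_degree)

lemma (in fermat_twist) C'_jacobian: "sextic_jacobian C'"
proof (unfold_locales)
  fix D assume "D \<in> principal_divisors C'"
  from principal_degree[OF push_twist_principal[OF this]] show "divisor_degree D = 0" by simp
qed

context fermat_torsion
begin

sublocale J: sextic_jacobian C
  by (rule C_jacobian)

lemma deg0_iff: "D \<in> J.deg0 \<longleftrightarrow> degree_zero D"
  by (simp add: J.deg0_def degree_zero_def)

lemma Jac_map_C:
  assumes "\<And>D. D \<in> Prin \<Longrightarrow> push_divisor s D \<in> Prin" "D \<in> J.deg0"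
  shows "Jac_map C C s (J.cls D) = J.cls (push_divisor s D)"
  using Jac_map_cls[OF C_jacobian C_jacobian] assms by blast

text \<open>
  The divisors whose classes are images of the class of \<open>D\<close> under the ring form a submodule.
\<close>

lemma orbit_contains_torsion:
  assumes D: "D \<in> J.deg0" "frag_cmul (int r) D \<in> Prin" "D \<notin> Prin"
    and E: "E \<in> J.deg0" "frag_cmul (int r) E \<in> Prin"
  shows "\<exists>\<alpha>\<in>Z_pi_chi_rho p \<zeta>. \<alpha> (J.cls D) = J.cls E"
proof -
  let ?R = "End_ring (Jac C)"
  define M where "M = {F \<in> J.deg0. \<exists>\<alpha>\<in>Z_pi_chi_rho p \<zeta>. \<alpha> (J.cls D) = J.cls F}"
  have D_carrier: "J.cls D \<in> carrier (Jac C)" using D(1) by (simp add: J.carrier_Jac)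
  have push: "push_divisor s F \<in> M"
    if F: "F \<in> M" and s: "\<And>D. D \<in> Prin \<Longrightarrow> push_divisor s D \<in> Prin"
      "\<And>P. P \<in> curve_points C \<Longrightarrow> s P \<in> curve_points C"
      and gen: "Jac_map C C s \<in> Z_pi_chi_rho p \<zeta>" for s F
  proof -
    obtain \<alpha> where \<alpha>: "\<alpha> \<in> Z_pi_chi_rho p \<zeta>" "\<alpha> (J.cls D) = J.cls F" and F0: "F \<in> J.deg0"
      using F by (auto simp: M_def)
    have "Jac_map C C s \<otimes>\<^bsub>?R\<^esub> \<alpha> \<in> Z_pi_chi_rho p \<zeta>"
      using gen \<alpha>(1) unfolding Z_pi_chi_rho_def by (rule generate_ring.eng_mult)
    moreover have "(Jac_map C C s \<otimes>\<^bsub>?R\<^esub> \<alpha>) (J.cls D) = J.cls (push_divisor s F)"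
      using D_carrier Jac_map_C[OF s(1) F0] by (simp add: End_ring_def compose_def \<alpha>(2))
    moreover have "push_divisor s F \<in> J.deg0"
      using degree_zero_push[of F s] F0 s(2) by (simp add: deg0_iff)
    ultimately show ?thesis by (auto simp: M_def)
  qed
  have sub: "submodule M"
    unfolding submodule_def
  proof (intro conjI ballI allI impI)
    fix F F' assume "F \<in> M" "F' \<in> M"
    then obtain \<alpha> \<beta> where *: "\<alpha> \<in> Z_pi_chi_rho p \<zeta>" "\<alpha> (J.cls D) = J.cls F"
        "\<beta> \<in> Z_pi_chi_rho p \<zeta>" "\<beta> (J.cls D) = J.cls F'" "F + F' \<in> J.deg0"
      by (auto simp: M_def J.deg0_add)
    have "\<alpha> \<oplus>\<^bsub>?R\<^esub> \<beta> \<in> Z_pi_chi_rho p \<zeta>"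
      using *(1,3) unfolding Z_pi_chi_rho_def by (rule generate_ring.eng_add)
    moreover have "(\<alpha> \<oplus>\<^bsub>?R\<^esub> \<beta>) (J.cls D) = J.cls (F + F')"
      using D_carrier by (simp add: End_ring_def *(2,4) J.cls_mult)
    ultimately show "F + F' \<in> M" using *(5) by (auto simp: M_def)
  next
    fix F F' assume F: "F \<in> M" "F \<sim> F'"
    have "F - (F - F') \<in> J.deg0"
      using J.deg0_diff[OF _ J.deg0_principal, of F "F - F'"] F by (simp add: M_def eqv_def)
    moreover have "J.cls F = J.cls F'" using F(2) by (simp add: J.cls_eq_iff eqv_def)
    ultimately show "F' \<in> M" using F(1) by (simp add: M_def)
  next
    fix F assume F: "F \<in> M"
    show "rho F \<in> M"
      by (rule push[OF F rho_principal rho_points])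
         (auto simp: Z_pi_chi_rho_def intro: generate_ring.incl)
    show "chi F \<in> M"
      by (rule push[OF F chi_principal chi_points])
         (auto simp: Z_pi_chi_rho_def intro: generate_ring.incl)
    show "frob F \<in> M"
      by (rule push[OF F _ frob_points])
         (auto simp: Z_pi_chi_rho_def frob_principal_iff intro: generate_ring.incl)
  qed
  have "\<one>\<^bsub>?R\<^esub> \<in> Z_pi_chi_rho p \<zeta>" unfolding Z_pi_chi_rho_def by (rule generate_ring.one)
  moreover have "\<one>\<^bsub>?R\<^esub> (J.cls D) = J.cls D" using D_carrier by (simp add: End_ring_def)
  ultimately have "D \<in> M" using D(1) by (auto simp: M_def)
  hence "E \<in> M"
    using torsion_irreducible[OF sub] D E by (simp add: deg0_iff eqv_0_iff)
  thus ?thesis by (simp add: M_def)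
qed

end

locale fermat_twist_torsion = fermat_torsion + fermat_twist
begin

sublocale J': sextic_jacobian C'
  by (rule C'_jacobian)

lemma Jac_map_twist:
  "D \<in> J'.deg0 \<Longrightarrow> Jac_map C' C (moebius a b c d) (J'.cls D) = J.cls (push_divisor (moebius a b c d) D)"
  using Jac_map_cls[OF C'_jacobian C_jacobian] push_twist_principal by blast

lemma push_twist_principal_iff:
  "push_divisor (moebius a b c d) D \<in> Prin \<longleftrightarrow> D \<in> principal_divisors C'"
proof
  assume "push_divisor (moebius a b c d) D \<in> Prin"
  from push_twist_principal_inverse[OF this] show "D \<in> principal_divisors C'"
    by (simp add: push_divisor_push_divisor push_divisor_id moebius_left_inverse)
qed (rule push_twist_principal)

lemma push_twist_deg0: "D \<in> J'.deg0 \<Longrightarrow> push_divisor (moebius a b c d) D \<in> J.deg0"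
  using keys_push_divisor[of "moebius a b c d" D] moebius_twist_points[OF det]
  by (auto simp: J.deg0_def J'.deg0_def)

lemma Jac_map_twist_inj: "inj_on (Jac_map C' C (moebius a b c d)) (carrier (Jac C'))"
proof (rule inj_onI)
  fix x y assume "x \<in> carrier (Jac C')" "y \<in> carrier (Jac C')"
    and eq: "Jac_map C' C (moebius a b c d) x = Jac_map C' C (moebius a b c d) y"
  then obtain D E where *: "x = J'.cls D" "y = J'.cls E" "D \<in> J'.deg0" "E \<in> J'.deg0"
    by (auto simp: J'.carrier_Jac)
  hence "push_divisor (moebius a b c d) (D - E) \<in> Prin"
    using eq by (simp add: Jac_map_twist J.cls_eq_iff)
  thus "x = y" unfolding push_twist_principal_iff using * by (simp add: J'.cls_eq_iff)
qed

lemma orbit_contains_torsion_twist: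
  assumes D: "D \<in> torsion (Jac C') r" "D \<noteq> \<one>\<^bsub>Jac C'\<^esub>" and E: "E \<in> torsion (Jac C') r"
  shows "\<exists>\<psi>\<in>conjugate_endos (Jac C') (Jac_map C' C (moebius a b c d)) (Z_pi_chi_rho p \<zeta>). \<psi> D = E"
proof -
  let ?\<phi> = "Jac_map C' C (moebius a b c d)" and ?M = "push_divisor (moebius a b c d)"
  have carrier: "D \<in> carrier (Jac C')" "E \<in> carrier (Jac C')" using D E by (auto simp: torsion_def)
  then obtain D0 E0 where *: "D = J'.cls D0" "D0 \<in> J'.deg0" "E = J'.cls E0" "E0 \<in> J'.deg0"
    by (auto simp: J'.carrier_Jac)
  have "frag_cmul (int r) (?M D0) \<in> Prin" "frag_cmul (int r) (?M E0) \<in> Prin"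
    using D(1) E * by (simp_all add: J'.torsion_cls_iff push_twist_principal_iff flip: push_divisor_cmul)
  moreover have "?M D0 \<notin> Prin"
    using D(2) * by (simp add: push_twist_principal_iff J'.one_Jac J'.cls_eq_iff)
  ultimately obtain \<alpha> where \<alpha>: "\<alpha> \<in> Z_pi_chi_rho p \<zeta>" "\<alpha> (J.cls (?M D0)) = J.cls (?M E0)"
    using orbit_contains_torsion push_twist_deg0 * by blast
  hence "\<alpha> (?\<phi> D) = ?\<phi> E" using * by (simp add: Jac_map_twist)
  hence "inv_into (carrier (Jac C')) ?\<phi> (\<alpha> (?\<phi> D)) = E"
    using inv_into_f_f[OF Jac_map_twist_inj carrier(2)] by simp
  thus ?thesis using \<alpha>(1) carrier(1) by (auto simp: conjugate_endos_def)
qed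

end

lemma primitive_sixth_root:
  fixes z :: "'k::field"
  assumes "primitive_root_of_unity 6 z"
  shows "z ^ 2 = z - 1" "z ^ 4 \<noteq> 1"
proof -
  have z: "z ^ 6 = 1" "z ^ 3 \<noteq> 1" "z ^ 2 \<noteq> 1" "z ^ 4 \<noteq> 1"
    using assms by (simp_all add: primitive_root_of_unity_def)
  show "z ^ 4 \<noteq> 1" by fact
  have "(z ^ 3 - 1) * (z ^ 3 + 1) = z ^ 6 - 1" by (simp add: algebra_simps flip: power_add)
  hence "(z ^ 3 - 1) * (z ^ 3 + 1) = 0" using z(1) by simp
  hence "z ^ 3 + 1 = 0" using z(2) by simp
  moreover have "(z + 1) * (z ^ 2 - z + 1) = z ^ 3 + 1"
    by (simp add: power2_eq_square power3_eq_cube algebra_simps)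
  moreover have "z + 1 \<noteq> 0" using z(3) by (metis eq_neg_iff_add_eq_0 power2_minus power_one)
  ultimately have "z ^ 2 - z + 1 = 0" by (metis mult_eq_0_iff)
  thus "z ^ 2 = z - 1" by (simp add: algebra_simps eq_neg_iff_add_eq_0)
qed

theorem theorem7p3:
  fixes p r :: nat
    and \<zeta>6 \<zeta>3 \<gamma> a b c d :: "'k::alg_closed_field"
    and e :: "('k curve_point \<Rightarrow>\<^sub>0 int) set \<Rightarrow> ('k curve_point \<Rightarrow>\<^sub>0 int) set \<Rightarrow> 'k"
    and C' :: "'k poly"
    and \<phi> :: "('k curve_point \<Rightarrow>\<^sub>0 int) set \<Rightarrow> ('k curve_point \<Rightarrow>\<^sub>0 int) set"
  assumes "prime p" and "odd p" and "[p = 2] (mod 3)"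
    and "is_algebraic_closure_of_Fp TYPE('k) p"
    and "primitive_root_of_unity 6 \<zeta>6" and "\<zeta>3 = \<zeta>6 ^ 2"
    and "\<gamma> ^ (p ^ 2 - 1) = \<zeta>3"
    and "a = \<gamma> ^ p" and "b = inverse \<zeta>3 * \<gamma> ^ p" and "c = \<gamma>" and "d = \<zeta>3 * \<gamma>"
    and "C' = twist_sextic a b c d"
    and "\<phi> = Jac_map C' C_sextic (moebius a b c d)"
    and "prime r" and "r \<noteq> 2" and "r \<noteq> 3" and "r \<noteq> p"
    and "torsion_pairing (Jac C') r e"
    and "bilinear_pairing (Jac C') r e"
    and "nondegenerate_pairing (Jac C') r e"
    and "Galois_invariant_pairing C' r e"
  shows "\<forall>D1\<in>torsion (Jac C') r. \<forall>D2\<in>torsion (Jac C') r.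
           D1 \<noteq> \<one>\<^bsub>Jac C'\<^esub> \<and> D2 \<noteq> \<one>\<^bsub>Jac C'\<^esub> \<longrightarrow>
           (\<exists>\<psi>\<in>conjugate_endos (Jac C') \<phi> (Z_pi_chi_rho p \<zeta>6). e D1 (\<psi> D2) \<noteq> 1)"
proof -
  have char: "CHAR('k) = p" using assms(4) by (simp add: is_algebraic_closure_of_Fp_def)
  have p_mod_3: "p mod 3 = 2" using assms(3) by (simp add: cong_def)
  hence p_mod: "p mod 6 = 5" using assms(2) by presburger
  have "of_nat 2 \<noteq> (0::'k)" "of_nat 3 \<noteq> (0::'k)"
    unfolding of_nat_eq_0_iff_char_dvd char
    using assms(1,2) p_mod_3 primes_dvd_imp_eq[of p 2] primes_dvd_imp_eq[of p 3] by auto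
  hence two: "(2::'k) \<noteq> 0" and three: "(3::'k) \<noteq> 0" by simp_all
  have z: "\<zeta>6 ^ 2 = \<zeta>6 - 1" "\<zeta>6 ^ 4 \<noteq> 1" using primitive_sixth_root[OF assms(5)] by auto
  have "\<zeta>6 ^ 6 = 1" using assms(5) by (simp add: primitive_root_of_unity_def)
  hence "\<zeta>6 \<noteq> 0" by auto
  hence z3: "\<zeta>3 \<noteq> 0" "\<zeta>3 * \<zeta>3 \<noteq> 1" using z(2) assms(6) by (simp_all flip: power_add)
  have "p ^ 2 - 1 > 0" using one_less_power[OF prime_gt_1_nat[OF assms(1)], of 2] by simp
  hence g: "\<gamma> \<noteq> 0" using assms(7) z3(1) by (metis zero_power)
  have det: "a * d - b * c \<noteq> 0"
  proof
    assume "a * d - b * c = 0"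
    hence "\<gamma> ^ p * \<gamma> * (\<zeta>3 - inverse \<zeta>3) = 0"
      unfolding assms(8-11) by (simp add: algebra_simps)
    hence "\<zeta>3 = inverse \<zeta>3" using g by simp
    thus False using z3 by (metis right_inverse)
  qed
  interpret fermat_twist_torsion "TYPE('k)" \<zeta>6 p r a b c d
    using two three z(1) char assms(1) p_mod assms(14-17) det by unfold_locales auto
  show ?thesis
  proof (intro ballI impI, elim conjE)
    fix D1 D2
    assume D: "D1 \<in> torsion (Jac C') r" "D2 \<in> torsion (Jac C') r" "D1 \<noteq> \<one>\<^bsub>Jac C'\<^esub>" "D2 \<noteq> \<one>\<^bsub>Jac C'\<^esub>"
    obtain E where E: "E \<in> torsion (Jac C') r" "e D1 E \<noteq> 1"
      using assms(20) D(1,3) by (auto simp: nondegenerate_pairing_def)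
    obtain \<psi> where "\<psi> \<in> conjugate_endos (Jac C') \<phi> (Z_pi_chi_rho p \<zeta>6)" "\<psi> D2 = E"
      using orbit_contains_torsion_twist D(2,4) E(1) unfolding assms(12,13) by blast
    thus "\<exists>\<psi>\<in>conjugate_endos (Jac C') \<phi> (Z_pi_chi_rho p \<zeta>6). e D1 (\<psi> D2) \<noteq> 1"
      using E(2) by blast
  qed
qed

end
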